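(* Assume that for every $g\in\mathcal G$ there exist $h_g\in\overline{\mathcal H}^{L^2}$ and a constant $c_g\in\mathbb R$ such that $h_g=f_g-c_g$ $\mathbb P_X$-a.e. in $\mathcal X$. Let $(U,V)$ be a jointly Gaussian random variable with values in $\mathcal G\oplus\mathcal H$ and $$\begin{pmatrix} U \\ V \end{pmatrix}\sim\mathcal N\left(\begin{pmatrix} \mu_Y \\ \mu_X \end{pmatrix},\begin{pmatrix} C_Y & C_{YX} \\ C_{XY} & C_X \end{pmatrix}\right),$$ and let $\mathbb P_{\varphi(X)}$ and $\mathbb P_V$ denote the probability distributions of $\varphi(X)$ and $V$ on $\mathcal H$, respectively. Then, for $\mathbb P_V$-a.e. $v\in\mathcal H$, $$C_{U|V=v}=\mathbb E[C_{Y|X}]=\int_{\mathcal X}C_{Y|X=x}\,d\mathbb P_X(x).$$ Further, there exist $N_1,N_2\subseteq\mathcal H$ with $\mathbb P_{\varphi(X)}(N_1)=0$ and $\mathbb P_V(N_2)=0$ such that, for every $v=\varphi(x)\notin N_1\cup N_2$, $\mu_{U|V=v}=\mu_{Y|X=x}$.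
   Context: Setting. $(\Omega,\Sigma,\mathbb P)$ is a probability space, $\mathcal X$ a measurable space, $\mathcal Y$ a Borel space (Borel isomorphic to a Borel subset of $[0,1]$). $k\colon\mathcal X\times\mathcal X\to\mathbb R$ and $\ell\colon\mathcal Y\times\mathcal Y\to\mathbb R$ are symmetric positive definite kernels such that $k(x,\cdot)$ and $\ell(y,\cdot)$ are Borel measurable for all $x,y$. $\mathcal H$ and $\mathcal G$ are the RKHSs of $k$ and $\ell$, assumed separable, with canonical feature maps $\varphi(x)=k(x,\cdot)\in\mathcal H$, $\psi(y)=\ell(y,\cdot)\in\mathcal G$. $X\colon\Omega\to\mathcal X$ and $Y\colon\Omega\to\mathcal Y$ are random variables with laws $\mathbb P_X,\mathbb P_Y$; $\mathbb P_{Y|X=x}$ is a fixed regular conditional distribution of $Y$ given $X=x$ (it exists and is $\mathbb P_X$-a.e. unique). Assume $\mathbb E[\|\varphi(X)\|_{\mathcal H}^2+\|\psi(Y)\|_{\mathcal G}^2]<\infty$. Then $\mathcal X_Y=\{x\in\mathcal X:\mathbb E[\|\psi(Y)\|_{\mathcal G}^2|X=x]<\infty\}$ has full $\mathbb P_X$-measure. Assume also that for $h\in\mathcal H$, $h=0$ $\mathbb P_X$-a.e. if and only if $h=0$; thus $\mathcal H$ is viewed as a subspace of $L^2(\mathbb P_X)$; $\overline{\mathcal H}^{L^2}$ is its closure in $L^2(\mathbb P_X)$. Means and covariances. Expectations of Hilbert-space-valued variables are Bochner integrals. For square-integrable $U,V$ with values in Hilbert spaces $\mathcal G,\mathcal H$,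 $\operatorname{Cov}[U,V]=\mathbb E[(U-\mathbb E U)\otimes(V-\mathbb E V)]\colon\mathcal H\to\mathcal G$, where $(g\otimes h)(h')=\langle h,h'\rangle g$; $\operatorname{Cov}[U]=\operatorname{Cov}[U,U]$. Set $\mu_X=\mathbb E[\varphi(X)]$, $\mu_Y=\mathbb E[\psi(Y)]$, $C_X=\operatorname{Cov}[\varphi(X)]$, $C_Y=\operatorname{Cov}[\psi(Y)]$, $C_{XY}=\operatorname{Cov}[\varphi(X),\psi(Y)]\colon\mathcal G\to\mathcal H$, $C_{YX}=C_{XY}^{*}$. Conditional objects. For $x\in\mathcal X_Y$, $\mu_{Y|X=x}=\mathbb E[\psi(Y)|X=x]\in\mathcal G$ and $C_{Y|X=x}=\operatorname{Cov}[\psi(Y)|X=x]$ are the mean and covariance operator of $\psi$ under $\mathbb P_{Y|X=x}$; $\mu_{Y|X=x}=0$ on the $\mathbb P_X$-null set $\mathcal X\setminus\mathcal X_Y$. For $g\in\mathcal G$, $f_g(x)=\mathbb E[g(Y)|X=x]$ for $x\in\mathcal X_Y$ and $f_g(x)=0$ otherwise; $f_g\in L^2(\mathbb P_X)$. For the Gaussian variable $(U,V)$, the conditional distribution of $U$ given $V=v$ is, for $\mathbb P_V$-a.e. $v\in\mathcal H$, a Gaussian measure on $\mathcal G$; $\mu_{U|V=v}$ and $C_{U|V=v}$ denote its mean and covariance operator.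
   Formalization: The final identity μ_{U|V=v} = μ_{Y|X=x} is proved for a suitable version of the regular conditional distribution P_{Y|X=x}, equal to the fixed one P_X-a.e.; for an arbitrary fixed version it can fail (e.g. constant kernel k = 1, law altered at one x). *)

theory Defs
  imports "HOL-Probability.Probability"
begin

definition borel_iso_space :: "'y measure \<Rightarrow> bool" where
  "borel_iso_space M \<longleftrightarrow>
     (\<exists>B f g. B \<in> sets (borel :: real measure) \<and> B \<subseteq> {0..1}
        \<and> f \<in> M \<rightarrow>\<^sub>M restrict_space borel B \<and> g \<in> restrict_space borel B \<rightarrow>\<^sub>M M
        \<and> (\<forall>y\<in>space M. g (f y) = y) \<and> (\<forall>t\<in>B. f (g t) = t))"

definition psd_kernel :: "'x set \<Rightarrow> ('x \<Rightarrow> 'x \<Rightarrow> real) \<Rightarrow> bool" where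
  "psd_kernel S k \<longleftrightarrow>
     (\<forall>x\<in>S. \<forall>y\<in>S. k x y = k y x)
     \<and> (\<forall>(n::nat) x a. (\<forall>i<n. x i \<in> S) \<longrightarrow> 0 \<le> (\<Sum>i<n. \<Sum>j<n. a i * a j * k (x i) (x j)))"

(* The RKHS of k on S is carried by a Hilbert space type 'h: the vector h stands for the function
   "val h" on S. Two vectors giving the same function on S are equal, phi x is the function k x, and
   the reproducing property holds (by which the vector operations are the pointwise ones on S). *)
definition is_rkhs ::
  "'x set \<Rightarrow> ('x \<Rightarrow> 'x \<Rightarrow> real) \<Rightarrow> ('h::{real_inner,banach} \<Rightarrow> 'x \<Rightarrow> real) \<Rightarrow> ('x \<Rightarrow> 'h) \<Rightarrow> bool" where
  "is_rkhs S k val \<phi> \<longleftrightarrow>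
     (\<forall>h h'. (\<forall>x\<in>S. val h x = val h' x) \<longrightarrow> h = h')
     \<and> (\<forall>x\<in>S. \<forall>y\<in>S. val (\<phi> x) y = k x y)
     \<and> (\<forall>h. \<forall>x\<in>S. val h x = h \<bullet> \<phi> x)"

(* Functions (not classes) whose class lies in the closure in L2(M) of the functions "val h". *)
definition L2_closure :: "'x measure \<Rightarrow> ('h \<Rightarrow> 'x \<Rightarrow> real) \<Rightarrow> ('x \<Rightarrow> real) set" where
  "L2_closure M val =
     {f. f \<in> borel_measurable M \<and> integrable M (\<lambda>x. (f x)\<^sup>2)
       \<and> (\<forall>\<epsilon>>0. \<exists>h. (\<integral>\<^sup>+x. ennreal ((val h x - f x)\<^sup>2) \<partial>M) < ennreal \<epsilon>)}"

(* Determined by the law of (X, Y) only up to a null set of x. This matters for claims of the form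
   "for all x with phi x outside a null set of H": if k = 1, then phi is constant, and altering
   kappa at a single non-atom x0 falsifies such a claim. The main theorem therefore makes that
   claim for a suitable version kappa' of kappa, equal to kappa almost everywhere. *)
definition is_rcd ::
  "'w measure \<Rightarrow> 'x measure \<Rightarrow> 'y measure \<Rightarrow> ('w \<Rightarrow> 'x) \<Rightarrow> ('w \<Rightarrow> 'y) \<Rightarrow> ('x \<Rightarrow> 'y measure) \<Rightarrow> bool" where
  "is_rcd P MX MY X Y \<kappa> \<longleftrightarrow>
     \<kappa> \<in> MX \<rightarrow>\<^sub>M prob_algebra MY
     \<and> (\<forall>A\<in>sets MX. \<forall>B\<in>sets MY.
          emeasure P {\<omega>\<in>space P. X \<omega> \<in> A \<and> Y \<omega> \<in> B}
            = (\<integral>\<^sup>+x\<in>A. emeasure (\<kappa> x) B \<partial>distr P MX X))"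

(* The library's has_bochner_integral requires a second-countable codomain, which the space of
   bounded operators is not. This is the same definition without that restriction; convergence
   is in the norm of 'b, for operators the operator norm. *)
definition has_banach_integral :: "'a measure \<Rightarrow> ('a \<Rightarrow> 'b::real_normed_vector) \<Rightarrow> 'b \<Rightarrow> bool" where
  "has_banach_integral M f I \<longleftrightarrow>
     f \<in> borel_measurable M
     \<and> (\<exists>s. (\<forall>i. Bochner_Integration.simple_bochner_integrable M (s i))
          \<and> (\<lambda>i. \<integral>\<^sup>+x. ennreal (norm (f x - s i x)) \<partial>M) \<longlonglongrightarrow> 0
          \<and> (\<lambda>i. Bochner_Integration.simple_bochner_integral M (s i)) \<longlonglongrightarrow> I)"

definition banach_integral :: "'a measure \<Rightarrow> ('a \<Rightarrow> 'b::real_normed_vector) \<Rightarrow> 'b" where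
  "banach_integral M f =
     (if \<exists>I. has_banach_integral M f I then THE I. has_banach_integral M f I else 0)"

lift_definition tensor_op :: "'g::real_inner \<Rightarrow> 'h::real_inner \<Rightarrow> 'h \<Rightarrow>\<^sub>L 'g"
  is "\<lambda>g h h'. (h \<bullet> h') *\<^sub>R g"
  by (intro bounded_linear_scaleR_const bounded_linear_inner_right)

definition Cov ::
  "'a measure \<Rightarrow> ('a \<Rightarrow> 'g::{real_inner,banach,second_countable_topology})
     \<Rightarrow> ('a \<Rightarrow> 'h::{real_inner,banach,second_countable_topology}) \<Rightarrow> 'h \<Rightarrow>\<^sub>L 'g" where
  "Cov M U V =
     banach_integral M (\<lambda>\<omega>. tensor_op (U \<omega> - (\<integral>\<omega>'. U \<omega>' \<partial>M)) (V \<omega> - (\<integral>\<omega>'. V \<omega>' \<partial>M)))"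

definition cond_domain ::
  "'x measure \<Rightarrow> ('x \<Rightarrow> 'y measure) \<Rightarrow> ('y \<Rightarrow> 'g::real_normed_vector) \<Rightarrow> 'x set" where
  "cond_domain MX \<kappa> \<psi> = {x\<in>space MX. (\<integral>\<^sup>+y. ennreal ((norm (\<psi> y))\<^sup>2) \<partial>\<kappa> x) < \<infinity>}"

definition cond_mean ::
  "'x measure \<Rightarrow> ('x \<Rightarrow> 'y measure) \<Rightarrow> ('y \<Rightarrow> 'g::{real_inner,banach,second_countable_topology})
     \<Rightarrow> 'x \<Rightarrow> 'g" where
  "cond_mean MX \<kappa> \<psi> x = (if x \<in> cond_domain MX \<kappa> \<psi> then \<integral>y. \<psi> y \<partial>\<kappa> x else 0)"

definition cond_cov ::
  "'x measure \<Rightarrow> ('x \<Rightarrow> 'y measure) \<Rightarrow> ('y \<Rightarrow> 'g::{real_inner,banach,second_countable_topology})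
     \<Rightarrow> 'x \<Rightarrow> 'g \<Rightarrow>\<^sub>L 'g" where
  "cond_cov MX \<kappa> \<psi> x = (if x \<in> cond_domain MX \<kappa> \<psi> then Cov (\<kappa> x) \<psi> \<psi> else 0)"

definition cond_fun ::
  "'x measure \<Rightarrow> ('x \<Rightarrow> 'y measure) \<Rightarrow> ('y \<Rightarrow> 'g::{real_inner,banach,second_countable_topology})
     \<Rightarrow> ('g \<Rightarrow> 'y \<Rightarrow> real) \<Rightarrow> 'g \<Rightarrow> 'x \<Rightarrow> real" where
  "cond_fun MX \<kappa> \<psi> val g x = (if x \<in> cond_domain MX \<kappa> \<psi> then \<integral>y. val g y \<partial>\<kappa> x else 0)"

(* The variance is v; a normal law of variance 0 is a point mass. *)
definition normal_law :: "real \<Rightarrow> real \<Rightarrow> real measure" where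
  "normal_law m v =
     (if v = 0 then return borel m
      else density lborel (\<lambda>x. ennreal (normal_density m (sqrt v) x)))"

(* N(m, C), possibly degenerate: every continuous linear functional is normally distributed, with
   the mean and the variance given by m and C. *)
definition gaussian_measure :: "'z::real_inner measure \<Rightarrow> 'z \<Rightarrow> ('z \<Rightarrow> 'z) \<Rightarrow> bool" where
  "gaussian_measure \<nu> m C \<longleftrightarrow>
     sets \<nu> = sets borel \<and> bounded_linear C
     \<and> (\<forall>a b. C a \<bullet> b = a \<bullet> C b) \<and> (\<forall>a. 0 \<le> C a \<bullet> a)
     \<and> (\<forall>a. distr \<nu> borel (\<lambda>z. a \<bullet> z) = normal_law (a \<bullet> m) (C a \<bullet> a))"

definition block_op ::
  "('g::real_inner \<Rightarrow> 'g) \<Rightarrow> ('h::real_inner \<Rightarrow> 'g) \<Rightarrow> ('g \<Rightarrow> 'h) \<Rightarrow> ('h \<Rightarrow> 'h) \<Rightarrow> 'g \<times> 'h \<Rightarrow> 'g \<times> 'h" where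
  "block_op A B C D = (\<lambda>(g, h). (A g + B h, C g + D h))"

end

theory Submission
  imports Defs
begin

text \<open>
  Let \<open>m x\<close> be the mean of \<open>\<psi>\<close> under \<open>\<kappa> x\<close>, and let \<open>\<alpha>\<close>, \<open>\<beta>\<close> be the means of \<open>\<psi> (Y)\<close> and
  \<open>\<phi> (X)\<close>. The Gaussian pair \<open>(U, V)\<close> has the first and second moments of \<open>(\<psi> (Y), \<phi> (X))\<close>. Hence
  sending \<open>a \<bullet> (\<psi> (Y) - \<alpha>) + h \<bullet> (\<phi> (X) - \<beta>)\<close> to \<open>a \<bullet> (U - \<alpha>) + h \<bullet> (V - \<beta>)\<close> preserves second
  moments, and whatever the \<open>L\<^sup>2\<close> geometry says about linear functionals of \<open>(\<psi> (Y), \<phi> (X))\<close> holds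
  for \<open>(U, V)\<close> as well.

  Fix \<open>a\<close>. By hypothesis, \<open>a \<bullet> m (X)\<close> is, up to a constant, an \<open>L\<^sup>2\<close> limit of variables
  \<open>h n \<bullet> \<phi> (X)\<close>. By isometry the variables \<open>h n \<bullet> (V - \<beta>)\<close> form a Cauchy sequence in \<open>L\<^sup>2\<close>; for a fast
  sequence both converge almost surely, the second one to \<open>r (V)\<close> with
  \<open>r v = lim (h n \<bullet> (v - \<beta>))\<close>. The variable \<open>Z = a \<bullet> (U - \<alpha>) - r (V)\<close> corresponds to the residual
  \<open>a \<bullet> (\<psi> (Y) - m (X))\<close>, which is orthogonal to every square integrable function of \<open>X\<close>. So \<open>Z\<close> is
  Gaussian and uncorrelated with every \<open>h \<bullet> V\<close>, and because the pair is jointly Gaussian it is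
  independent of \<open>V\<close> (\<open>linear_regression_limit\<close>). Given \<open>V = v\<close>, therefore, \<open>a \<bullet> U\<close> has mean
  \<open>r v + a \<bullet> \<alpha>\<close>, and its variance is the second moment of the residual, whatever \<open>v\<close> is
  (\<open>regression_function\<close>). This second moment is the value at \<open>a\<close> of the quadratic form of the
  expected conditional covariance, and polarisation along a countable frame gives the first claim
  (\<open>gaussian_cond_cov_constant\<close>).

  The same function \<open>r\<close> evaluated at \<open>\<phi> x\<close> gives \<open>a \<bullet> (m x - \<alpha>)\<close> for almost every \<open>x\<close>, which is the
  second claim except for exceptional points \<open>x\<close> that cannot be described through \<open>\<phi> x\<close> alone. On this null
  set of points the version \<open>\<kappa>'\<close> takes the conditional law of \<open>Y\<close> given \<open>\<phi> (X) = \<phi> x\<close>: by the tower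
  property the mean of that law is described by \<open>r\<close> too, up to a null set of values of \<open>\<phi> (X)\<close>
  (\<open>gaussian_cond_mean_version\<close>).

  Three ingredients support this. Covariance operators live in a non-separable Banach space, so
  Bochner integrals there are built from limits of simple functions; conditional covariances fit in
  since they are operator-norm limits of finite matrices. Independence of \<open>Z\<close> and \<open>V\<close> needs the
  uniqueness of Fourier transforms on a Hilbert space, which is reduced to the real line by treating
  one coordinate at a time. Conditional laws given \<open>\<phi> (X)\<close> are obtained from conditional distribution
  functions at rational levels.
\<close>

section \<open>Orthonormal expansions in separable inner product spaces\<close>

text \<open>
  A vector \<open>d n\<close> that depends linearly on its predecessors is sent to \<open>sgn 0 = 0\<close>, so that the members have
  norm \<open>0\<close> or \<open>1\<close> and no thinning of the sequence \<open>d\<close> is required.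
\<close>

function gram_schmidt :: "(nat \<Rightarrow> 'a::real_inner) \<Rightarrow> nat \<Rightarrow> 'a" where
  "gram_schmidt d n = sgn (d n - (\<Sum>i<n. (d n \<bullet> gram_schmidt d i) *\<^sub>R gram_schmidt d i))"
  by auto
termination by (relation "Wellfounded.measure snd") auto

declare gram_schmidt.simps [simp del]

definition gs_proj :: "(nat \<Rightarrow> 'a::real_inner) \<Rightarrow> nat \<Rightarrow> 'a \<Rightarrow> 'a" where
  "gs_proj d n v = (\<Sum>i<n. (v \<bullet> gram_schmidt d i) *\<^sub>R gram_schmidt d i)"

lemma gram_schmidt_eq: "gram_schmidt d n = sgn (d n - gs_proj d n (d n))"
  unfolding gs_proj_def by (rule gram_schmidt.simps)

lemma gram_schmidt_inner_self:
  "gram_schmidt d i = 0 \<or> gram_schmidt d i \<bullet> gram_schmidt d i = 1"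
  unfolding gram_schmidt_eq
  by (cases "d i - gs_proj d i (d i) = 0")
     (auto simp: dot_square_norm norm_sgn)

lemma gram_schmidt_orthogonal_less:
  "i < n \<Longrightarrow> gram_schmidt d n \<bullet> gram_schmidt d i = 0"
proof (induction n arbitrary: i rule: less_induct)
  case (less n)
  let ?e = "gram_schmidt d"
  have orth: "?e j \<bullet> ?e i = 0" if "j < n" "j \<noteq> i" for j
    using less.IH[of j i] less.IH[of i j] less.prems that
    by (cases j i rule: linorder_cases) (auto simp: inner_commute)
  have "gs_proj d n (d n) \<bullet> ?e i = (\<Sum>j<n. (d n \<bullet> ?e j) * (?e j \<bullet> ?e i))"
    by (simp add: gs_proj_def inner_sum_left)
  also have "\<dots> = (\<Sum>j<n. if j = i then (d n \<bullet> ?e i) * (?e i \<bullet> ?e i) else 0)"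
    by (intro sum.cong) (auto simp: orth)
  also have "\<dots> = (d n \<bullet> ?e i) * (?e i \<bullet> ?e i)"
    using less.prems by simp
  also have "\<dots> = d n \<bullet> ?e i"
    using gram_schmidt_inner_self[of d i] by auto
  finally show ?case
    by (subst gram_schmidt_eq) (simp add: sgn_div_norm inner_diff_left)
qed

lemma gram_schmidt_orthogonal: "i \<noteq> j \<Longrightarrow> gram_schmidt d i \<bullet> gram_schmidt d j = 0"
  using gram_schmidt_orthogonal_less[of i j d] gram_schmidt_orthogonal_less[of j i d]
  by (cases i j rule: linorder_cases) (auto simp: inner_commute)

lemma gs_proj_inner:
  "gs_proj d n v \<bullet> gram_schmidt d i = (if i < n then v \<bullet> gram_schmidt d i else 0)"
proof -
  let ?e = "gram_schmidt d"
  have "gs_proj d n v \<bullet> ?e i = (\<Sum>j<n. if j = i then (v \<bullet> ?e i) * (?e i \<bullet> ?e i) else 0)"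
    unfolding gs_proj_def inner_sum_left
    by (intro sum.cong) (auto simp: gram_schmidt_orthogonal)
  then show ?thesis
    using gram_schmidt_inner_self[of d i] by auto
qed

lemma gs_proj_diff: "gs_proj d n (v - w) = gs_proj d n v - gs_proj d n w"
  by (simp add: gs_proj_def inner_diff_left scaleR_diff_left sum_subtractf)

lemma gs_proj_norm_square: "(norm (gs_proj d n v))\<^sup>2 = (\<Sum>i<n. (v \<bullet> gram_schmidt d i)\<^sup>2)"
proof -
  have "(norm (gs_proj d n v))\<^sup>2 = gs_proj d n v \<bullet> (\<Sum>i<n. (v \<bullet> gram_schmidt d i) *\<^sub>R gram_schmidt d i)"
    by (simp add: gs_proj_def power2_norm_eq_inner)
  also have "\<dots> = (\<Sum>i<n. (v \<bullet> gram_schmidt d i)\<^sup>2)"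
    by (simp add: inner_sum_right gs_proj_inner power2_eq_square)
  finally show ?thesis .
qed

lemma gs_proj_pythagoras:
  "(norm v)\<^sup>2 = (norm (v - gs_proj d n v))\<^sup>2 + (\<Sum>i<n. (v \<bullet> gram_schmidt d i)\<^sup>2)"
proof -
  have "v \<bullet> gs_proj d n v = (\<Sum>i<n. (v \<bullet> gram_schmidt d i)\<^sup>2)"
    by (simp add: gs_proj_def inner_sum_right power2_eq_square)
  then have "v \<bullet> gs_proj d n v = gs_proj d n v \<bullet> gs_proj d n v"
    by (simp add: gs_proj_norm_square[symmetric] power2_norm_eq_inner)
  then show ?thesis
    by (simp add: gs_proj_norm_square[symmetric] power2_norm_eq_inner inner_diff_left inner_diff_right
        inner_commute)
qed

text \<open>
  By construction \<open>d m\<close> is a combination of \<open>gram_schmidt d 0, \<dots>, gram_schmidt d m\<close>, and the later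
  vectors are orthogonal to it.
\<close>

lemma gs_proj_fixes:
  assumes "m < n"
  shows "gs_proj d n (d m) = d m"
proof -
  let ?e = "gram_schmidt d"
  define r where "r = d m - gs_proj d m (d m)"
  have dm: "d m = gs_proj d m (d m) + norm r *\<^sub>R ?e m"
  proof -
    have "norm r *\<^sub>R sgn r = r" by (cases "r = 0") (simp_all add: sgn_div_norm)
    moreover have "?e m = sgn r" unfolding r_def by (rule gram_schmidt_eq)
    ultimately have "norm r *\<^sub>R ?e m = r" by simp
    then show ?thesis unfolding r_def by simp
  qed
  have zero: "d m \<bullet> ?e i = 0" if "m < i" for i
    by (subst dm) (use that in \<open>simp add: inner_add_left gs_proj_inner gram_schmidt_orthogonal\<close>)
  have "(d m \<bullet> ?e m) *\<^sub>R ?e m = norm r *\<^sub>R ?e m"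
    by (subst dm) (use gram_schmidt_inner_self[of d m] in \<open>auto simp: inner_add_left gs_proj_inner\<close>)
  moreover have "gs_proj d (Suc m) (d m) = gs_proj d m (d m) + (d m \<bullet> ?e m) *\<^sub>R ?e m"
    by (simp add: gs_proj_def)
  ultimately have "gs_proj d (Suc m) (d m) = d m"
    using dm by metis
  moreover have "gs_proj d n (d m) = gs_proj d (Suc m) (d m)"
    unfolding gs_proj_def by (rule sum.mono_neutral_right) (use assms zero in auto)
  ultimately show ?thesis by simp
qed

text \<open>
  For \<open>m < n\<close>, the error \<open>v - gs_proj d n v\<close> does not change when \<open>v\<close> is replaced by \<open>v - d m\<close>, so by
  Pythagoras its norm is at most \<open>norm (v - d m)\<close>.
\<close>

lemma gs_proj_tendsto:
  assumes "v \<in> closure (range d)"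
  shows "(\<lambda>n. gs_proj d n v) \<longlonglongrightarrow> v"
proof (rule LIMSEQ_I)
  fix r :: real assume "0 < r"
  then obtain m where m: "dist (d m) v < r"
    using assms unfolding closure_approachable by auto
  show "\<exists>no. \<forall>n\<ge>no. norm (gs_proj d n v - v) < r"
  proof (intro exI[of _ "Suc m"] allI impI)
    fix n assume "Suc m \<le> n"
    then have "v - gs_proj d n v = (v - d m) - gs_proj d n (v - d m)"
      by (simp add: gs_proj_diff gs_proj_fixes)
    moreover have "(norm ((v - d m) - gs_proj d n (v - d m)))\<^sup>2 \<le> (norm (v - d m))\<^sup>2"
      using gs_proj_pythagoras[of "v - d m" d n] by (simp add: sum_nonneg)
    ultimately have "norm (v - gs_proj d n v) \<le> norm (v - d m)"
      by (metis norm_ge_zero power2_le_imp_le)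
    then show "norm (gs_proj d n v - v) < r"
      using m by (simp add: dist_norm norm_minus_commute)
  qed
qed

text \<open>
  Zero vectors may occur among the \<open>e i\<close>: this is a Parseval frame, and a basis only after they are
  discarded.
\<close>

lemma obtain_parseval_frame:
  obtains e :: "nat \<Rightarrow> 'a::{real_inner,second_countable_topology}" where
    "\<And>v. (\<lambda>n. \<Sum>i<n. (v \<bullet> e i) *\<^sub>R e i) \<longlonglongrightarrow> v"
    "\<And>v n. norm (\<Sum>i<n. (v \<bullet> e i) *\<^sub>R e i) \<le> norm v"
    "\<And>v. (\<lambda>i. (v \<bullet> e i)\<^sup>2) sums (norm v)\<^sup>2"
proof -
  obtain D :: "'a set" where D: "countable D" "\<And>X. open X \<Longrightarrow> X \<noteq> {} \<Longrightarrow> \<exists>d\<in>D. d \<in> X"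
    by (rule countable_dense_setE) blast
  have "D \<noteq> {}" using D(2)[of UNIV] by auto
  then have d: "range (from_nat_into D) = D"
    using D(1) by (rule range_from_nat_into)
  define d where "d = from_nat_into D"
  have "v \<in> closure (range d)" for v
    unfolding closure_approachable
  proof safe
    fix r :: real assume "0 < r"
    then show "\<exists>y\<in>range d. dist y v < r"
      using D(2)[of "ball v r"] d unfolding d_def by (auto simp: dist_commute)
  qed
  then have lim: "(\<lambda>n. gs_proj d n v) \<longlonglongrightarrow> v" for v
    by (rule gs_proj_tendsto)
  show thesis
  proof (rule that[of "gram_schmidt d"])
    fix v :: 'a
    show "(\<lambda>n. \<Sum>i<n. (v \<bullet> gram_schmidt d i) *\<^sub>R gram_schmidt d i) \<longlonglongrightarrow> v"
      using lim[of v] by (simp add: gs_proj_def)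
    show "norm (\<Sum>i<n. (v \<bullet> gram_schmidt d i) *\<^sub>R gram_schmidt d i) \<le> norm v" for n
    proof -
      have "(norm (gs_proj d n v))\<^sup>2 \<le> (norm v)\<^sup>2"
        using gs_proj_pythagoras[of v d n] gs_proj_norm_square[of d n v] by simp
      then have "norm (gs_proj d n v) \<le> norm v"
        by (rule power2_le_imp_le) simp
      then show ?thesis by (simp add: gs_proj_def)
    qed
    have "(\<lambda>n. (norm (gs_proj d n v))\<^sup>2) \<longlonglongrightarrow> (norm v)\<^sup>2"
      by (intro tendsto_intros lim)
    then show "(\<lambda>i. (v \<bullet> gram_schmidt d i)\<^sup>2) sums (norm v)\<^sup>2"
      by (simp add: sums_def gs_proj_norm_square)
  qed
qed

text \<open>
  Expanding \<open>v\<close> along a Gram-Schmidt sequence of a dense subset of \<open>S\<close> gives a Cauchy sequence by Bessel's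
  inequality; its limit is the orthogonal projection of \<open>v\<close> onto \<open>S\<close>.
\<close>

lemma closed_subspace_trivial_complement:
  fixes S :: "'a::{real_inner,banach,second_countable_topology} set"
  assumes S: "subspace S" "closed S" and triv: "\<And>v. (\<And>s. s \<in> S \<Longrightarrow> v \<bullet> s = 0) \<Longrightarrow> v = 0"
  shows "v \<in> S"
proof -
  obtain T where T: "countable T" "T \<subseteq> S" "S \<subseteq> closure T"
    using separable[of S] by metis
  have "S \<noteq> {}" using S(1) subspace_0 by blast
  with T(3) have "T \<noteq> {}" by auto
  define d where "d = from_nat_into T"
  have d: "range d = T"
    unfolding d_def using \<open>T \<noteq> {}\<close> T(1) by (rule range_from_nat_into)
  let ?e = "gram_schmidt d"
  have proj_mem: "gs_proj d n w \<in> S" if "\<And>i. i < n \<Longrightarrow> ?e i \<in> S" for n w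
    unfolding gs_proj_def using that by (intro subspace_sum subspace_scale S) auto
  have e_mem: "?e n \<in> S" for n
  proof (induction n rule: less_induct)
    case (less n)
    then show ?case
      by (subst gram_schmidt_eq)
         (use d T(2) in \<open>auto simp: sgn_div_norm intro!: subspace_scale[OF S(1)] subspace_diff[OF S(1)] proj_mem\<close>)
  qed
  have summ: "summable (\<lambda>i. (v \<bullet> ?e i)\<^sup>2)"
  proof (rule bounded_imp_summable)
    show "(\<Sum>i\<le>n. (v \<bullet> ?e i)\<^sup>2) \<le> (norm v)\<^sup>2" for n
      using gs_proj_pythagoras[of v d "Suc n"] by (simp add: lessThan_Suc_atMost)
  qed simp
  have "Cauchy (\<lambda>n. gs_proj d n v)"
  proof (rule CauchyI')
    fix r :: real assume "0 < r"
    then obtain N where N: "\<And>m n. m \<ge> N \<Longrightarrow> norm (\<Sum>i=m..<n. (v \<bullet> ?e i)\<^sup>2) < r\<^sup>2"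
      using summ[unfolded summable_Cauchy] by (metis zero_less_power)
    show "\<exists>M. \<forall>m\<ge>M. \<forall>n>m. dist (gs_proj d m v) (gs_proj d n v) < r"
    proof (intro exI[of _ N] allI impI)
      fix m n assume mn: "N \<le> m" "m < n"
      have split: "(\<Sum>i<n. f i) = (\<Sum>i<m. f i) + (\<Sum>i=m..<n. f i)" for f :: "nat \<Rightarrow> 'b::comm_monoid_add"
        using mn sum.atLeastLessThan_concat[of 0 m n f] by (simp add: lessThan_atLeast0)
      have "(norm (gs_proj d n v - gs_proj d m v))\<^sup>2 = (\<Sum>i=m..<n. (v \<bullet> ?e i)\<^sup>2)"
      proof -
        have "gs_proj d m v \<bullet> gs_proj d n v = (\<Sum>i<m. (v \<bullet> ?e i)\<^sup>2)"
          by (subst (2) gs_proj_def)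
             (simp add: inner_sum_right inner_add_right gs_proj_inner split power2_eq_square)
        then have "(norm (gs_proj d n v - gs_proj d m v))\<^sup>2
            = (norm (gs_proj d n v))\<^sup>2 - (\<Sum>i<m. (v \<bullet> ?e i)\<^sup>2)"
          using gs_proj_norm_square[of d m v]
          by (simp add: power2_norm_eq_inner inner_diff_left inner_diff_right inner_commute)
        then show ?thesis
          by (simp add: gs_proj_norm_square split)
      qed
      also have "\<dots> < r\<^sup>2"
        using N[of m n] mn by (simp add: sum_nonneg)
      finally have "norm (gs_proj d n v - gs_proj d m v) < r"
        using \<open>0 < r\<close> by (simp add: power2_less_imp_less)
      then show "dist (gs_proj d m v) (gs_proj d n v) < r"
        by (simp add: dist_norm norm_minus_commute)
    qed
  qed
  then obtain p where p: "(\<lambda>n. gs_proj d n v) \<longlonglongrightarrow> p"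
    using Cauchy_convergent convergent_def by blast
  have pS: "p \<in> S"
    by (rule closed_sequentially[OF S(2) _ p]) (intro proj_mem e_mem)
  have pe: "(v - p) \<bullet> ?e i = 0" for i
  proof -
    have "(\<lambda>n. gs_proj d n v \<bullet> ?e i) \<longlonglongrightarrow> p \<bullet> ?e i"
      by (intro tendsto_intros p)
    moreover have "(\<lambda>n. gs_proj d n v \<bullet> ?e i) \<longlonglongrightarrow> v \<bullet> ?e i"
      by (rule tendsto_eventually, rule eventually_sequentiallyI[of "Suc i"]) (simp add: gs_proj_inner)
    ultimately show ?thesis
      using LIMSEQ_unique by (fastforce simp: inner_diff_left)
  qed
  have pd: "(v - p) \<bullet> d m = 0" for m
  proof -
    have "(v - p) \<bullet> d m = (v - p) \<bullet> gs_proj d (Suc m) (d m)"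
      by (simp add: gs_proj_fixes)
    also have "\<dots> = 0"
      by (simp only: gs_proj_def inner_sum_right inner_scaleR_right pe) simp
    finally show ?thesis .
  qed
  have "v - p = 0"
  proof (rule triv)
    fix s assume "s \<in> S"
    then have "s \<in> closure T" using T(3) by auto
    moreover have "closure T \<subseteq> {s. (v - p) \<bullet> s = 0}"
      by (rule closure_minimal) (use pd d in \<open>auto intro!: closed_Collect_eq continuous_intros\<close>)
    ultimately show "(v - p) \<bullet> s = 0" by auto
  qed
  with pS show ?thesis by simp
qed

text \<open>
  The finite expansions of \<open>f\<close> along a frame are measurable and converge pointwise to \<open>f\<close>.
\<close>

lemma borel_measurable_weakly:
  fixes f :: "'x \<Rightarrow> 'a::{real_inner,second_countable_topology}"
  assumes "\<And>h. (\<lambda>x. h \<bullet> f x) \<in> borel_measurable M"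
  shows "f \<in> borel_measurable M"
proof -
  obtain e :: "nat \<Rightarrow> 'a" where e: "\<And>v. (\<lambda>n. \<Sum>i<n. (v \<bullet> e i) *\<^sub>R e i) \<longlonglongrightarrow> v"
    by (rule obtain_parseval_frame) blast
  have [measurable]: "(\<lambda>x. f x \<bullet> e i) \<in> borel_measurable M" for i
    using assms[of "e i"] by (simp add: inner_commute)
  show ?thesis
    by (rule borel_measurable_LIMSEQ_metric[where f="\<lambda>n x. \<Sum>i<n. (f x \<bullet> e i) *\<^sub>R e i"])
       (auto intro: e)
qed

text \<open>
  The vectors \<open>h\<close> for which \<open>x \<mapsto> h \<bullet> \<phi> x\<close> is measurable form a closed subspace that contains all \<open>\<phi> x\<close>. A
  vector orthogonal to every \<open>\<phi> x\<close> stands for the zero function, so this subspace is everything, and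
  weak measurability suffices.
\<close>

lemma rkhs_feature_measurable:
  fixes val :: "'h::{real_inner,banach,second_countable_topology} \<Rightarrow> 'x \<Rightarrow> real"
  assumes rkhs: "is_rkhs (space M) k val \<phi>" and k: "\<And>x. x \<in> space M \<Longrightarrow> k x \<in> borel_measurable M"
  shows "\<phi> \<in> borel_measurable M"
proof (rule borel_measurable_weakly)
  fix h :: 'h
  let ?S = "{h::'h. (\<lambda>x. h \<bullet> \<phi> x) \<in> borel_measurable M}"
  have "h \<in> ?S"
  proof (rule closed_subspace_trivial_complement)
    show "subspace ?S"
      by (rule subspaceI) (auto simp: inner_add_left)
    show "closed ?S"
      unfolding closed_sequential_limits
    proof safe
      fix s :: "nat \<Rightarrow> 'h" and l assume s: "\<forall>n. s n \<in> ?S" and l: "s \<longlonglongrightarrow> l"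
      show "(\<lambda>x. l \<bullet> \<phi> x) \<in> borel_measurable M"
        by (rule borel_measurable_LIMSEQ_metric[where f="\<lambda>n x. s n \<bullet> \<phi> x"])
           (use s l in \<open>auto intro!: tendsto_intros\<close>)
    qed
    fix v assume v: "\<And>s. s \<in> ?S \<Longrightarrow> v \<bullet> s = 0"
    have "val v x = val 0 x" if x: "x \<in> space M" for x
    proof -
      have "\<phi> x \<bullet> \<phi> y = k x y" if "y \<in> space M" for y
        using rkhs x that unfolding is_rkhs_def by metis
      then have "(\<lambda>y. \<phi> x \<bullet> \<phi> y) \<in> borel_measurable M \<longleftrightarrow> k x \<in> borel_measurable M"
        by (intro measurable_cong) auto
      with k[OF x] have "\<phi> x \<in> ?S" by simp
      from v[OF this] show ?thesis
        using rkhs x unfolding is_rkhs_def by simp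
    qed
    moreover have "\<forall>h h'. (\<forall>x\<in>space M. val h x = val h' x) \<longrightarrow> h = h'"
      using rkhs unfolding is_rkhs_def by simp
    ultimately show "v = 0" by simp
  qed
  then show "(\<lambda>x. h \<bullet> \<phi> x) \<in> borel_measurable M" by simp
qed

section \<open>Bochner integrals with values in non-separable Banach spaces\<close>

text \<open>
  In a space without a countable base, sums of Borel functions need not be Borel. Limits of simple functions
  are stable under sums, continuous maps and limits, and they suffice for integration.
\<close>

definition strongly_measurable :: "'a measure \<Rightarrow> ('a \<Rightarrow> 'b::metric_space) \<Rightarrow> bool" where
  "strongly_measurable M f \<longleftrightarrow>
     (\<exists>s. (\<forall>i. simple_function M (s i)) \<and> (\<forall>x\<in>space M. (\<lambda>i. s i x) \<longlonglongrightarrow> f x))"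

lemma strongly_measurable_borel: "strongly_measurable M f \<Longrightarrow> f \<in> borel_measurable M"
  unfolding strongly_measurable_def
  by (metis borel_measurable_LIMSEQ_metric borel_measurable_simple_function)

lemma strongly_measurable_separable:
  fixes f :: "'a \<Rightarrow> 'b::{metric_space,second_countable_topology}"
  assumes "f \<in> borel_measurable M"
  shows "strongly_measurable M f"
  using borel_measurable_implies_sequence_metric[OF assms, of undefined]
  unfolding strongly_measurable_def by blast

lemma strongly_measurable_compose:
  assumes "strongly_measurable M f" "continuous_on UNIV T"
  shows "strongly_measurable M (\<lambda>x. T (f x))"
proof -
  obtain s where s: "\<And>i. simple_function M (s i)" "\<And>x. x \<in> space M \<Longrightarrow> (\<lambda>i. s i x) \<longlonglongrightarrow> f x"
    using assms(1) unfolding strongly_measurable_def by metis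
  have "isCont T y" for y
    using assms(2) by (simp add: continuous_on_eq_continuous_at)
  then have "\<forall>x\<in>space M. (\<lambda>i. T (s i x)) \<longlonglongrightarrow> T (f x)"
    using s(2) by (auto intro: isCont_tendsto_compose)
  moreover have "simple_function M (\<lambda>x. T (s i x))" for i
    using s(1) by (rule simple_function_compose1)
  ultimately show ?thesis
    unfolding strongly_measurable_def
    by (intro exI[of _ "\<lambda>i x. T (s i x)"]) simp
qed

lemma strongly_measurable_add:
  fixes f g :: "'a \<Rightarrow> 'b::real_normed_vector"
  assumes "strongly_measurable M f" "strongly_measurable M g"
  shows "strongly_measurable M (\<lambda>x. f x + g x)"
proof -
  obtain s where s: "\<And>i. simple_function M (s i)" "\<And>x. x \<in> space M \<Longrightarrow> (\<lambda>i. s i x) \<longlonglongrightarrow> f x"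
    using assms(1) unfolding strongly_measurable_def by metis
  obtain t where t: "\<And>i. simple_function M (t i)" "\<And>x. x \<in> space M \<Longrightarrow> (\<lambda>i. t i x) \<longlonglongrightarrow> g x"
    using assms(2) unfolding strongly_measurable_def by metis
  have "simple_function M (\<lambda>x. s i x + t i x)" for i
    using s(1) t(1) by (rule simple_function_compose2)
  then show ?thesis
    unfolding strongly_measurable_def
    by (intro exI[of _ "\<lambda>i x. s i x + t i x"]) (simp add: s t tendsto_add)
qed

lemma strongly_measurable_sum:
  fixes f :: "'i \<Rightarrow> 'a \<Rightarrow> 'b::real_normed_vector"
  assumes "\<And>i. i \<in> I \<Longrightarrow> strongly_measurable M (f i)"
  shows "strongly_measurable M (\<lambda>x. \<Sum>i\<in>I. f i x)"
proof -
  have zero: "strongly_measurable M (\<lambda>_. 0::'b)"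
    unfolding strongly_measurable_def by (intro exI[of _ "\<lambda>_ _. 0"]) auto
  show ?thesis
    using assms by (induction I rule: infinite_finite_induct)
                   (auto intro: zero strongly_measurable_add)
qed

text \<open>
  A point among \<open>d 0, \<dots>, d n\<close> nearest to \<open>y\<close>; ties go to the smallest index, which makes the choice measurable
  in \<open>y\<close>.
\<close>

primrec nearest_point :: "(nat \<Rightarrow> 'b::metric_space) \<Rightarrow> nat \<Rightarrow> 'b \<Rightarrow> 'b" where
  "nearest_point d 0 y = d 0"
| "nearest_point d (Suc n) y =
     (if dist y (d (Suc n)) < dist y (nearest_point d n y) then d (Suc n) else nearest_point d n y)"

lemma dist_nearest_point_le: "i \<le> n \<Longrightarrow> dist y (nearest_point d n y) \<le> dist y (d i)"
proof (induction n)
  case (Suc n)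
  then show ?case by (cases "i = Suc n") (auto simp: not_less le_Suc_eq)
qed simp

lemma nearest_point_tendsto:
  assumes "y \<in> closure (range d)"
  shows "(\<lambda>n. nearest_point d n y) \<longlonglongrightarrow> y"
proof (rule metric_LIMSEQ_I)
  fix r :: real assume "0 < r"
  then obtain i where "dist (d i) y < r"
    using assms unfolding closure_approachable by auto
  then show "\<exists>no. \<forall>n\<ge>no. dist (nearest_point d n y) y < r"
    by (metis dist_commute dist_nearest_point_le le_less_trans)
qed

lemma simple_function_nearest_point:
  assumes [measurable]: "f \<in> borel_measurable M"
  shows "simple_function M (\<lambda>x. nearest_point d n (f x))"
proof -
  have [measurable]: "(\<lambda>x. dist (f x) c) \<in> borel_measurable M" for c
    by (rule borel_measurable_continuous_on[OF _ assms]) (auto intro!: continuous_intros)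
  have "simple_function M (\<lambda>x. nearest_point d n (f x))
     \<and> (\<lambda>x. dist (f x) (nearest_point d n (f x))) \<in> borel_measurable M"
  proof (induction n)
    case (Suc n)
    then have [measurable]: "(\<lambda>x. dist (f x) (nearest_point d n (f x))) \<in> borel_measurable M"
      by simp
    have "(\<lambda>x. dist (f x) (nearest_point d (Suc n) (f x))) =
        (\<lambda>x. min (dist (f x) (d (Suc n))) (dist (f x) (nearest_point d n (f x))))"
      by (auto simp: min_def)
    moreover have "simple_function M (\<lambda>x. nearest_point d (Suc n) (f x))"
      unfolding nearest_point.simps using Suc by (intro simple_function_If) auto
    ultimately show ?case
      by (simp only:) measurable
  qed simp
  then show ?thesis by simp
qed

text \<open>
  The limit is Borel and takes its values in the closure of a countable set, the union of the ranges of all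
  approximating simple functions. Its nearest points in growing finite parts of this set are simple
  functions that converge to it.
\<close>

lemma strongly_measurable_LIMSEQ:
  assumes f: "\<And>i::nat. strongly_measurable M (f i)"
    and lim: "\<And>x. x \<in> space M \<Longrightarrow> (\<lambda>i. f i x) \<longlonglongrightarrow> g x"
  shows "strongly_measurable M g"
proof (cases "space M = {}")
  case True
  then show ?thesis
    unfolding strongly_measurable_def by (intro exI[of _ "\<lambda>_ _. undefined"]) auto
next
  case False
  obtain s where s: "\<And>i j. simple_function M (s i j)"
      "\<And>i x. x \<in> space M \<Longrightarrow> (\<lambda>j. s i j x) \<longlonglongrightarrow> f i x"
    using f unfolding strongly_measurable_def by metis
  define D where "D = (\<Union>i. \<Union>j. s i j ` space M)"
  have "countable D"
    unfolding D_def by (intro countable_UN countableI_type)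
      (use s(1) in \<open>auto simp: simple_function_def intro: countable_finite\<close>)
  moreover have "D \<noteq> {}"
    unfolding D_def using False by auto
  ultimately have d: "range (from_nat_into D) = D"
    by (intro range_from_nat_into)
  have "f i x \<in> closure D" if "x \<in> space M" for i x
    unfolding closure_sequential
    by (rule exI[of _ "\<lambda>j. s i j x"]) (use s that in \<open>auto simp: D_def\<close>)
  then have "g x \<in> closure D" if "x \<in> space M" for x
    using closed_sequentially[OF closed_closure, of "\<lambda>i. f i x" D "g x"] lim that by auto
  moreover have "g \<in> borel_measurable M"
    by (rule borel_measurable_LIMSEQ_metric[OF _ lim]) (auto intro: strongly_measurable_borel f)
  ultimately show ?thesis
    unfolding strongly_measurable_def
    by (intro exI[of _ "\<lambda>n x. nearest_point (from_nat_into D) n (g x)"])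
       (auto intro: simple_function_nearest_point nearest_point_tendsto simp: d)
qed

text \<open>
  The distance of two Borel functions into a non-separable space can fail to be measurable. If one of them
  is simple, the distance is a finite sum over its values.
\<close>

lemma borel_measurable_dist_simple_function:
  fixes f :: "'a \<Rightarrow> 'b::metric_space"
  assumes f: "f \<in> borel_measurable M" and s: "simple_function M s"
  shows "(\<lambda>x. dist (f x) (s x)) \<in> borel_measurable M"
proof -
  have [measurable]: "(\<lambda>x. dist (f x) a) \<in> borel_measurable M" for a
    by (rule borel_measurable_continuous_on[OF _ f]) (auto intro!: continuous_intros)
  have [measurable]: "s -` {a} \<inter> space M \<in> sets M" for a
    using simple_functionD[OF s] by auto
  have fin: "finite (s ` space M)"
    using s by (auto simp: simple_function_def)
  have "dist (f x) (s x) = (\<Sum>a\<in>s ` space M. indicator (s -` {a} \<inter> space M) x * dist (f x) a)"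
    if "x \<in> space M" for x
  proof -
    have "(\<Sum>a\<in>s ` space M. indicator (s -` {a} \<inter> space M) x * dist (f x) a)
        = (\<Sum>a\<in>s ` space M. if a = s x then dist (f x) (s x) else 0)"
      using that by (intro sum.cong) (auto simp: indicator_def)
    then show ?thesis using that fin by simp
  qed
  then show ?thesis
    by (subst measurable_cong) (auto intro!: borel_measurable_sum borel_measurable_times)
qed

text \<open>
  For approximations of \<open>f\<close> in \<open>L\<^sup>1\<close>, the bound shows that the integrals form a Cauchy sequence and that their
  limit does not depend on the approximations.
\<close>

lemma norm_simple_bochner_integral_diff_le:
  fixes f :: "'a \<Rightarrow> 'b::real_normed_vector"
  assumes f: "f \<in> borel_measurable M"
    and s: "Bochner_Integration.simple_bochner_integrable M s"
    and t: "Bochner_Integration.simple_bochner_integrable M t"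
  shows "ennreal (norm (Bochner_Integration.simple_bochner_integral M s
             - Bochner_Integration.simple_bochner_integral M t)) \<le>
    (\<integral>\<^sup>+ x. norm (f x - s x) \<partial>M) + (\<integral>\<^sup>+ x. norm (f x - t x) \<partial>M)"
    (is "ennreal (norm (?s - ?t)) \<le> ?S + ?T")
proof -
  note compose2 = Bochner_Integration.simple_bochner_integrable_compose2
  have sf: "simple_function M s" "simple_function M t"
    using s t by (auto elim: Bochner_Integration.simple_bochner_integrable.cases)
  have [measurable]: "(\<lambda>x. norm (f x - s x)) \<in> borel_measurable M"
      "(\<lambda>x. norm (f x - t x)) \<in> borel_measurable M"
    using borel_measurable_dist_simple_function[OF f sf(1)]
      borel_measurable_dist_simple_function[OF f sf(2)] by (simp_all add: dist_norm)
  have "ennreal (norm (?s - ?t)) =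
      norm (Bochner_Integration.simple_bochner_integral M (\<lambda>x. s x - t x))"
    using s t by (subst Bochner_Integration.simple_bochner_integral_diff) auto
  also have "\<dots> \<le> Bochner_Integration.simple_bochner_integral M (\<lambda>x. norm (s x - t x))"
    using compose2[of "(-)" M s t] s t
    by (auto intro!: Bochner_Integration.simple_bochner_integral_norm_bound)
  also have "\<dots> = (\<integral>\<^sup>+x. norm (s x - t x) \<partial>M)"
    using compose2[of "\<lambda>x y. norm (x - y)" M s t] s t
    by (auto intro!: Bochner_Integration.simple_bochner_integral_eq_nn_integral)
  also have "\<dots> \<le> (\<integral>\<^sup>+x. ennreal (norm (f x - s x)) + ennreal (norm (f x - t x)) \<partial>M)"
  proof (rule nn_integral_mono)
    fix x
    have "norm (s x - t x) \<le> norm (f x - s x) + norm (f x - t x)"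
      by (metis dual_order.refl norm_diff_triangle_le norm_minus_commute)
    then show "ennreal (norm (s x - t x)) \<le> ennreal (norm (f x - s x)) + ennreal (norm (f x - t x))"
      by (metis ennreal_leI ennreal_plus norm_ge_zero)
  qed
  also have "\<dots> = ?S + ?T"
    by (rule nn_integral_add) auto
  finally show ?thesis .
qed

lemma has_banach_integral_unique:
  fixes f :: "'a \<Rightarrow> 'b::real_normed_vector"
  assumes "has_banach_integral M f I" "has_banach_integral M f J"
  shows "I = J"
proof -
  let ?int = "Bochner_Integration.simple_bochner_integral M"
  obtain s where s: "f \<in> borel_measurable M" "\<And>i. Bochner_Integration.simple_bochner_integrable M (s i)"
      "(\<lambda>i. \<integral>\<^sup>+x. ennreal (norm (f x - s i x)) \<partial>M) \<longlonglongrightarrow> 0" "(\<lambda>i. ?int (s i)) \<longlonglongrightarrow> I"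
    using assms(1) unfolding has_banach_integral_def by blast
  obtain t where t: "\<And>i. Bochner_Integration.simple_bochner_integrable M (t i)"
      "(\<lambda>i. \<integral>\<^sup>+x. ennreal (norm (f x - t i x)) \<partial>M) \<longlonglongrightarrow> 0" "(\<lambda>i. ?int (t i)) \<longlonglongrightarrow> J"
    using assms(2) unfolding has_banach_integral_def by blast
  have "(\<lambda>i. ennreal (norm (?int (s i) - ?int (t i)))) \<longlonglongrightarrow> ennreal (norm (I - J))"
    by (intro tendsto_intros s t)
  moreover have "(\<lambda>i. (\<integral>\<^sup>+x. ennreal (norm (f x - s i x)) \<partial>M)
      + (\<integral>\<^sup>+x. ennreal (norm (f x - t i x)) \<partial>M)) \<longlonglongrightarrow> 0 + 0"
    by (intro tendsto_intros s t)
  ultimately have "ennreal (norm (I - J)) \<le> 0 + 0"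
    by (rule LIMSEQ_le) (auto intro!: norm_simple_bochner_integral_diff_le s t)
  then show ?thesis by simp
qed

lemma banach_integral_eq:
  assumes "has_banach_integral M f I"
  shows "banach_integral M f = I"
proof -
  have "(THE I. has_banach_integral M f I) = I"
    by (rule the_equality, rule assms, rule has_banach_integral_unique[OF _ assms])
  with assms show ?thesis
    unfolding banach_integral_def by auto
qed

lemma has_banach_integral_exists:
  fixes f :: "'a \<Rightarrow> 'b::banach"
  assumes f: "strongly_measurable M f" and fin: "(\<integral>\<^sup>+x. ennreal (norm (f x)) \<partial>M) < \<infinity>"
  shows "\<exists>I. has_banach_integral M f I"
proof -
  let ?int = "Bochner_Integration.simple_bochner_integral M"
  have fb: "f \<in> borel_measurable M"
    by (rule strongly_measurable_borel[OF f])
  have [measurable]: "(\<lambda>x. norm (f x)) \<in> borel_measurable M"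
    by (rule borel_measurable_continuous_on[OF _ fb]) (auto intro!: continuous_intros)
  obtain s where s: "\<And>i. simple_function M (s i)" "\<And>x. x \<in> space M \<Longrightarrow> (\<lambda>i. s i x) \<longlonglongrightarrow> f x"
    using f unfolding strongly_measurable_def by metis
  \<comment> \<open>Cutting off where the approximation is too large gives a dominated sequence.\<close>
  define t where "t i x = (if norm (s i x) \<le> 2 * norm (f x) then s i x else 0)" for i x
  have ts: "simple_function M (t i)" for i
  proof -
    have [measurable]: "(\<lambda>x. norm (s i x)) \<in> borel_measurable M"
      by (rule borel_measurable_simple_function[OF simple_function_compose1[OF s(1)]])
    show ?thesis
      unfolding t_def[abs_def] by (intro simple_function_If s) auto
  qed
  have tb: "norm (t i x) \<le> 2 * norm (f x)" for i x
    by (simp add: t_def)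
  have tlim: "(\<lambda>i. t i x) \<longlonglongrightarrow> f x" if x: "x \<in> space M" for x
  proof (cases "f x = 0")
    case True
    then have "t i x = 0" for i using tb[of i x] by simp
    then show ?thesis using True by simp
  next
    case False
    have "(\<lambda>i. norm (s i x)) \<longlonglongrightarrow> norm (f x)"
      by (intro tendsto_intros s x)
    then have "eventually (\<lambda>i. norm (s i x) < 2 * norm (f x)) sequentially"
      by (rule order_tendstoD(2)) (use False in auto)
    then have "eventually (\<lambda>i. s i x = t i x) sequentially"
      by eventually_elim (simp add: t_def)
    then show ?thesis
      using s(2)[OF x] by (rule Lim_transform_eventually[rotated])
  qed
  have meas: "(\<lambda>x. norm (f x - t i x)) \<in> borel_measurable M" for i
    using borel_measurable_dist_simple_function[OF fb ts] by (simp add: dist_norm)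
  have bound: "norm (f x - t i x) \<le> 3 * norm (f x)" for i x
    using norm_triangle_ineq4[of "f x" "t i x"] tb[of i x] by simp
  have "(\<lambda>i. \<integral>\<^sup>+x. ennreal (norm (f x - t i x)) \<partial>M) \<longlonglongrightarrow> (\<integral>\<^sup>+x. 0 \<partial>M)"
  proof (rule nn_integral_dominated_convergence[where w="\<lambda>x. ennreal (3 * norm (f x))"])
    show "(\<integral>\<^sup>+x. ennreal (3 * norm (f x)) \<partial>M) < \<infinity>"
      using fin by (simp add: ennreal_mult nn_integral_cmult ennreal_mult_less_top)
    show "AE x in M. (\<lambda>i. ennreal (norm (f x - t i x))) \<longlonglongrightarrow> 0"
    proof (rule AE_I2)
      fix x assume "x \<in> space M"
      then have "(\<lambda>i. norm (f x - t i x)) \<longlonglongrightarrow> norm (f x - f x)"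
        by (intro tendsto_intros tlim)
      then show "(\<lambda>i. ennreal (norm (f x - t i x))) \<longlonglongrightarrow> 0"
        using tendsto_ennrealI by fastforce
    qed
  qed (use meas bound in \<open>auto intro!: ennreal_leI\<close>)
  then have L1: "(\<lambda>i. \<integral>\<^sup>+x. ennreal (norm (f x - t i x)) \<partial>M) \<longlonglongrightarrow> 0"
    by simp
  have ti: "Bochner_Integration.simple_bochner_integrable M (t i)" for i
  proof (rule Bochner_Integration.simple_bochner_integrableI_bounded[OF ts])
    have "(\<integral>\<^sup>+x. ennreal (norm (t i x)) \<partial>M) \<le> (\<integral>\<^sup>+x. ennreal (2 * norm (f x)) \<partial>M)"
      by (intro nn_integral_mono ennreal_leI tb)
    also have "\<dots> < \<infinity>"
      using fin by (simp add: ennreal_mult nn_integral_cmult ennreal_mult_less_top)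
    finally show "(\<integral>\<^sup>+x. ennreal (norm (t i x)) \<partial>M) < \<infinity>" .
  qed
  have "Cauchy (\<lambda>i. ?int (t i))"
  proof (rule metric_CauchyI)
    fix r :: real assume "0 < r"
    then have "eventually (\<lambda>i. (\<integral>\<^sup>+x. ennreal (norm (f x - t i x)) \<partial>M) < ennreal (r / 2)) sequentially"
      using order_tendstoD(2)[OF L1, of "ennreal (r / 2)"] by simp
    then obtain N where N: "\<And>i. i \<ge> N \<Longrightarrow> (\<integral>\<^sup>+x. ennreal (norm (f x - t i x)) \<partial>M) < ennreal (r / 2)"
      unfolding eventually_sequentially by auto
    show "\<exists>N. \<forall>m\<ge>N. \<forall>n\<ge>N. dist (?int (t m)) (?int (t n)) < r"
    proof (intro exI[of _ N] allI impI)
      fix m n assume mn: "N \<le> m" "N \<le> n"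
      have "ennreal (norm (?int (t m) - ?int (t n))) \<le>
          (\<integral>\<^sup>+x. ennreal (norm (f x - t m x)) \<partial>M) + (\<integral>\<^sup>+x. ennreal (norm (f x - t n x)) \<partial>M)"
        by (rule norm_simple_bochner_integral_diff_le[OF fb ti ti])
      also have "\<dots> < ennreal (r / 2) + ennreal (r / 2)"
        by (intro add_strict_mono N mn)
      also have "\<dots> = ennreal r"
        using \<open>0 < r\<close> by (simp flip: ennreal_plus)
      finally show "dist (?int (t m)) (?int (t n)) < r"
        using \<open>0 < r\<close> by (simp add: dist_norm ennreal_less_iff)
    qed
  qed
  then obtain I where "(\<lambda>i. ?int (t i)) \<longlonglongrightarrow> I"
    using Cauchy_convergent convergent_def by blast
  with fb ti L1 show ?thesis
    unfolding has_banach_integral_def by blast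
qed

text \<open>
  Bounded functionals turn operator-valued integrals into real ones, for which the usual calculus of integrals is
  at hand.
\<close>

lemma has_banach_integral_bounded_linear:
  fixes f :: "'a \<Rightarrow> 'b::real_normed_vector"
    and T :: "'b \<Rightarrow> 'c::{real_normed_vector,second_countable_topology}"
  assumes "has_banach_integral M f I" "bounded_linear T"
  shows "has_bochner_integral M (\<lambda>x. T (f x)) (T I)"
proof -
  interpret T: bounded_linear T by fact
  obtain s where s: "f \<in> borel_measurable M" "\<And>i. Bochner_Integration.simple_bochner_integrable M (s i)"
      "(\<lambda>i. \<integral>\<^sup>+x. ennreal (norm (f x - s i x)) \<partial>M) \<longlonglongrightarrow> 0"
      "(\<lambda>i. Bochner_Integration.simple_bochner_integral M (s i)) \<longlonglongrightarrow> I"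
    using assms(1) unfolding has_banach_integral_def by blast
  obtain K where K: "K > 0" "\<And>x. norm (T x) \<le> norm x * K"
    using T.pos_bounded by blast
  have [measurable]: "(\<lambda>x. norm (f x - s i x)) \<in> borel_measurable M" for i
    using borel_measurable_dist_simple_function[OF s(1), of "s i"] s(2)[of i]
    by (auto simp: dist_norm elim!: Bochner_Integration.simple_bochner_integrable.cases)
  show ?thesis
  proof (rule has_bochner_integral.intros[where s="\<lambda>i x. T (s i x)"])
    show "(\<lambda>x. T (f x)) \<in> borel_measurable M"
      by (rule borel_measurable_continuous_on[OF _ s(1)])
         (rule linear_continuous_on[OF assms(2)])
    show "Bochner_Integration.simple_bochner_integrable M (\<lambda>x. T (s i x))" for i
      using Bochner_Integration.simple_bochner_integrable_compose2[of "\<lambda>x y. T x", OF _ s(2) s(2)]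
      by (simp add: T.zero)
    show "(\<lambda>i. \<integral>\<^sup>+x. ennreal (norm (T (f x) - T (s i x))) \<partial>M) \<longlonglongrightarrow> 0"
    proof (rule tendsto_sandwich[where f="\<lambda>_. 0"])
      show "\<forall>\<^sub>F i in sequentially. (\<integral>\<^sup>+x. ennreal (norm (T (f x) - T (s i x))) \<partial>M)
          \<le> ennreal K * (\<integral>\<^sup>+x. ennreal (norm (f x - s i x)) \<partial>M)"
      proof (rule always_eventually, rule allI)
        fix i
        have "(\<integral>\<^sup>+x. ennreal (norm (T (f x) - T (s i x))) \<partial>M)
            \<le> (\<integral>\<^sup>+x. ennreal K * ennreal (norm (f x - s i x)) \<partial>M)"
          using K by (intro nn_integral_mono)
            (auto simp: T.diff[symmetric] ennreal_mult[symmetric] mult.commute intro!: ennreal_leI)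
        also have "\<dots> = ennreal K * (\<integral>\<^sup>+x. ennreal (norm (f x - s i x)) \<partial>M)"
          by (intro nn_integral_cmult) measurable
        finally show "(\<integral>\<^sup>+x. ennreal (norm (T (f x) - T (s i x))) \<partial>M)
          \<le> ennreal K * (\<integral>\<^sup>+x. ennreal (norm (f x - s i x)) \<partial>M)" .
      qed
      show "(\<lambda>i. ennreal K * (\<integral>\<^sup>+x. ennreal (norm (f x - s i x)) \<partial>M)) \<longlonglongrightarrow> 0"
        using ennreal_tendsto_cmult[OF _ s(3), of "ennreal K"] by simp
    qed auto
    show "(\<lambda>i. Bochner_Integration.simple_bochner_integral M (\<lambda>x. T (s i x))) \<longlonglongrightarrow> T I"
      using T.tendsto[OF s(4)] s(2)
      by (simp add: Bochner_Integration.simple_bochner_integral_linear[OF T.linear_axioms])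
  qed
qed

section \<open>Square integrable vectors and their covariance operators\<close>

definition square_integrable :: "'a measure \<Rightarrow> ('a \<Rightarrow> 'b::{real_inner,second_countable_topology}) \<Rightarrow> bool" where
  "square_integrable M f \<longleftrightarrow> f \<in> borel_measurable M \<and> integrable M (\<lambda>x. (norm (f x))\<^sup>2)"

lemma square_integrable_measurable [measurable_dest]:
  "square_integrable M f \<Longrightarrow> f \<in> borel_measurable M"
  by (simp add: square_integrable_def)

lemma square_integrable_power2:
  "square_integrable M f \<Longrightarrow> integrable M (\<lambda>x. (f x :: real)\<^sup>2)"
  by (simp add: square_integrable_def)

lemma square_integrable_bound:
  assumes "square_integrable M f" and [measurable]: "g \<in> borel_measurable M"
    and "\<And>x. x \<in> space M \<Longrightarrow> norm (g x) \<le> K * norm (f x)"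
  shows "square_integrable M g"
  unfolding square_integrable_def
proof
  have "integrable M (\<lambda>x. K\<^sup>2 * (norm (f x))\<^sup>2)"
    using assms(1) by (simp add: square_integrable_def)
  then show "integrable M (\<lambda>x. (norm (g x))\<^sup>2)"
  proof (rule Bochner_Integration.integrable_bound)
    show "AE x in M. norm ((norm (g x))\<^sup>2) \<le> norm (K\<^sup>2 * (norm (f x))\<^sup>2)"
      using assms(3) power_mono[OF assms(3), of _ 2] by (auto intro!: AE_I2 simp: power_mult_distrib)
  qed measurable
qed (rule assms)

lemma square_integrable_add:
  assumes f: "square_integrable M f" and g: "square_integrable M g"
  shows "square_integrable M (\<lambda>x. f x + g x)"
  unfolding square_integrable_def
proof
  have [measurable]: "f \<in> borel_measurable M" "g \<in> borel_measurable M"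
    using f g by (auto simp: square_integrable_def)
  show "(\<lambda>x. f x + g x) \<in> borel_measurable M" by measurable
  have "integrable M (\<lambda>x. 2 * (norm (f x))\<^sup>2 + 2 * (norm (g x))\<^sup>2)"
    using f g by (simp add: square_integrable_def)
  then show "integrable M (\<lambda>x. (norm (f x + g x))\<^sup>2)"
  proof (rule Bochner_Integration.integrable_bound)
    have "(norm (f x + g x))\<^sup>2 \<le> 2 * (norm (f x))\<^sup>2 + 2 * (norm (g x))\<^sup>2" for x
    proof -
      have "(norm (f x + g x))\<^sup>2 \<le> (norm (f x) + norm (g x))\<^sup>2"
        by (intro power_mono norm_triangle_ineq) simp
      also have "\<dots> \<le> 2 * (norm (f x))\<^sup>2 + 2 * (norm (g x))\<^sup>2"
        using sum_squares_bound[of "norm (f x)" "norm (g x)"] by (simp add: power2_sum)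
      finally show ?thesis .
    qed
    then show "AE x in M. norm ((norm (f x + g x))\<^sup>2) \<le> norm (2 * (norm (f x))\<^sup>2 + 2 * (norm (g x))\<^sup>2)"
      by (intro AE_I2) simp
  qed measurable
qed

lemma square_integrable_scaleR:
  "square_integrable M f \<Longrightarrow> square_integrable M (\<lambda>x. c *\<^sub>R f x)"
  by (rule square_integrable_bound[where K="\<bar>c\<bar>"]) auto

lemma square_integrable_mult:
  "square_integrable M (f :: _ \<Rightarrow> real) \<Longrightarrow> square_integrable M (\<lambda>x. c * f x)"
  by (rule square_integrable_bound[where K="\<bar>c\<bar>"]) (auto simp: abs_mult)

lemma square_integrable_diff:
  assumes "square_integrable M f" "square_integrable M g"
  shows "square_integrable M (\<lambda>x. f x - g x)"
  using square_integrable_add[OF assms(1) square_integrable_scaleR[OF assms(2), of "-1"]] by simp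

lemma square_integrable_inner:
  assumes "square_integrable M f"
  shows "square_integrable M (\<lambda>x. a \<bullet> f x)"
  by (rule square_integrable_bound[OF assms, where K="norm a"])
     (use assms in \<open>auto simp: Cauchy_Schwarz_ineq2\<close>)

lemma (in finite_measure) square_integrable_const: "square_integrable M (\<lambda>_. c)"
  by (simp add: square_integrable_def)

lemma square_integrable_times:
  assumes f: "square_integrable M f" and g: "square_integrable M g"
  shows "integrable M (\<lambda>x. norm (f x) * norm (g x))"
proof -
  have [measurable]: "f \<in> borel_measurable M" "g \<in> borel_measurable M"
    using f g by (auto simp: square_integrable_def)
  have "integrable M (\<lambda>x. (norm (f x))\<^sup>2 + (norm (g x))\<^sup>2)"
    using f g by (simp add: square_integrable_def)
  then show ?thesis
  proof (rule Bochner_Integration.integrable_bound)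
    have "norm (f x) * norm (g x) \<le> (norm (f x))\<^sup>2 + (norm (g x))\<^sup>2" for x
      using sum_squares_bound[of "norm (f x)" "norm (g x)"]
        mult_nonneg_nonneg[OF norm_ge_zero[of "f x"] norm_ge_zero[of "g x"]] by linarith
    then show "AE x in M. norm (norm (f x) * norm (g x)) \<le> norm ((norm (f x))\<^sup>2 + (norm (g x))\<^sup>2)"
      by (intro AE_I2) simp
  qed measurable
qed

lemma square_integrable_mult_integrable:
  fixes f g :: "'a \<Rightarrow> real"
  assumes "square_integrable M f" "square_integrable M g"
  shows "integrable M (\<lambda>x. f x * g x)"
  by (rule Bochner_Integration.integrable_bound[OF square_integrable_times[OF assms]])
     (use assms in \<open>auto simp: abs_mult\<close>)

lemma (in finite_measure) square_integrable_integrable: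
  fixes f :: "'a \<Rightarrow> 'b::{real_inner,banach,second_countable_topology}"
  assumes "square_integrable M f"
  shows "integrable M f"
  by (rule Bochner_Integration.integrable_bound[OF square_integrable_times[OF assms square_integrable_const[of "1::real"]]])
     (use assms in auto)

lemma bounded_bilinear_tensor_op: "bounded_bilinear tensor_op"
proof
  show "tensor_op (a + a') b = tensor_op a b + tensor_op a' b" for a a' :: 'a and b :: 'b
    by transfer (simp add: fun_eq_iff scaleR_add_right)
  show "tensor_op a (b + b') = tensor_op a b + tensor_op a b'" for a :: 'a and b b' :: 'b
    by transfer (simp add: fun_eq_iff inner_add_left scaleR_add_left)
  show "tensor_op (r *\<^sub>R a) b = r *\<^sub>R tensor_op a b" for r and a :: 'a and b :: 'b
    by transfer (simp add: fun_eq_iff)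
  show "tensor_op a (r *\<^sub>R b) = r *\<^sub>R tensor_op a b" for r and a :: 'a and b :: 'b
    by transfer (simp add: fun_eq_iff)
  show "\<exists>K. \<forall>(a::'a) (b::'b). norm (tensor_op a b) \<le> norm a * norm b * K"
  proof (intro exI[of _ 1] allI)
    fix a :: 'a and b :: 'b
    show "norm (tensor_op a b) \<le> norm a * norm b * 1"
    proof (rule norm_blinfun_bound)
      fix h :: 'b
      have "\<bar>b \<bullet> h\<bar> * norm a \<le> (norm b * norm h) * norm a"
        by (intro mult_right_mono Cauchy_Schwarz_ineq2) simp
      then show "norm (blinfun_apply (tensor_op a b) h) \<le> norm a * norm b * 1 * norm h"
        by (simp add: tensor_op.rep_eq ac_simps)
    qed simp
  qed
qed

lemma norm_tensor_op_le: "norm (tensor_op a b) \<le> norm a * norm b"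
proof (rule norm_blinfun_bound)
  fix h
  have "\<bar>b \<bullet> h\<bar> * norm a \<le> (norm b * norm h) * norm a"
    by (intro mult_right_mono Cauchy_Schwarz_ineq2) simp
  then show "norm (blinfun_apply (tensor_op a b) h) \<le> norm a * norm b * norm h"
    by (simp add: tensor_op.rep_eq ac_simps)
qed simp

lemma continuous_on_tensor_op: "continuous_on UNIV (\<lambda>p. tensor_op (fst p) (snd p))"
  by (rule bounded_bilinear.continuous_on[OF bounded_bilinear_tensor_op])
     (intro continuous_on_fst continuous_on_snd continuous_on_id)+

lemma has_banach_integral_blinfun_inner:
  assumes "has_banach_integral M F I"
  shows "has_bochner_integral M (\<lambda>x. blinfun_apply (F x) a \<bullet> b) (blinfun_apply I a \<bullet> b)"
  by (rule has_banach_integral_bounded_linear[OF assms])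
     (rule bounded_linear_inner_left_comp[OF blinfun.bounded_linear_left])

lemma (in finite_measure) has_banach_integral_tensor_op:
  fixes f :: "'a \<Rightarrow> 'g::{real_inner,banach,second_countable_topology}"
    and g :: "'a \<Rightarrow> 'h::{real_inner,banach,second_countable_topology}"
  assumes "square_integrable M f" "square_integrable M g"
  shows "has_banach_integral M (\<lambda>x. tensor_op (f x) (g x)) (banach_integral M (\<lambda>x. tensor_op (f x) (g x)))"
proof -
  have [measurable]: "f \<in> borel_measurable M" "g \<in> borel_measurable M"
    using assms by (auto simp: square_integrable_def)
  have "strongly_measurable M (\<lambda>x. (f x, g x))"
    by (rule strongly_measurable_separable) measurable
  from strongly_measurable_compose[OF this continuous_on_tensor_op]
  have "strongly_measurable M (\<lambda>x. tensor_op (f x) (g x))" by simp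
  moreover have "(\<integral>\<^sup>+x. ennreal (norm (tensor_op (f x) (g x))) \<partial>M) < \<infinity>"
  proof -
    have "(\<integral>\<^sup>+x. ennreal (norm (tensor_op (f x) (g x))) \<partial>M) \<le> (\<integral>\<^sup>+x. ennreal (norm (f x) * norm (g x)) \<partial>M)"
      by (intro nn_integral_mono ennreal_leI norm_tensor_op_le)
    also have "\<dots> < \<infinity>"
      using integrableD(2)[OF square_integrable_times[OF assms]] by (simp add: less_top)
    finally show ?thesis .
  qed
  ultimately obtain I where "has_banach_integral M (\<lambda>x. tensor_op (f x) (g x)) I"
    using has_banach_integral_exists by blast
  then show ?thesis
    using banach_integral_eq by metis
qed

text \<open>
  Covariance operators are handled below through these matrix entries.
\<close>

lemma (in finite_measure) Cov_inner:
  fixes U :: "'a \<Rightarrow> 'g::{real_inner,banach,second_countable_topology}"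
    and V :: "'a \<Rightarrow> 'h::{real_inner,banach,second_countable_topology}"
  assumes U: "square_integrable M U" and V: "square_integrable M V"
  shows "blinfun_apply (Cov M U V) h \<bullet> g
     = (\<integral>x. (h \<bullet> (V x - (\<integral>x. V x \<partial>M))) * (g \<bullet> (U x - (\<integral>x. U x \<partial>M))) \<partial>M)"
proof -
  let ?U = "\<lambda>x. U x - (\<integral>x. U x \<partial>M)" and ?V = "\<lambda>x. V x - (\<integral>x. V x \<partial>M)"
  have "has_banach_integral M (\<lambda>x. tensor_op (?U x) (?V x)) (Cov M U V)"
    unfolding Cov_def
    by (intro has_banach_integral_tensor_op square_integrable_diff square_integrable_const U V)
  from has_banach_integral_blinfun_inner[OF this, of h g]
  have "has_bochner_integral M (\<lambda>x. (h \<bullet> ?V x) * (g \<bullet> ?U x)) (blinfun_apply (Cov M U V) h \<bullet> g)"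
    by (simp add: tensor_op.rep_eq inner_commute)
  then show ?thesis
    by (simp add: has_bochner_integral_integral_eq)
qed

text \<open>
  Test with \<open>b = D a\<close>.
\<close>

lemma norm_blinfun_le_of_inner:
  fixes D :: "'a::real_inner \<Rightarrow>\<^sub>L 'b::real_inner"
  assumes "0 \<le> K" and D: "\<And>a b. \<bar>blinfun_apply D a \<bullet> b\<bar> \<le> K * norm a * norm b"
  shows "norm D \<le> K"
proof (rule norm_blinfun_bound[OF assms(1)])
  fix a
  let ?v = "blinfun_apply D a"
  have "norm ?v * norm ?v \<le> (K * norm a) * norm ?v"
    using D[of a ?v] by (simp add: power2_norm_eq_inner[symmetric] power2_eq_square)
  then show "norm ?v \<le> K * norm a"
    using assms(1) by (cases "?v = 0") (auto simp: mult_le_cancel_right)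
qed

text \<open>
  Let \<open>p n\<close> be the map \<open>v \<mapsto> (\<Sum>i<n. (v \<bullet> e i) *\<^sub>R e i)\<close>, \<open>C\<close> the covariance operator and \<open>W\<close> the centred
  variable. The sum in the statement is \<open>p n \<circ> C \<circ> p n\<close>, the covariance operator of \<open>p n W\<close>, and its
  distance to \<open>C\<close> is at most the mean of \<open>2 * norm W * norm (W - p n W)\<close>, which tends to \<open>0\<close> by dominated
  convergence. Convergence in operator norm, rather than entrywise, is what strong measurability of a
  family of covariance operators requires.
\<close>

lemma (in finite_measure) Cov_finite_rank_approx:
  fixes U :: "'a \<Rightarrow> 'g::{real_inner,banach,second_countable_topology}"
  assumes U: "square_integrable M U"
    and e: "\<And>v. (\<lambda>n. \<Sum>i<n. (v \<bullet> e i) *\<^sub>R e i) \<longlonglongrightarrow> v"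
      "\<And>v n. norm (\<Sum>i<n. (v \<bullet> e i) *\<^sub>R e i) \<le> norm v"
  shows "(\<lambda>n. \<Sum>i<n. \<Sum>j<n. (blinfun_apply (Cov M U U) (e j) \<bullet> e i) *\<^sub>R tensor_op (e i) (e j))
           \<longlonglongrightarrow> Cov M U U"
proof -
  define W where "W x = U x - (\<integral>x. U x \<partial>M)" for x
  define p where "p n v = (\<Sum>i<n. (v \<bullet> e i) *\<^sub>R e i)" for n v
  let ?C = "Cov M U U"
  let ?S = "\<lambda>n. \<Sum>i<n. \<Sum>j<n. (blinfun_apply ?C (e j) \<bullet> e i) *\<^sub>R tensor_op (e i) (e j)"
  have W: "square_integrable M W"
    unfolding W_def[abs_def] by (intro square_integrable_diff square_integrable_const U)
  have [measurable]: "W \<in> borel_measurable M" using W by measurable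
  have pW [measurable]: "(\<lambda>x. p n (W x)) \<in> borel_measurable M" for n
    unfolding p_def by measurable
  have p_le: "norm (p n v) \<le> norm v" for n v
    unfolding p_def by (rule e(2))
  have p_sym: "p n v \<bullet> w = v \<bullet> p n w" for n v w
    by (simp add: p_def inner_sum_left inner_sum_right inner_commute mult.commute)
  have pW_si: "square_integrable M (\<lambda>x. p n (W x))" for n
    by (rule square_integrable_bound[OF W pW, where K=1]) (simp add: p_le)
  have C: "blinfun_apply ?C a \<bullet> b = (\<integral>x. (a \<bullet> W x) * (b \<bullet> W x) \<partial>M)" for a b
    unfolding W_def by (rule Cov_inner[OF U U])
  have S: "blinfun_apply (?S n) a \<bullet> b = blinfun_apply ?C (p n a) \<bullet> p n b" for n a b
  proof -
    have "blinfun_apply (?S n) a \<bullet> b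
        = (\<Sum>i<n. \<Sum>j<n. (blinfun_apply ?C (e j) \<bullet> e i) * ((e j \<bullet> a) * (e i \<bullet> b)))"
      by (simp add: blinfun.sum_left blinfun.scaleR_left tensor_op.rep_eq inner_sum_left mult.assoc)
    also have "\<dots> = (\<Sum>i<n. \<Sum>j<n. (b \<bullet> e i) * ((a \<bullet> e j) * (blinfun_apply ?C (e j) \<bullet> e i)))"
      by (intro sum.cong refl) (simp add: inner_commute[of a] inner_commute[of b])
    also have "\<dots> = blinfun_apply ?C (p n a) \<bullet> p n b"
      by (simp add: p_def blinfun.sum_right blinfun.scaleR_right inner_sum_left inner_sum_right
          sum_distrib_left)
    finally show ?thesis .
  qed
  define K where "K n = (\<integral>x. 2 * norm (W x) * norm (W x - p n (W x)) \<partial>M)" for n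
  have K_int: "integrable M (\<lambda>x. 2 * norm (W x) * norm (W x - p n (W x)))" for n
    using square_integrable_times[OF W square_integrable_diff[OF W pW_si[of n]]]
    by (simp add: mult.assoc)
  have bound: "norm (?C - ?S n) \<le> K n" for n
  proof (rule norm_blinfun_le_of_inner)
    show "0 \<le> K n" unfolding K_def by (rule Bochner_Integration.integral_nonneg) simp
    fix a b
    have int: "integrable M (\<lambda>x. (a \<bullet> W x) * (b \<bullet> W x))"
        "integrable M (\<lambda>x. (a \<bullet> p n (W x)) * (b \<bullet> p n (W x)))" for a b
      by (rule square_integrable_mult_integrable; rule square_integrable_inner; rule W pW_si)+
    have "blinfun_apply (?C - ?S n) a \<bullet> b
        = (\<integral>x. (a \<bullet> W x) * (b \<bullet> W x) \<partial>M) - (\<integral>x. (a \<bullet> p n (W x)) * (b \<bullet> p n (W x)) \<partial>M)"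
    proof -
      have "blinfun_apply (?C - ?S n) a \<bullet> b = blinfun_apply ?C a \<bullet> b - blinfun_apply ?C (p n a) \<bullet> p n b"
        by (simp only: blinfun.diff_left inner_diff_left S)
      then show ?thesis
        by (simp only: C p_sym)
    qed
    also have "\<dots> = (\<integral>x. (a \<bullet> W x) * (b \<bullet> W x) - (a \<bullet> p n (W x)) * (b \<bullet> p n (W x)) \<partial>M)"
      by (rule Bochner_Integration.integral_diff[symmetric]) (intro int)+
    also have "\<bar>\<dots>\<bar> \<le> (\<integral>x. (norm a * norm b) * (2 * norm (W x) * norm (W x - p n (W x))) \<partial>M)"
    proof (rule integral_abs_bound[THEN order_trans], rule integral_mono)
      fix x
      let ?w = "W x" and ?q = "p n (W x)"
      have "(a \<bullet> ?w) * (b \<bullet> ?w) - (a \<bullet> ?q) * (b \<bullet> ?q) = (a \<bullet> ?w) * (b \<bullet> (?w - ?q)) + (a \<bullet> (?w - ?q)) * (b \<bullet> ?q)"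
        by (simp add: inner_diff_right algebra_simps)
      also have "\<bar>\<dots>\<bar> \<le> (norm a * norm ?w) * (norm b * norm (?w - ?q)) + (norm a * norm (?w - ?q)) * (norm b * norm ?w)"
      proof -
        have "\<bar>b \<bullet> ?q\<bar> \<le> norm b * norm ?w"
          using Cauchy_Schwarz_ineq2[of b ?q] mult_left_mono[OF p_le[of n ?w], of "norm b"] by simp
        then have "\<bar>(a \<bullet> (?w - ?q)) * (b \<bullet> ?q)\<bar> \<le> (norm a * norm (?w - ?q)) * (norm b * norm ?w)"
          unfolding abs_mult by (intro mult_mono Cauchy_Schwarz_ineq2) auto
        moreover have "\<bar>(a \<bullet> ?w) * (b \<bullet> (?w - ?q))\<bar> \<le> (norm a * norm ?w) * (norm b * norm (?w - ?q))"
          unfolding abs_mult by (intro mult_mono Cauchy_Schwarz_ineq2) auto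
        ultimately show ?thesis by linarith
      qed
      also have "\<dots> = (norm a * norm b) * (2 * norm ?w * norm (?w - ?q))"
        by (simp add: algebra_simps)
      finally show "\<bar>(a \<bullet> ?w) * (b \<bullet> ?w) - (a \<bullet> ?q) * (b \<bullet> ?q)\<bar> \<le> (norm a * norm b) * (2 * norm ?w * norm (?w - ?q))" .
    next
      show "integrable M (\<lambda>x. \<bar>(a \<bullet> W x) * (b \<bullet> W x) - (a \<bullet> p n (W x)) * (b \<bullet> p n (W x))\<bar>)"
        by (rule integrable_abs, rule Bochner_Integration.integrable_diff; rule int)
      show "integrable M (\<lambda>x. (norm a * norm b) * (2 * norm (W x) * norm (W x - p n (W x))))"
        by (rule Bochner_Integration.integrable_mult_right) (rule K_int)
    qed
    also have "\<dots> = K n * norm a * norm b"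
      by (simp add: K_def)
    finally show "\<bar>blinfun_apply (?C - ?S n) a \<bullet> b\<bar> \<le> K n * norm a * norm b" .
  qed
  have "K \<longlonglongrightarrow> (\<integral>x. 0 \<partial>M)"
    unfolding K_def
  proof (rule integral_dominated_convergence[where w="\<lambda>x. 4 * (norm (W x))\<^sup>2"])
    show "integrable M (\<lambda>x. 4 * (norm (W x))\<^sup>2)"
      using W by (simp add: square_integrable_def)
    show "AE x in M. (\<lambda>n. 2 * norm (W x) * norm (W x - p n (W x))) \<longlonglongrightarrow> 0"
    proof (rule AE_I2)
      fix x
      have "(\<lambda>n. 2 * norm (W x) * norm (W x - p n (W x))) \<longlonglongrightarrow> 2 * norm (W x) * norm (W x - W x)"
        unfolding p_def by (intro tendsto_intros e(1))
      then show "(\<lambda>n. 2 * norm (W x) * norm (W x - p n (W x))) \<longlonglongrightarrow> 0" by simp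
    qed
    show "AE x in M. norm (2 * norm (W x) * norm (W x - p n (W x))) \<le> 4 * (norm (W x))\<^sup>2" for n
    proof (rule AE_I2)
      fix x
      have "norm (W x - p n (W x)) \<le> 2 * norm (W x)"
        using norm_triangle_ineq4[of "W x" "p n (W x)"] p_le[of n "W x"] by simp
      then have "(2 * norm (W x)) * norm (W x - p n (W x)) \<le> (2 * norm (W x)) * (2 * norm (W x))"
        by (intro mult_left_mono) auto
      then show "norm (2 * norm (W x) * norm (W x - p n (W x))) \<le> 4 * (norm (W x))\<^sup>2"
        by (simp add: power2_eq_square)
    qed
  qed measurable
  then have "K \<longlonglongrightarrow> 0" by simp
  then have "(\<lambda>n. ?S n - ?C) \<longlonglongrightarrow> 0"
    by (rule Lim_null_comparison[rotated]) (simp add: bound norm_minus_commute)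
  then show ?thesis
    by (rule LIM_zero_cancel)
qed

section \<open>Disintegration along a regular conditional distribution\<close>

locale conditional_law = prob_space P
  for P :: "'w measure" +
  fixes MX :: "'x measure" and MY :: "'y measure"
    and X :: "'w \<Rightarrow> 'x" and Y :: "'w \<Rightarrow> 'y" and \<kappa> :: "'x \<Rightarrow> 'y measure"
  assumes X [measurable]: "X \<in> P \<rightarrow>\<^sub>M MX"
    and Y [measurable]: "Y \<in> P \<rightarrow>\<^sub>M MY"
    and rcd: "is_rcd P MX MY X Y \<kappa>"
begin

abbreviation "law \<equiv> distr P MX X"

sublocale law: prob_space law
  by (rule prob_space_distr) (rule X)

lemma kernel [measurable]: "\<kappa> \<in> MX \<rightarrow>\<^sub>M subprob_algebra MY"
  using rcd unfolding is_rcd_def by (auto intro: measurable_prob_algebraD)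

lemma kernel_prob: "x \<in> space MX \<Longrightarrow> prob_space (\<kappa> x)"
  and sets_kernel_eq [measurable_cong]: "x \<in> space MX \<Longrightarrow> sets (\<kappa> x) = sets MY"
  using rcd measurable_space[of \<kappa> MX "prob_algebra MY" x]
  unfolding is_rcd_def by (auto simp: space_prob_algebra)

text \<open>
  Both sides agree on rectangles, which generate the product and are stable under intersection.
\<close>

lemma joint_law_eq_bind:
  "distr P (MX \<Otimes>\<^sub>M MY) (\<lambda>\<omega>. (X \<omega>, Y \<omega>)) = law \<bind> (\<lambda>x. distr (\<kappa> x) (MX \<Otimes>\<^sub>M MY) (Pair x))"
    (is "?L = ?R")
proof (rule measure_eqI_generator_eq[OF Int_stable_pair_measure_generator])
  have K [measurable]: "(\<lambda>x. distr (\<kappa> x) (MX \<Otimes>\<^sub>M MY) (Pair x)) \<in> law \<rightarrow>\<^sub>M subprob_algebra (MX \<Otimes>\<^sub>M MY)"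
    by (rule measurable_distr2[where M=MY]) measurable
  have ne: "space law \<noteq> {}"
    by (rule law.not_empty)
  have setsR: "sets ?R = sets (MX \<Otimes>\<^sub>M MY)"
    using ne by (intro sets_bind[OF _ ne]) simp
  let ?E = "{a \<times> b |a b. a \<in> sets MX \<and> b \<in> sets MY}"
  show "?E \<subseteq> Pow (space MX \<times> space MY)"
    using pair_measure_closed[of MX MY] by simp
  show "sets ?L = sigma_sets (space MX \<times> space MY) ?E"
    by (simp add: sets_pair_measure)
  show "sets ?R = sigma_sets (space MX \<times> space MY) ?E"
    unfolding setsR by (simp add: sets_pair_measure)
  fix S assume "S \<in> ?E"
  then obtain A B where [measurable]: "A \<in> sets MX" "B \<in> sets MY" and S: "S = A \<times> B"
    by auto
  have "emeasure ?L S = emeasure P {\<omega> \<in> space P. X \<omega> \<in> A \<and> Y \<omega> \<in> B}"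
    unfolding S by (subst emeasure_distr) (auto intro!: arg_cong[where f="emeasure P"])
  also have "\<dots> = (\<integral>\<^sup>+x\<in>A. emeasure (\<kappa> x) B \<partial>law)"
    using rcd unfolding is_rcd_def by auto
  also have "\<dots> = (\<integral>\<^sup>+x. emeasure (distr (\<kappa> x) (MX \<Otimes>\<^sub>M MY) (Pair x)) S \<partial>law)"
  proof (rule nn_integral_cong)
    fix x assume x: "x \<in> space law"
    then have sx: "sets (\<kappa> x) = sets MY" by (simp add: sets_kernel_eq)
    then have "Pair x \<in> \<kappa> x \<rightarrow>\<^sub>M MX \<Otimes>\<^sub>M MY"
      using x by (simp add: measurable_Pair1' cong: measurable_cong_sets)
    then have "emeasure (distr (\<kappa> x) (MX \<Otimes>\<^sub>M MY) (Pair x)) S = emeasure (\<kappa> x) (Pair x -` S \<inter> space (\<kappa> x))"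
      by (rule emeasure_distr) (simp add: S)
    also have "Pair x -` S \<inter> space (\<kappa> x) = (if x \<in> A then B else {})"
      using sets.sets_into_space[OF \<open>B \<in> sets MY\<close>] sets_eq_imp_space_eq[OF sx] by (auto simp: S)
    finally show "emeasure (\<kappa> x) B * indicator A x = emeasure (distr (\<kappa> x) (MX \<Otimes>\<^sub>M MY) (Pair x)) S"
      by simp
  qed
  also have "\<dots> = emeasure ?R S"
    by (subst emeasure_bind[OF ne K]) (simp_all add: S)
  finally show "emeasure ?L S = emeasure ?R S" .
next
  show "range (\<lambda>_::nat. space MX \<times> space MY) \<subseteq> {a \<times> b |a b. a \<in> sets MX \<and> b \<in> sets MY}"
    by blast
  show "(\<Union>i::nat. space MX \<times> space MY) = space MX \<times> space MY" by simp
  show "emeasure ?L (space MX \<times> space MY) \<noteq> \<infinity>" for i :: nat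
  proof -
    interpret L: prob_space ?L by (rule prob_space_distr) measurable
    show ?thesis by simp
  qed
qed

lemma nn_integral_disintegration:
  assumes [measurable]: "f \<in> borel_measurable (MX \<Otimes>\<^sub>M MY)"
  shows "(\<integral>\<^sup>+\<omega>. f (X \<omega>, Y \<omega>) \<partial>P) = (\<integral>\<^sup>+x. \<integral>\<^sup>+y. f (x, y) \<partial>\<kappa> x \<partial>law)"
proof -
  have K [measurable]: "(\<lambda>x. distr (\<kappa> x) (MX \<Otimes>\<^sub>M MY) (Pair x)) \<in> law \<rightarrow>\<^sub>M subprob_algebra (MX \<Otimes>\<^sub>M MY)"
    by (rule measurable_distr2[where M=MY]) measurable
  have "(\<integral>\<^sup>+\<omega>. f (X \<omega>, Y \<omega>) \<partial>P) = (\<integral>\<^sup>+p. f p \<partial>distr P (MX \<Otimes>\<^sub>M MY) (\<lambda>\<omega>. (X \<omega>, Y \<omega>)))"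
    by (subst nn_integral_distr) auto
  also have "\<dots> = (\<integral>\<^sup>+x. \<integral>\<^sup>+p. f p \<partial>distr (\<kappa> x) (MX \<Otimes>\<^sub>M MY) (Pair x) \<partial>law)"
    unfolding joint_law_eq_bind by (rule nn_integral_bind[OF assms K])
  also have "\<dots> = (\<integral>\<^sup>+x. \<integral>\<^sup>+y. f (x, y) \<partial>\<kappa> x \<partial>law)"
  proof (rule nn_integral_cong)
    fix x assume x: "x \<in> space law"
    then have "sets (\<kappa> x) = sets MY" by (simp add: sets_kernel_eq)
    then have "Pair x \<in> \<kappa> x \<rightarrow>\<^sub>M MX \<Otimes>\<^sub>M MY"
      using x by (simp add: measurable_Pair1' cong: measurable_cong_sets)
    then show "(\<integral>\<^sup>+p. f p \<partial>distr (\<kappa> x) (MX \<Otimes>\<^sub>M MY) (Pair x)) = (\<integral>\<^sup>+y. f (x, y) \<partial>\<kappa> x)"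
      by (rule nn_integral_distr) measurable
  qed
  finally show ?thesis .
qed

lemma measurable_kernel_nn_integral:
  assumes "f \<in> borel_measurable (MX \<Otimes>\<^sub>M MY)"
  shows "(\<lambda>x. \<integral>\<^sup>+y. f (x, y) \<partial>\<kappa> x) \<in> borel_measurable MX"
  using nn_integral_measurable_subprob_algebra2[of "\<lambda>x y. f (x, y)" MX MY \<kappa>] assms kernel by simp

lemma section_measurable:
  assumes "f \<in> borel_measurable (MX \<Otimes>\<^sub>M MY)" "x \<in> space MX"
  shows "(\<lambda>y. f (x, y)) \<in> borel_measurable (\<kappa> x)"
proof -
  have "(\<lambda>y. f (x, y)) \<in> borel_measurable MY"
    using assms by measurable
  then show ?thesis
    using sets_kernel_eq[OF assms(2)] by (simp cong: measurable_cong_sets)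
qed

lemma measurable_kernel_integral:
  fixes f :: "'x \<times> 'y \<Rightarrow> 'c::{banach,second_countable_topology}"
  assumes f [measurable]: "f \<in> borel_measurable (MX \<Otimes>\<^sub>M MY)"
  shows "(\<lambda>x. \<integral>y. f (x, y) \<partial>\<kappa> x) \<in> borel_measurable MX"
proof -
  have "(\<lambda>x. distr (\<kappa> x) (MX \<Otimes>\<^sub>M MY) (Pair x)) \<in> MX \<rightarrow>\<^sub>M subprob_algebra (MX \<Otimes>\<^sub>M MY)"
    by (rule measurable_distr2[where M=MY]) measurable
  from measurable_compose[OF this integral_measurable_subprob_algebra[OF f]]
  have "(\<lambda>x. \<integral>p. f p \<partial>distr (\<kappa> x) (MX \<Otimes>\<^sub>M MY) (Pair x)) \<in> borel_measurable MX" .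
  also have "?this \<longleftrightarrow> ?thesis"
  proof (rule measurable_cong)
    fix x assume x: "x \<in> space MX"
    then have "Pair x \<in> \<kappa> x \<rightarrow>\<^sub>M MX \<Otimes>\<^sub>M MY"
      by (simp add: measurable_Pair1' sets_kernel_eq cong: measurable_cong_sets)
    then show "(\<integral>p. f p \<partial>distr (\<kappa> x) (MX \<Otimes>\<^sub>M MY) (Pair x)) = (\<integral>y. f (x, y) \<partial>\<kappa> x)"
      by (rule integral_distr) (rule f)
  qed
  finally show ?thesis .
qed

lemma integral_disintegration_nonneg:
  fixes f :: "'x \<times> 'y \<Rightarrow> real"
  assumes f [measurable]: "f \<in> borel_measurable (MX \<Otimes>\<^sub>M MY)" and nn: "\<And>p. 0 \<le> f p"
    and int: "integrable P (\<lambda>\<omega>. f (X \<omega>, Y \<omega>))"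
  shows "AE x in law. integrable (\<kappa> x) (\<lambda>y. f (x, y))"
    and "has_bochner_integral law (\<lambda>x. \<integral>y. f (x, y) \<partial>\<kappa> x) (\<integral>\<omega>. f (X \<omega>, Y \<omega>) \<partial>P)"
proof -
  have eq: "(\<integral>\<^sup>+x. \<integral>\<^sup>+y. ennreal (f (x, y)) \<partial>\<kappa> x \<partial>law) = ennreal (\<integral>\<omega>. f (X \<omega>, Y \<omega>) \<partial>P)"
    using nn_integral_disintegration[of "\<lambda>p. ennreal (f p)"] nn_integral_eq_integral[OF int] nn
    by simp
  have "AE x in law. (\<integral>\<^sup>+y. ennreal (f (x, y)) \<partial>\<kappa> x) \<noteq> \<infinity>"
    by (rule nn_integral_PInf_AE) (use eq measurable_kernel_nn_integral[of "\<lambda>p. ennreal (f p)"] in auto)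
  then show AE: "AE x in law. integrable (\<kappa> x) (\<lambda>y. f (x, y))"
    using AE_space
  proof eventually_elim
    case (elim x)
    then show ?case
      using section_measurable[OF f] nn by (intro integrableI_nonneg) (auto simp: less_top)
  qed
  have meas: "(\<lambda>x. \<integral>y. f (x, y) \<partial>\<kappa> x) \<in> borel_measurable law"
    using measurable_kernel_integral[OF f] by simp
  have "(\<integral>\<^sup>+x. ennreal (\<integral>y. f (x, y) \<partial>\<kappa> x) \<partial>law) = (\<integral>\<^sup>+x. \<integral>\<^sup>+y. ennreal (f (x, y)) \<partial>\<kappa> x \<partial>law)"
    using AE by (intro nn_integral_cong_AE, eventually_elim)
                (simp add: nn_integral_eq_integral nn)
  then show "has_bochner_integral law (\<lambda>x. \<integral>y. f (x, y) \<partial>\<kappa> x) (\<integral>\<omega>. f (X \<omega>, Y \<omega>) \<partial>P)"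
    using eq nn meas
    by (intro has_bochner_integral_nn_integral) auto
qed

lemma integral_disintegration:
  fixes f :: "'x \<times> 'y \<Rightarrow> real"
  assumes f [measurable]: "f \<in> borel_measurable (MX \<Otimes>\<^sub>M MY)"
    and int: "integrable P (\<lambda>\<omega>. f (X \<omega>, Y \<omega>))"
  shows "AE x in law. integrable (\<kappa> x) (\<lambda>y. f (x, y))"
    and "has_bochner_integral law (\<lambda>x. \<integral>y. f (x, y) \<partial>\<kappa> x) (\<integral>\<omega>. f (X \<omega>, Y \<omega>) \<partial>P)"
proof -
  let ?p = "\<lambda>p. max 0 (f p)" and ?n = "\<lambda>p. max 0 (- f p)"
  have p: "integrable P (\<lambda>\<omega>. ?p (X \<omega>, Y \<omega>))" and n: "integrable P (\<lambda>\<omega>. ?n (X \<omega>, Y \<omega>))"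
    using int by (auto intro!: integrable_max)
  have pm: "?p \<in> borel_measurable (MX \<Otimes>\<^sub>M MY)" and nm: "?n \<in> borel_measurable (MX \<Otimes>\<^sub>M MY)"
    by measurable
  note P = integral_disintegration_nonneg[OF pm max.cobounded1 p]
    and N = integral_disintegration_nonneg[OF nm max.cobounded1 n]
  have split: "f p = ?p p - ?n p" for p by (simp add: max_def)
  have AE: "AE x in law. integrable (\<kappa> x) (\<lambda>y. f (x, y)) \<and>
      (\<integral>y. ?p (x, y) \<partial>\<kappa> x) - (\<integral>y. ?n (x, y) \<partial>\<kappa> x) = (\<integral>y. f (x, y) \<partial>\<kappa> x)"
    using P(1) N(1)
  proof eventually_elim
    case (elim x)
    then have "integrable (\<kappa> x) (\<lambda>y. ?p (x, y) - ?n (x, y))"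
      by (intro Bochner_Integration.integrable_diff) auto
    moreover have "(\<integral>y. ?p (x, y) - ?n (x, y) \<partial>\<kappa> x) = (\<integral>y. ?p (x, y) \<partial>\<kappa> x) - (\<integral>y. ?n (x, y) \<partial>\<kappa> x)"
      using elim by (intro Bochner_Integration.integral_diff) auto
    ultimately show ?case
      by (simp only: split[symmetric])
  qed
  then show "AE x in law. integrable (\<kappa> x) (\<lambda>y. f (x, y))"
    by (rule eventually_mono) simp
  have "has_bochner_integral law (\<lambda>x. (\<integral>y. ?p (x, y) \<partial>\<kappa> x) - (\<integral>y. ?n (x, y) \<partial>\<kappa> x))
      ((\<integral>\<omega>. ?p (X \<omega>, Y \<omega>) \<partial>P) - (\<integral>\<omega>. ?n (X \<omega>, Y \<omega>) \<partial>P))"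
    using P(2) N(2) by (intro has_bochner_integral_diff) auto
  also have "(\<integral>\<omega>. ?p (X \<omega>, Y \<omega>) \<partial>P) - (\<integral>\<omega>. ?n (X \<omega>, Y \<omega>) \<partial>P) = (\<integral>\<omega>. f (X \<omega>, Y \<omega>) \<partial>P)"
    unfolding Bochner_Integration.integral_diff[OF p n, symmetric] by (simp only: split[symmetric])
  finally have "has_bochner_integral law (\<lambda>x. (\<integral>y. ?p (x, y) \<partial>\<kappa> x) - (\<integral>y. ?n (x, y) \<partial>\<kappa> x))
      (\<integral>\<omega>. f (X \<omega>, Y \<omega>) \<partial>P)" .
  then show "has_bochner_integral law (\<lambda>x. \<integral>y. f (x, y) \<partial>\<kappa> x) (\<integral>\<omega>. f (X \<omega>, Y \<omega>) \<partial>P)"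
  proof (rule has_bochner_integral_cong_AE[THEN iffD1, rotated -1])
    show "AE x in law. (\<integral>y. ?p (x, y) \<partial>\<kappa> x) - (\<integral>y. ?n (x, y) \<partial>\<kappa> x) = (\<integral>y. f (x, y) \<partial>\<kappa> x)"
      using AE by (rule eventually_mono) simp
    show "(\<lambda>x. (\<integral>y. ?p (x, y) \<partial>\<kappa> x) - (\<integral>y. ?n (x, y) \<partial>\<kappa> x)) \<in> borel_measurable law"
      using P(2) N(2) by (auto dest!: borel_measurable_has_bochner_integral)
    show "(\<lambda>x. \<integral>y. f (x, y) \<partial>\<kappa> x) \<in> borel_measurable law"
      using measurable_kernel_integral[OF f] by simp
  qed
qed

lemma AE_law_eq_iff:
  fixes f g :: "'x \<Rightarrow> real"
  assumes f: "f \<in> borel_measurable MX" and g: "g \<in> borel_measurable MX"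
  shows "(AE x in law. f x = g x) \<longleftrightarrow> (AE \<omega> in P. f (X \<omega>) = g (X \<omega>))"
  by (rule AE_distr_iff[OF X borel_measurable_eq[OF f g]])

lemmas AE_law_eqI = AE_law_eq_iff[THEN iffD2] and AE_law_eqD = AE_law_eq_iff[THEN iffD1]

end

locale conditional_feature = conditional_law P MX MY X Y \<kappa>
  for P :: "'w measure" and MX :: "'x measure" and MY :: "'y measure"
    and X :: "'w \<Rightarrow> 'x" and Y :: "'w \<Rightarrow> 'y" and \<kappa> :: "'x \<Rightarrow> 'y measure" +
  fixes \<psi> :: "'y \<Rightarrow> 'g::{real_inner,banach,second_countable_topology}"
  assumes \<psi> [measurable]: "\<psi> \<in> borel_measurable MY"
    and square_integrable_\<psi>Y: "square_integrable P (\<lambda>\<omega>. \<psi> (Y \<omega>))"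
begin

abbreviation "domY \<equiv> cond_domain MX \<kappa> \<psi>"
abbreviation "m \<equiv> cond_mean MX \<kappa> \<psi>"
abbreviation "C \<equiv> cond_cov MX \<kappa> \<psi>"
abbreviation "residual a \<omega> \<equiv> a \<bullet> (\<psi> (Y \<omega>) - m (X \<omega>))"

lemma dom_sets [measurable]: "domY \<in> sets MX"
  unfolding cond_domain_def
  using measurable_kernel_nn_integral[of "\<lambda>(x, y). ennreal ((norm (\<psi> y))\<^sup>2)"] by simp

lemma dom_subset: "x \<in> domY \<Longrightarrow> x \<in> space MX"
  by (simp add: cond_domain_def)

lemma nn_integral_norm_square_disintegration:
  "(\<integral>\<^sup>+x. \<integral>\<^sup>+y. ennreal ((norm (\<psi> y))\<^sup>2) \<partial>\<kappa> x \<partial>law) < \<infinity>"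
proof -
  have "(\<integral>\<^sup>+x. \<integral>\<^sup>+y. ennreal ((norm (\<psi> y))\<^sup>2) \<partial>\<kappa> x \<partial>law) = (\<integral>\<^sup>+\<omega>. ennreal ((norm (\<psi> (Y \<omega>)))\<^sup>2) \<partial>P)"
    using nn_integral_disintegration[of "\<lambda>(x, y). ennreal ((norm (\<psi> y))\<^sup>2)"] by simp
  also have "\<dots> < \<infinity>"
    using integrableD(2)[of P "\<lambda>\<omega>. (norm (\<psi> (Y \<omega>)))\<^sup>2"] square_integrable_\<psi>Y
    by (simp add: square_integrable_def less_top)
  finally show ?thesis .
qed

lemma AE_dom: "AE x in law. x \<in> domY"
proof -
  have "AE x in law. (\<integral>\<^sup>+y. ennreal ((norm (\<psi> y))\<^sup>2) \<partial>\<kappa> x) \<noteq> \<infinity>"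
    using nn_integral_norm_square_disintegration
      measurable_kernel_nn_integral[of "\<lambda>(x, y). ennreal ((norm (\<psi> y))\<^sup>2)"]
    by (intro nn_integral_PInf_AE) simp_all
  then show ?thesis
    using AE_space by eventually_elim (simp add: cond_domain_def less_top)
qed

lemma kernel_square_integrable:
  assumes "x \<in> domY"
  shows "square_integrable (\<kappa> x) \<psi>"
proof -
  have "\<psi> \<in> borel_measurable (\<kappa> x)"
    using sets_kernel_eq[OF dom_subset[OF assms]] by (simp cong: measurable_cong_sets)
  moreover from this have "integrable (\<kappa> x) (\<lambda>y. (norm (\<psi> y))\<^sup>2)"
    using assms by (intro integrableI_nonneg) (auto simp: cond_domain_def)
  ultimately show ?thesis
    by (simp add: square_integrable_def)
qed

lemma cond_mean_measurable [measurable]: "m \<in> borel_measurable MX"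
  unfolding cond_mean_def[abs_def]
  using measurable_kernel_integral[of "\<lambda>(x, y). \<psi> y"] by simp

lemma cond_mean_inner_measurable: "(\<lambda>x. a \<bullet> m x) \<in> borel_measurable MX"
  by measurable

lemma cond_mean_inner:
  assumes "x \<in> domY"
  shows "a \<bullet> m x = (\<integral>y. a \<bullet> \<psi> y \<partial>\<kappa> x)"
proof -
  interpret K: prob_space "\<kappa> x" by (rule kernel_prob[OF dom_subset[OF assms]])
  show ?thesis
    using assms K.square_integrable_integrable[OF kernel_square_integrable[OF assms]]
    by (simp add: cond_mean_def)
qed

lemma cond_cov_inner:
  assumes "x \<in> domY"
  shows "blinfun_apply (C x) a \<bullet> b = (\<integral>y. (a \<bullet> (\<psi> y - m x)) * (b \<bullet> (\<psi> y - m x)) \<partial>\<kappa> x)"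
proof -
  interpret K: prob_space "\<kappa> x" by (rule kernel_prob[OF dom_subset[OF assms]])
  show ?thesis
    using K.Cov_inner[OF kernel_square_integrable[OF assms] kernel_square_integrable[OF assms]] assms
    by (simp add: cond_cov_def cond_mean_def)
qed

text \<open>
  The variance is nonnegative, so this bounds the norm of the conditional mean by the conditional second
  moment.
\<close>

lemma kernel_norm_square_decomposition:
  assumes "x \<in> domY"
  shows "(\<integral>y. (norm (\<psi> y))\<^sup>2 \<partial>\<kappa> x) = (\<integral>y. (norm (\<psi> y - m x))\<^sup>2 \<partial>\<kappa> x) + (norm (m x))\<^sup>2"
proof -
  interpret K: prob_space "\<kappa> x" by (rule kernel_prob[OF dom_subset[OF assms]])
  note si = kernel_square_integrable[OF assms]
  have i1: "integrable (\<kappa> x) (\<lambda>y. (norm (\<psi> y - m x))\<^sup>2)"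
    using square_integrable_diff[OF si K.square_integrable_const] by (simp add: square_integrable_def)
  have i2: "integrable (\<kappa> x) (\<lambda>y. m x \<bullet> \<psi> y)"
    by (rule K.square_integrable_integrable[OF square_integrable_inner[OF si]])
  have "(\<integral>y. (norm (\<psi> y))\<^sup>2 \<partial>\<kappa> x)
      = (\<integral>y. (norm (\<psi> y - m x))\<^sup>2 + 2 * (m x \<bullet> \<psi> y) - (norm (m x))\<^sup>2 \<partial>\<kappa> x)"
    by (simp add: power2_norm_eq_inner inner_diff_left inner_diff_right inner_commute)
  also have "\<dots> = (\<integral>y. (norm (\<psi> y - m x))\<^sup>2 \<partial>\<kappa> x) + 2 * (\<integral>y. m x \<bullet> \<psi> y \<partial>\<kappa> x) - (norm (m x))\<^sup>2"
    using i1 i2 by (simp add: K.prob_space)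
  also have "(\<integral>y. m x \<bullet> \<psi> y \<partial>\<kappa> x) = (norm (m x))\<^sup>2"
    by (simp add: cond_mean_inner[OF assms, symmetric] power2_norm_eq_inner)
  finally show ?thesis by simp
qed

lemma norm_cond_mean_square_le:
  assumes "x \<in> domY"
  shows "(norm (m x))\<^sup>2 \<le> (\<integral>y. (norm (\<psi> y))\<^sup>2 \<partial>\<kappa> x)"
  unfolding kernel_norm_square_decomposition[OF assms] by simp

lemma norm_square_disintegration:
  "integrable law (\<lambda>x. \<integral>y. (norm (\<psi> y))\<^sup>2 \<partial>\<kappa> x)"
  using integral_disintegration(2)[of "\<lambda>(x, y). (norm (\<psi> y))\<^sup>2"] square_integrable_\<psi>Y
  by (auto simp: square_integrable_def intro: integrable.intros)

lemma square_integrable_cond_mean: "square_integrable law m"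
  unfolding square_integrable_def
proof
  show "integrable law (\<lambda>x. (norm (m x))\<^sup>2)"
  proof (rule Bochner_Integration.integrable_bound[OF norm_square_disintegration])
    show "AE x in law. norm ((norm (m x))\<^sup>2) \<le> norm (\<integral>y. (norm (\<psi> y))\<^sup>2 \<partial>\<kappa> x)"
      using AE_dom by eventually_elim (use norm_cond_mean_square_le in force)
  qed measurable
qed measurable

lemma square_integrable_compose_X:
  fixes g :: "'x \<Rightarrow> 'c::{real_inner,second_countable_topology}"
  shows "g \<in> borel_measurable MX \<Longrightarrow> square_integrable P (\<lambda>\<omega>. g (X \<omega>)) \<longleftrightarrow> square_integrable law g"
  unfolding square_integrable_def by (auto simp: integrable_distr_eq)

text \<open>
  The conditional mean is the orthogonal projection of \<open>\<psi> (Y)\<close> onto the square integrable functions of \<open>X\<close>: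
  the residual is orthogonal to all of them.
\<close>

lemma cond_mean_projection:
  assumes [measurable]: "g \<in> borel_measurable MX" and g: "square_integrable law (g :: 'x \<Rightarrow> real)"
  shows "(\<integral>\<omega>. (a \<bullet> \<psi> (Y \<omega>)) * g (X \<omega>) \<partial>P) = (\<integral>\<omega>. (a \<bullet> m (X \<omega>)) * g (X \<omega>) \<partial>P)"
proof -
  have int: "integrable P (\<lambda>\<omega>. (a \<bullet> \<psi> (Y \<omega>)) * g (X \<omega>))"
    by (rule square_integrable_mult_integrable[OF square_integrable_inner[OF square_integrable_\<psi>Y]])
       (simp add: square_integrable_compose_X g)
  have "(\<integral>\<omega>. (a \<bullet> \<psi> (Y \<omega>)) * g (X \<omega>) \<partial>P) = (\<integral>x. \<integral>y. (a \<bullet> \<psi> y) * g x \<partial>\<kappa> x \<partial>law)"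
    using integral_disintegration(2)[of "\<lambda>(x, y). (a \<bullet> \<psi> y) * g x"] int
    by (simp add: has_bochner_integral_integral_eq)
  also have "\<dots> = (\<integral>x. (a \<bullet> m x) * g x \<partial>law)"
  proof (rule integral_cong_AE)
    show "(\<lambda>x. \<integral>y. (a \<bullet> \<psi> y) * g x \<partial>\<kappa> x) \<in> borel_measurable law"
      using measurable_kernel_integral[of "\<lambda>(x, y). (a \<bullet> \<psi> y) * g x"] by simp
    show "AE x in law. (\<integral>y. (a \<bullet> \<psi> y) * g x \<partial>\<kappa> x) = (a \<bullet> m x) * g x"
      using AE_dom by eventually_elim (simp add: cond_mean_inner)
  qed measurable
  also have "\<dots> = (\<integral>\<omega>. (a \<bullet> m (X \<omega>)) * g (X \<omega>) \<partial>P)"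
    by (rule integral_distr) measurable
  finally show ?thesis .
qed

text \<open>
  On events that depend on \<open>X\<close> only, \<open>\<psi> (Y)\<close> and \<open>m (X)\<close> have the same integral, and functions with equal
  integrals over all sets agree almost everywhere.
\<close>

lemma AE_cond_mean_eqI:
  fixes r :: "'x \<Rightarrow> real"
  assumes r [measurable]: "r \<in> borel_measurable MX" and int: "integrable P (\<lambda>\<omega>. r (X \<omega>))"
    and eq: "\<And>S. S \<in> sets MX \<Longrightarrow>
      (\<integral>\<omega>. (a \<bullet> \<psi> (Y \<omega>)) * indicator S (X \<omega>) \<partial>P) = (\<integral>\<omega>. r (X \<omega>) * indicator S (X \<omega>) \<partial>P)"
  shows "AE x in law. a \<bullet> m x = r x"
proof (rule density_unique_real)
  show "integrable law (\<lambda>x. a \<bullet> m x)"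
    by (rule law.square_integrable_integrable[OF square_integrable_inner[OF square_integrable_cond_mean]])
  show "integrable law r"
    using int by (simp add: integrable_distr_eq)
  fix S assume "S \<in> sets law"
  then have S [measurable]: "S \<in> sets MX" by simp
  have set: "(LINT x:S|law. f x) = (\<integral>\<omega>. f (X \<omega>) * indicator S (X \<omega>) \<partial>P)"
    if [measurable]: "f \<in> borel_measurable MX" for f :: "'x \<Rightarrow> real"
  proof -
    have "(LINT x:S|law. f x) = (\<integral>x. f x * indicator S x \<partial>law)"
      by (simp add: set_lebesgue_integral_def mult.commute)
    also have "\<dots> = (\<integral>\<omega>. f (X \<omega>) * indicator S (X \<omega>) \<partial>P)"
      by (rule integral_distr) measurable
    finally show ?thesis .
  qed
  have "square_integrable law (indicator S :: 'x \<Rightarrow> real)"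
    by (rule square_integrable_bound[OF law.square_integrable_const[of "1::real"], where K=1])
       (auto simp: indicator_def)
  then have "(\<integral>\<omega>. (a \<bullet> m (X \<omega>)) * indicator S (X \<omega>) \<partial>P) = (\<integral>\<omega>. r (X \<omega>) * indicator S (X \<omega>) \<partial>P)"
    by (intro trans[OF cond_mean_projection[symmetric] eq[OF S]]) simp_all
  then show "(LINT x:S|law. a \<bullet> m x) = (LINT x:S|law. r x)"
    by (simp add: set[OF r] set[OF cond_mean_inner_measurable])
qed

lemma cond_cov_entry_measurable [measurable]:
  "(\<lambda>x. blinfun_apply (C x) a \<bullet> b) \<in> borel_measurable MX"
proof -
  have "(\<lambda>x. if x \<in> domY then \<integral>y. (a \<bullet> (\<psi> y - m x)) * (b \<bullet> (\<psi> y - m x)) \<partial>\<kappa> x else 0) \<in> borel_measurable MX"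
    using measurable_kernel_integral[of "\<lambda>(x, y). (a \<bullet> (\<psi> y - m x)) * (b \<bullet> (\<psi> y - m x))"]
    by simp
  also have "(\<lambda>x. if x \<in> domY then \<integral>y. (a \<bullet> (\<psi> y - m x)) * (b \<bullet> (\<psi> y - m x)) \<partial>\<kappa> x else 0)
      = (\<lambda>x. blinfun_apply (C x) a \<bullet> b)"
    by (auto simp: fun_eq_iff cond_cov_inner) (simp add: cond_cov_def)
  finally show ?thesis .
qed

text \<open>
  The conditional covariance averages to the covariance of the residuals, on every event that depends on \<open>X\<close>
  only.
\<close>

lemma cond_cov_disintegration:
  shows "integrable law (\<lambda>x. blinfun_apply (C x) a \<bullet> b)"
    and "S \<in> sets MX \<Longrightarrow> (LINT x:S|law. blinfun_apply (C x) a \<bullet> b) =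
      (\<integral>\<omega>. indicator S (X \<omega>) * (residual a \<omega> * residual b \<omega>) \<partial>P)"
proof -
  have D: "square_integrable P (\<lambda>\<omega>. \<psi> (Y \<omega>) - m (X \<omega>))"
    by (intro square_integrable_diff square_integrable_\<psi>Y)
       (simp add: square_integrable_compose_X square_integrable_cond_mean)
  have iD: "integrable P (\<lambda>\<omega>. residual a \<omega> * residual b \<omega>)"
    by (rule square_integrable_mult_integrable; rule square_integrable_inner[OF D])
  have *: "has_bochner_integral law (\<lambda>x. indicator S x * (blinfun_apply (C x) a \<bullet> b))
      (\<integral>\<omega>. indicator S (X \<omega>) * (residual a \<omega> * residual b \<omega>) \<partial>P)"
    if [measurable]: "S \<in> sets MX" for S
  proof -
    let ?F = "\<lambda>(x, y). indicator S x * ((a \<bullet> (\<psi> y - m x)) * (b \<bullet> (\<psi> y - m x)))"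
    have "integrable P (\<lambda>\<omega>. indicator S (X \<omega>) * (residual a \<omega> * residual b \<omega>))"
      by (rule Bochner_Integration.integrable_bound[OF iD]) (auto simp: indicator_def)
    then have "has_bochner_integral law (\<lambda>x. \<integral>y. ?F (x, y) \<partial>\<kappa> x)
      (\<integral>\<omega>. indicator S (X \<omega>) * (residual a \<omega> * residual b \<omega>) \<partial>P)"
      using integral_disintegration(2)[of ?F] by simp
    then show ?thesis
    proof (rule has_bochner_integral_cong_AE[THEN iffD1, rotated -1])
      show "(\<lambda>x. \<integral>y. ?F (x, y) \<partial>\<kappa> x) \<in> borel_measurable law"
        using measurable_kernel_integral[of ?F] by simp
      show "AE x in law. (\<integral>y. ?F (x, y) \<partial>\<kappa> x) = indicator S x * (blinfun_apply (C x) a \<bullet> b)"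
        using AE_dom by eventually_elim (simp add: cond_cov_inner)
      show "(\<lambda>x. indicator S x * (blinfun_apply (C x) a \<bullet> b)) \<in> borel_measurable law"
        using cond_cov_entry_measurable by measurable
    qed
  qed
  have "has_bochner_integral law (\<lambda>x. indicator (space MX) x * (blinfun_apply (C x) a \<bullet> b))
      (\<integral>\<omega>. indicator (space MX) (X \<omega>) * (residual a \<omega> * residual b \<omega>) \<partial>P)"
    by (rule *) simp
  then have "integrable law (\<lambda>x. indicator (space MX) x * (blinfun_apply (C x) a \<bullet> b))"
    by (rule integrable.intros)
  also have "?this \<longleftrightarrow> integrable law (\<lambda>x. blinfun_apply (C x) a \<bullet> b)"
    by (rule Bochner_Integration.integrable_cong) (simp_all add: indicator_def)
  finally show "integrable law (\<lambda>x. blinfun_apply (C x) a \<bullet> b)" .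
  show "(LINT x:S|law. blinfun_apply (C x) a \<bullet> b) =
      (\<integral>\<omega>. indicator S (X \<omega>) * (residual a \<omega> * residual b \<omega>) \<partial>P)"
    if "S \<in> sets MX"
    using *[OF that] by (simp add: set_lebesgue_integral_def has_bochner_integral_integral_eq)
qed

text \<open>
  The entries are measurable by the kernel property, and \<open>C x\<close> is the operator-norm limit of finite matrices
  formed from them.
\<close>

lemma cond_cov_measurable: "strongly_measurable MX C"
proof -
  obtain e :: "nat \<Rightarrow> 'g" where e: "\<And>v. (\<lambda>n. \<Sum>i<n. (v \<bullet> e i) *\<^sub>R e i) \<longlonglongrightarrow> v"
    "\<And>v n. norm (\<Sum>i<n. (v \<bullet> e i) *\<^sub>R e i) \<le> norm v"
    by (rule obtain_parseval_frame) blast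
  show ?thesis
  proof (rule strongly_measurable_LIMSEQ)
    show "(\<lambda>n. \<Sum>i<n. \<Sum>j<n. (blinfun_apply (C x) (e j) \<bullet> e i) *\<^sub>R tensor_op (e i) (e j)) \<longlonglongrightarrow> C x"
      if "x \<in> space MX" for x
    proof (cases "x \<in> domY")
      case True
      interpret K: prob_space "\<kappa> x" by (rule kernel_prob[OF that])
      show ?thesis
        using K.Cov_finite_rank_approx[OF kernel_square_integrable[OF True] e] True
        by (simp add: cond_cov_def)
    next
      case False
      then show ?thesis by (simp add: cond_cov_def)
    qed
    show "strongly_measurable MX
        (\<lambda>x. \<Sum>i<n. \<Sum>j<n. (blinfun_apply (C x) (e j) \<bullet> e i) *\<^sub>R tensor_op (e i) (e j))" for n
      by (rule strongly_measurable_sum, rule strongly_measurable_sum,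
          rule strongly_measurable_compose[OF strongly_measurable_separable[OF cond_cov_entry_measurable]])
         (rule continuous_on_scaleR[OF continuous_on_id continuous_on_const])
  qed
qed

lemma norm_cond_cov_le:
  assumes "x \<in> domY"
  shows "norm (C x) \<le> (\<integral>y. (norm (\<psi> y))\<^sup>2 \<partial>\<kappa> x)"
proof (rule norm_blinfun_le_of_inner)
  interpret K: prob_space "\<kappa> x" by (rule kernel_prob[OF dom_subset[OF assms]])
  show "0 \<le> (\<integral>y. (norm (\<psi> y))\<^sup>2 \<partial>\<kappa> x)" by simp
  fix a b
  let ?W = "\<lambda>y. \<psi> y - m x"
  have W: "square_integrable (\<kappa> x) ?W"
    by (rule square_integrable_diff[OF kernel_square_integrable[OF assms] K.square_integrable_const])
  have "\<bar>blinfun_apply (C x) a \<bullet> b\<bar> \<le> (\<integral>y. \<bar>(a \<bullet> ?W y) * (b \<bullet> ?W y)\<bar> \<partial>\<kappa> x)"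
    unfolding cond_cov_inner[OF assms] by (rule integral_abs_bound)
  also have "\<dots> \<le> (\<integral>y. (norm a * norm b) * (norm (?W y))\<^sup>2 \<partial>\<kappa> x)"
  proof (rule integral_mono)
    show "integrable (\<kappa> x) (\<lambda>y. \<bar>(a \<bullet> ?W y) * (b \<bullet> ?W y)\<bar>)"
      by (rule integrable_abs, rule square_integrable_mult_integrable; rule square_integrable_inner[OF W])
    show "integrable (\<kappa> x) (\<lambda>y. (norm a * norm b) * (norm (?W y))\<^sup>2)"
      using W by (simp add: square_integrable_def)
    show "\<bar>(a \<bullet> ?W y) * (b \<bullet> ?W y)\<bar> \<le> (norm a * norm b) * (norm (?W y))\<^sup>2" for y
    proof -
      have "\<bar>(a \<bullet> ?W y) * (b \<bullet> ?W y)\<bar> \<le> (norm a * norm (?W y)) * (norm b * norm (?W y))"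
        unfolding abs_mult by (intro mult_mono Cauchy_Schwarz_ineq2) auto
      then show ?thesis by (simp add: power2_eq_square ac_simps)
    qed
  qed
  also have "\<dots> \<le> (norm a * norm b) * (\<integral>y. (norm (\<psi> y))\<^sup>2 \<partial>\<kappa> x)"
    unfolding kernel_norm_square_decomposition[OF assms] by (simp add: mult_left_mono)
  finally show "\<bar>blinfun_apply (C x) a \<bullet> b\<bar> \<le> (\<integral>y. (norm (\<psi> y))\<^sup>2 \<partial>\<kappa> x) * norm a * norm b"
    by (simp add: ac_simps)
qed

text \<open>
  The integrals over \<open>P\<close> and over the law of \<open>X\<close> are obtained separately; they coincide because they have the
  same entries.
\<close>

lemma expected_cond_cov_exists:
  obtains I where "has_banach_integral law C I" "has_banach_integral P (\<lambda>\<omega>. C (X \<omega>)) I"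
    "\<And>a b. blinfun_apply I a \<bullet> b
       = (\<integral>\<omega>. residual a \<omega> * residual b \<omega> \<partial>P)"
proof -
  have Cm: "C \<in> borel_measurable MX"
    by (rule strongly_measurable_borel[OF cond_cov_measurable])
  have [measurable]: "(\<lambda>x. norm (C x)) \<in> borel_measurable MX"
    by (rule borel_measurable_continuous_on[OF _ Cm]) (intro continuous_on_norm continuous_on_id)
  have fin: "(\<integral>\<^sup>+x. ennreal (norm (C x)) \<partial>law) < \<infinity>"
  proof -
    have "(\<integral>\<^sup>+x. ennreal (norm (C x)) \<partial>law) \<le> (\<integral>\<^sup>+x. ennreal (\<integral>y. (norm (\<psi> y))\<^sup>2 \<partial>\<kappa> x) \<partial>law)"
      using AE_dom by (intro nn_integral_mono_AE, eventually_elim) (intro ennreal_leI norm_cond_cov_le)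
    also have "\<dots> < \<infinity>"
      using integrableD(2)[OF norm_square_disintegration] by (simp add: less_top)
    finally show ?thesis .
  qed
  have "strongly_measurable law C"
    using cond_cov_measurable by (simp add: strongly_measurable_def simple_function_def)
  from has_banach_integral_exists[OF this fin] obtain I where I: "has_banach_integral law C I" ..
  have "strongly_measurable P (\<lambda>\<omega>. C (X \<omega>))"
  proof -
    obtain s where s: "\<And>i. simple_function MX (s i)" "\<And>x. x \<in> space MX \<Longrightarrow> (\<lambda>i. s i x) \<longlonglongrightarrow> C x"
      using cond_cov_measurable unfolding strongly_measurable_def by metis
    have "simple_function P (\<lambda>\<omega>. s i (X \<omega>))" for i
      by (rule simple_function_comp[OF X s(1)])
    moreover have "X \<omega> \<in> space MX" if "\<omega> \<in> space P" for \<omega>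
      using X that by (rule measurable_space)
    ultimately show ?thesis
      unfolding strongly_measurable_def by (intro exI[of _ "\<lambda>i \<omega>. s i (X \<omega>)"]) (simp add: s(2))
  qed
  moreover have "(\<integral>\<^sup>+\<omega>. ennreal (norm (C (X \<omega>))) \<partial>P) < \<infinity>"
    using fin by (simp add: nn_integral_distr)
  ultimately obtain J where J: "has_banach_integral P (\<lambda>\<omega>. C (X \<omega>)) J"
    using has_banach_integral_exists by blast
  have I_eq: "blinfun_apply I a \<bullet> b = (\<integral>x. blinfun_apply (C x) a \<bullet> b \<partial>law)" for a b
    using has_banach_integral_blinfun_inner[OF I, of a b]
    by (simp add: has_bochner_integral_integral_eq)
  have J_eq: "blinfun_apply J a \<bullet> b = (\<integral>\<omega>. blinfun_apply (C (X \<omega>)) a \<bullet> b \<partial>P)" for a b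
    using has_banach_integral_blinfun_inner[OF J, of a b]
    by (simp add: has_bochner_integral_integral_eq)
  have "blinfun_apply I a \<bullet> b = blinfun_apply J a \<bullet> b" for a b
    unfolding I_eq J_eq by (rule integral_distr) measurable
  then have "I = J"
    by (intro blinfun_eqI) (metis vector_eq_ldot inner_commute)
  moreover have "blinfun_apply I a \<bullet> b
       = (\<integral>\<omega>. residual a \<omega> * residual b \<omega> \<partial>P)" for a b
  proof -
    let ?h = "\<lambda>\<omega>. residual a \<omega> * residual b \<omega>"
    have "(\<integral>x. blinfun_apply (C x) a \<bullet> b \<partial>law) = (LINT x:space MX|law. blinfun_apply (C x) a \<bullet> b)"
      unfolding set_lebesgue_integral_def
      by (rule Bochner_Integration.integral_cong) (simp_all add: indicator_def)
    also have "\<dots> = (\<integral>\<omega>. indicator (space MX) (X \<omega>) * ?h \<omega> \<partial>P)"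
      by (rule cond_cov_disintegration(2)) simp
    also have "\<dots> = (\<integral>\<omega>. ?h \<omega> \<partial>P)"
      by (rule Bochner_Integration.integral_cong) (simp_all add: indicator_def measurable_space[OF X])
    finally show ?thesis by (simp add: I_eq)
  qed
  ultimately show thesis
    using that I J by blast
qed

end

section \<open>Existence of regular conditional distributions\<close>

text \<open>
  The function \<open>c\<close> is the Radon-Nikodym density of \<open>A \<mapsto> P(Z \<in> A, S)\<close> with respect to the law of \<open>Z\<close>, cut off
  at \<open>1\<close>.
\<close>

lemma (in prob_space) conditional_probability_exists:
  assumes Z [measurable]: "Z \<in> M \<rightarrow>\<^sub>M MZ" and S [measurable]: "S \<in> sets M"
  obtains c where "c \<in> borel_measurable MZ" "\<And>v. 0 \<le> c v" "\<And>v. c v \<le> (1::real)"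
    "\<And>A. A \<in> sets MZ \<Longrightarrow> (LINT v:A|distr M MZ Z. c v) = prob (Z -` A \<inter> space M \<inter> S)"
proof -
  let ?\<mu> = "distr M MZ Z"
  interpret \<mu>: prob_space ?\<mu> by (rule prob_space_distr) (rule Z)
  define N where "N = distr (density M (indicator S)) MZ Z"
  have N_eq: "emeasure N A = emeasure M (Z -` A \<inter> space M \<inter> S)" if [measurable]: "A \<in> sets MZ" for A
  proof -
    have "emeasure N A = (\<integral>\<^sup>+x. indicator S x * indicator (Z -` A \<inter> space M) x \<partial>M)"
      unfolding N_def by (subst emeasure_distr) (auto simp: emeasure_density)
    also have "\<dots> = (\<integral>\<^sup>+x. indicator (Z -` A \<inter> space M \<inter> S) x \<partial>M)"
      by (intro nn_integral_cong) (auto simp: indicator_def)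
    finally show ?thesis by simp
  qed
  have fin: "finite_measure N"
    by (rule finite_measureI) (simp add: N_eq N_def[THEN arg_cong[where f=space]])
  then interpret N: finite_measure N .
  have sets: "sets N = sets ?\<mu>" by (simp add: N_def)
  have ac: "absolutely_continuous ?\<mu> N"
    unfolding absolutely_continuous_def
  proof
    fix A assume "A \<in> null_sets ?\<mu>"
    then have A [measurable]: "A \<in> sets MZ" and "emeasure M (Z -` A \<inter> space M) = 0"
      by (auto simp: null_sets_def emeasure_distr)
    moreover have "emeasure M (Z -` A \<inter> space M \<inter> S) \<le> emeasure M (Z -` A \<inter> space M)"
      by (intro emeasure_mono) auto
    ultimately show "A \<in> null_sets N"
      by (auto simp: null_sets_def N_eq sets)
  qed
  define H where "H v = enn2real (RN_deriv ?\<mu> N v)" for v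
  have [measurable]: "H \<in> borel_measurable MZ"
    unfolding H_def[abs_def] using borel_measurable_RN_deriv[of ?\<mu> N] by simp
  note Nsf = N.sigma_finite_measure_axioms
  have H_int: "integrable ?\<mu> H"
    using \<mu>.RN_deriv_integrable[OF Nsf ac sets, of "\<lambda>_. 1"] by (simp add: H_def[abs_def])
  have H_set: "(LINT v:A|?\<mu>. H v) = prob (Z -` A \<inter> space M \<inter> S)" if [measurable]: "A \<in> sets MZ" for A
  proof -
    have "(LINT v:A|?\<mu>. H v) = (\<integral>v. H v * indicator A v \<partial>?\<mu>)"
      unfolding set_lebesgue_integral_def by (simp add: mult.commute)
    also have "\<dots> = (\<integral>v. indicator A v \<partial>N)"
      unfolding H_def by (rule \<mu>.RN_deriv_integral[OF Nsf ac sets, symmetric]) simp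
    also have "\<dots> = measure N A"
      using sets.sets_into_space[OF that] by (simp add: N_def Int_absorb2)
    finally show ?thesis by (simp add: measure_def N_eq)
  qed
  have H_le: "AE v in ?\<mu>. 0 \<le> 1 - H v"
  proof (rule \<mu>.density_nonneg)
    show "integrable ?\<mu> (\<lambda>v. 1 - H v)" using H_int by simp
    fix A assume "A \<in> sets ?\<mu>"
    then have A [measurable]: "A \<in> sets MZ" by simp
    have "(LINT v:A|?\<mu>. 1 - H v) = (LINT v:A|?\<mu>. 1) - (LINT v:A|?\<mu>. H v)"
      by (rule set_integral_diff(2)) (auto simp: set_integrable_def intro!: integrable_mult_indicator[where f=H, simplified] H_int integrable_real_indicator simp: less_top[symmetric])
    also have "\<dots> = prob (Z -` A \<inter> space M) - prob (Z -` A \<inter> space M \<inter> S)"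
    proof -
      have "(LINT v:A|?\<mu>. 1) = prob (Z -` A \<inter> space M)"
        using sets.sets_into_space[OF A]
        by (simp add: set_lebesgue_integral_def measure_distr Int_absorb2)
      then show ?thesis by (simp only: H_set[OF A])
    qed
    also have "\<dots> \<ge> 0"
      using finite_measure_mono[of "Z -` A \<inter> space M \<inter> S" "Z -` A \<inter> space M"] by auto
    finally show "0 \<le> (LINT v:A|?\<mu>. 1 - H v)" .
  qed
  show thesis
  proof (rule that[of "\<lambda>v. min 1 (H v)"])
    fix A assume [measurable]: "A \<in> sets MZ"
    have "(LINT v:A|?\<mu>. min 1 (H v)) = (LINT v:A|?\<mu>. H v)"
      unfolding set_lebesgue_integral_def
      by (intro integral_cong_AE) (use H_le in \<open>auto simp: min_def\<close>)
    then show "(LINT v:A|?\<mu>. min 1 (H v)) = prob (Z -` A \<inter> space M \<inter> S)"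
      by (simp add: H_set)
  qed (auto simp: H_def)
qed

text \<open>
  Conditional probabilities \<open>G q\<close> of \<open>T \<le> q\<close> are chosen for rational \<open>q\<close> only. The relations that make
  \<open>q \<mapsto> G q v\<close> a distribution function on \<open>[0,1]\<close> are then countably many, so they hold simultaneously for
  all \<open>v\<close> in a set \<open>E\<close> of full measure; there, the infimum over rationals \<open>q > t\<close> is a right-continuous
  distribution function, and Stieltjes measures give the kernel. Outside \<open>E\<close> any probability does.
\<close>

lemma (in prob_space) real_rcd_exists:
  assumes Z [measurable]: "Z \<in> M \<rightarrow>\<^sub>M MZ" and T [measurable]: "T \<in> borel_measurable M"
    and T01: "\<And>\<omega>. \<omega> \<in> space M \<Longrightarrow> 0 \<le> T \<omega> \<and> T \<omega> \<le> (1::real)"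
  shows "\<exists>\<rho>. is_rcd M MZ borel Z T \<rho>"
proof -
  let ?\<mu> = "distr M MZ Z"
  interpret \<mu>: prob_space ?\<mu> by (rule prob_space_distr) (rule Z)
  define S where "S t = {\<omega> \<in> space M. T \<omega> \<le> t}" for t
  have S [measurable]: "S t \<in> sets M" for t
    unfolding S_def by measurable
  have "\<forall>q::rat. \<exists>c. c \<in> borel_measurable MZ \<and> (\<forall>v. 0 \<le> c v) \<and> (\<forall>v. c v \<le> (1::real)) \<and>
      (\<forall>A\<in>sets MZ. (LINT v:A|?\<mu>. c v) = prob (Z -` A \<inter> space M \<inter> S (of_rat q)))"
    using conditional_probability_exists[OF Z S] by metis
  then obtain G where G [measurable]: "\<And>q. G q \<in> borel_measurable MZ"
      and G01: "\<And>q v. 0 \<le> G q v" "\<And>q v. G q v \<le> (1::real)"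
      and G_int: "\<And>q A. A \<in> sets MZ \<Longrightarrow> (LINT v:A|?\<mu>. G q v) = prob (Z -` A \<inter> space M \<inter> S (of_rat q))"
    by metis
  have G_integrable: "integrable ?\<mu> (G q)" for q
    by (rule \<mu>.integrable_const_bound[of _ 1]) (use G01 in auto)
  have G_set: "set_integrable ?\<mu> A (G q)" if "A \<in> sets MZ" for A q
    unfolding set_integrable_def using that by (intro integrable_mult_indicator G_integrable) simp
  have mono: "AE v in ?\<mu>. G q v \<le> G r v" if "q \<le> r" for q r
  proof -
    have "AE v in ?\<mu>. 0 \<le> G r v - G q v"
    proof (rule \<mu>.density_nonneg)
      show "integrable ?\<mu> (\<lambda>v. G r v - G q v)"
        by (intro Bochner_Integration.integrable_diff G_integrable)
      fix A assume "A \<in> sets ?\<mu>"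
      then have A [measurable]: "A \<in> sets MZ" by simp
      have "(LINT v:A|?\<mu>. G r v - G q v) = prob (Z -` A \<inter> space M \<inter> S (of_rat r)) - prob (Z -` A \<inter> space M \<inter> S (of_rat q))"
        by (subst set_integral_diff(2)) (simp_all add: G_set G_int)
      also have "\<dots> \<ge> 0"
      proof -
        have "real_of_rat q \<le> of_rat r" using that by (simp add: of_rat_less_eq)
        then have "S (of_rat q) \<subseteq> S (of_rat r)" by (auto simp: S_def)
        then have "Z -` A \<inter> space M \<inter> S (of_rat q) \<subseteq> Z -` A \<inter> space M \<inter> S (of_rat r)" by auto
        then show ?thesis by (simp add: finite_measure_mono)
      qed
      finally show "0 \<le> (LINT v:A|?\<mu>. G r v - G q v)" .
    qed
    then show ?thesis by eventually_elim simp
  qed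
  have neg: "AE v in ?\<mu>. G q v = 0" if "q < 0" for q
  proof (rule \<mu>.density_zero[OF G_integrable])
    fix A assume "A \<in> sets ?\<mu>"
    have "real_of_rat q < 0" using that by simp
    then have "\<not> T \<omega> \<le> of_rat q" if "\<omega> \<in> space M" for \<omega> using T01[OF that] by linarith
    then have "S (of_rat q) = {}" by (auto simp: S_def)
    then show "(LINT v:A|?\<mu>. G q v) = 0"
      using \<open>A \<in> sets ?\<mu>\<close> by (simp add: G_int)
  qed
  have one: "AE v in ?\<mu>. G q v = 1" if "1 \<le> q" for q
  proof (rule density_unique_real[OF G_integrable])
    show "integrable ?\<mu> (\<lambda>_. 1::real)" by simp
    fix A assume "A \<in> sets ?\<mu>"
    then have A [measurable]: "A \<in> sets MZ" by simp
    have "1 \<le> real_of_rat q" using that by simp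
    then have "T \<omega> \<le> of_rat q" if "\<omega> \<in> space M" for \<omega> using T01[OF that] by linarith
    then have "S (of_rat q) = space M" by (auto simp: S_def)
    then have "(LINT v:A|?\<mu>. G q v) = prob (Z -` A \<inter> space M)"
      by (simp add: G_int)
    then show "(LINT v:A|?\<mu>. G q v) = (LINT v:A|?\<mu>. 1)"
      using sets.sets_into_space[OF A]
      by (simp add: set_lebesgue_integral_def[of _ _ "\<lambda>_. 1"] measure_distr Int_absorb2)
  qed
  define E where "E = {v \<in> space MZ. (\<forall>q r. q \<le> r \<longrightarrow> G q v \<le> G r v) \<and> (\<forall>q. q < 0 \<longrightarrow> G q v = 0) \<and> (\<forall>q. 1 \<le> q \<longrightarrow> G q v = 1)}"
  have E_sets [measurable]: "E \<in> sets MZ"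
    unfolding E_def by measurable
  have AE_E: "AE v in ?\<mu>. v \<in> E"
  proof -
    have "AE v in ?\<mu>. \<forall>q r. q \<le> r \<longrightarrow> G q v \<le> G r v"
      by (intro AE_all_countable[THEN iffD2] allI) (use mono in \<open>auto intro: AE_I2\<close>)
    moreover have "AE v in ?\<mu>. \<forall>q. q < 0 \<longrightarrow> G q v = 0"
      by (intro AE_all_countable[THEN iffD2] allI) (use neg in \<open>auto intro: AE_I2\<close>)
    moreover have "AE v in ?\<mu>. \<forall>q. 1 \<le> q \<longrightarrow> G q v = 1"
      by (intro AE_all_countable[THEN iffD2] allI) (use one in \<open>auto intro: AE_I2\<close>)
    ultimately show ?thesis
      using AE_space by eventually_elim (simp add: E_def)
  qed
  define Q where "Q t = {q::rat. t < real_of_rat q}" for t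
  have Q_ne: "Q t \<noteq> {}" for t
    using of_rat_dense[of t "t + 1"] by (auto simp: Q_def)
  define F where "F v t = (INF q\<in>Q t. G q v)" for v t
  have F_meas [measurable]: "(\<lambda>v. F v t) \<in> borel_measurable MZ" for t
    unfolding F_def by measurable
  have bdd: "bdd_below ((\<lambda>q. G q v) ` X)" for v X
    using G01(1) by (intro bdd_belowI2[of _ 0])
  have F_le: "F v t \<le> G q v" if "t < of_rat q" for v t q
    unfolding F_def by (rule cINF_lower[OF bdd]) (use that in \<open>simp add: Q_def\<close>)
  have F_less: "\<exists>q. t < of_rat q \<and> G q v < y" if "F v t < y" for v t y
    using that unfolding F_def by (subst (asm) cINF_less_iff[OF Q_ne bdd]) (auto simp: Q_def)
  have F_ge: "y \<le> F v t" if "\<And>q. t < of_rat q \<Longrightarrow> y \<le> G q v" for v t y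
    unfolding F_def by (rule cINF_greatest[OF Q_ne]) (use that in \<open>auto simp: Q_def\<close>)
  have F_mono: "F v s \<le> F v t" if "s \<le> t" for v s t
    by (rule F_ge) (use that in \<open>auto intro: F_le\<close>)
  have F_right: "continuous (at_right t) (F v)" for v t
    unfolding continuous_within
  proof (rule order_tendstoI)
    fix y assume "y < F v t"
    then have "y < F v s" if "t < s" for s
      using F_mono[of t s v] that by simp
    then show "eventually (\<lambda>s. y < F v s) (at_right t)"
      by (auto simp: eventually_at_right_field intro!: exI[of _ "t + 1"])
  next
    fix y assume "F v t < y"
    then obtain q where q: "t < of_rat q" "G q v < y" using F_less by blast
    then have "F v s < y" if "s < of_rat q" for s
      using F_le[OF that, of v] by simp
    then show "eventually (\<lambda>s. F v s < y) (at_right t)"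
      using q(1) by (auto simp: eventually_at_right_field)
  qed
  have F_neg: "F v t = 0" if v: "v \<in> E" and t: "t < 0" for v t
  proof (rule antisym)
    obtain q where q: "t < of_rat q" "real_of_rat q < 0"
      using of_rat_dense[OF t] by auto
    then have "q < 0" by simp
    then have "G q v = 0" using v by (simp add: E_def)
    then show "F v t \<le> 0" using F_le[OF q(1), of v] by simp
    show "0 \<le> F v t" by (rule F_ge) (rule G01)
  qed
  have F_one: "F v t = 1" if v: "v \<in> E" and t: "1 \<le> t" for v t
  proof -
    have "G q v = 1" if "t < of_rat q" for q
    proof -
      have "1 < real_of_rat q" using t that by linarith
      then have "1 \<le> q" by simp
      then show ?thesis using v by (simp add: E_def)
    qed
    then have "F v t = (INF q\<in>Q t. 1)"
      unfolding F_def by (intro INF_cong) (auto simp: Q_def)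
    then show ?thesis using Q_ne by simp
  qed
  define \<rho> where "\<rho> v = (if v \<in> E then interval_measure (F v) else return borel 0)" for v
  have F_bot: "(F v \<longlongrightarrow> 0) at_bot" if "v \<in> E" for v
    by (rule tendsto_eventually) (use F_neg[OF that] in \<open>auto simp: eventually_at_bot_dense\<close>)
  have F_top: "(F v \<longlongrightarrow> 1) at_top" if "v \<in> E" for v
    by (rule tendsto_eventually) (use F_one[OF that] in \<open>auto simp: eventually_at_top_linorder\<close>)
  have \<rho>_prob: "prob_space (\<rho> v)" for v
    using real_distribution_interval_measure[OF F_mono F_right F_bot F_top]
    by (auto simp: \<rho>_def real_distribution_def intro: prob_space_return)
  have \<rho>_sets: "sets (\<rho> v) = sets borel" for v
    by (simp add: \<rho>_def)
  have \<rho>_Iic: "emeasure (\<rho> v) {..t} = ennreal (F v t)" if "v \<in> E" for v t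
    using emeasure_interval_measure_Iic[OF F_mono F_right F_bot] that by (simp add: \<rho>_def)
  have borel_Iic: "sets borel = sigma_sets UNIV (range atMost :: real set set)"
    by (simp only: borel_eq_atMost) simp
  have stable: "Int_stable (range atMost :: real set set)"
    by (auto simp: Int_stable_def min_def intro!: exI)
  have \<rho>_meas: "\<rho> \<in> MZ \<rightarrow>\<^sub>M prob_algebra borel"
  proof (rule measurable_prob_algebra_generated[OF borel_Iic stable])
    fix A assume "A \<in> range (atMost :: real \<Rightarrow> real set)"
    then obtain t where A: "A = {..t}" by auto
    have "(\<lambda>v. emeasure (\<rho> v) A) = (\<lambda>v. if v \<in> E then ennreal (F v t) else emeasure (return borel 0) {..t})"
      using \<rho>_Iic by (auto simp: fun_eq_iff A \<rho>_def)
    then show "(\<lambda>v. emeasure (\<rho> v) A) \<in> borel_measurable MZ"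
      by simp
  qed (use \<rho>_prob \<rho>_sets in auto)
  (* Levels q n decreasing to t: G (q n) tends to F by definition of the infimum, and
     the events T \<le> q n shrink to T \<le> t. *)
  have F_int: "(LINT v:A|?\<mu>. F v t) = prob (Z -` A \<inter> space M \<inter> S t)" if A [measurable]: "A \<in> sets MZ" for A t
  proof -
    have "\<exists>q. t < of_rat q \<and> real_of_rat q < t + 1 / Suc n" for n
      using of_rat_dense[of t "t + 1 / Suc n"] by auto
    then obtain q where q: "\<And>n. t < of_rat (q n)" "\<And>n. real_of_rat (q n) < t + 1 / Suc n"
      by metis
    have q_lim: "(\<lambda>n. real_of_rat (q n)) \<longlonglongrightarrow> t"
    proof (rule tendsto_sandwich[of "\<lambda>_. t"])
      have "(\<lambda>n. t + 1 / real (Suc n)) \<longlonglongrightarrow> t + 0"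
        by (intro tendsto_add tendsto_const LIMSEQ_Suc[OF lim_1_over_n])
      then show "(\<lambda>n. t + 1 / real (Suc n)) \<longlonglongrightarrow> t" by simp
    qed (use q in \<open>auto intro!: always_eventually less_imp_le\<close>)
    have "(\<lambda>n. LINT v:A|?\<mu>. G (q n) v) \<longlonglongrightarrow> (LINT v:A|?\<mu>. F v t)"
      unfolding set_lebesgue_integral_def
    proof (rule integral_dominated_convergence[where w="\<lambda>_. 1"])
      show "AE v in ?\<mu>. (\<lambda>n. indicator A v *\<^sub>R G (q n) v) \<longlonglongrightarrow> indicator A v *\<^sub>R F v t"
        using AE_E
      proof eventually_elim
        case (elim v)
        have "(\<lambda>n. G (q n) v) \<longlonglongrightarrow> F v t"
        proof (rule order_tendstoI)
          fix y assume "y < F v t"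
          then show "eventually (\<lambda>n. y < G (q n) v) sequentially"
            by (intro always_eventually allI) (erule less_le_trans[OF _ F_le[OF q(1)]])
        next
          fix y assume "F v t < y"
          then obtain r where r: "t < of_rat r" "G r v < y" using F_less by blast
          have "eventually (\<lambda>n. real_of_rat (q n) < of_rat r) sequentially"
            using order_tendstoD(2)[OF q_lim r(1)] .
          then show "eventually (\<lambda>n. G (q n) v < y) sequentially"
          proof eventually_elim
            case (elim n)
            then have "q n \<le> r" by (simp add: of_rat_less)
            then have "G (q n) v \<le> G r v" using \<open>v \<in> E\<close> by (simp add: E_def)
            then show ?case using r(2) by simp
          qed
        qed
        then show ?case by (intro tendsto_intros)
      qed
      show "AE v in ?\<mu>. norm (indicator A v *\<^sub>R G (q n) v) \<le> 1" for n
        using G01 by (intro AE_I2) (auto simp: indicator_def)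
    qed measurable
    moreover have "(\<lambda>n. LINT v:A|?\<mu>. G (q n) v) \<longlonglongrightarrow> prob (Z -` A \<inter> space M \<inter> S t)"
    proof -
      have "(\<lambda>n. \<integral>\<omega>. indicator (Z -` A \<inter> space M \<inter> S (of_rat (q n))) \<omega> \<partial>M)
          \<longlonglongrightarrow> (\<integral>\<omega>. indicator (Z -` A \<inter> space M \<inter> S t) \<omega> \<partial>M :: real)"
      proof (rule integral_dominated_convergence[where w="\<lambda>_. 1"])
        show "AE \<omega> in M. (\<lambda>n. indicator (Z -` A \<inter> space M \<inter> S (of_rat (q n))) \<omega> :: real)
            \<longlonglongrightarrow> indicator (Z -` A \<inter> space M \<inter> S t) \<omega>"
        proof (rule AE_I2, rule tendsto_eventually)
          fix \<omega> assume "\<omega> \<in> space M"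
          show "eventually (\<lambda>n. (indicator (Z -` A \<inter> space M \<inter> S (of_rat (q n))) \<omega> :: real)
              = indicator (Z -` A \<inter> space M \<inter> S t) \<omega>) sequentially"
          proof (cases "T \<omega> \<le> t")
            case True
            then have "T \<omega> \<le> of_rat (q n)" for n using q(1)[of n] by simp
            with True show ?thesis by (simp add: S_def indicator_def)
          next
            case False
            then have "eventually (\<lambda>n. real_of_rat (q n) < T \<omega>) sequentially"
              by (intro order_tendstoD(2)[OF q_lim]) simp
            then show ?thesis
              by eventually_elim (use False in \<open>simp add: S_def indicator_def\<close>)
          qed
        qed
      qed (auto simp: indicator_def)
      then show ?thesis
        using A by (simp add: G_int)
    qed
    ultimately show ?thesis
      by (rule LIMSEQ_unique)
  qed
  have "emeasure M {\<omega> \<in> space M. Z \<omega> \<in> A \<and> T \<omega> \<in> B} = (\<integral>\<^sup>+v\<in>A. emeasure (\<rho> v) B \<partial>?\<mu>)"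
    if A [measurable]: "A \<in> sets MZ" and B: "B \<in> sets borel" for A B
  proof -
    define L where "L = distr (density M (indicator (Z -` A \<inter> space M))) borel T"
    define R where "R = density ?\<mu> (indicator A) \<bind> \<rho>"
    have ne: "space (density ?\<mu> (indicator A)) \<noteq> {}"
      using \<mu>.not_empty by simp
    have \<rho>_sub: "\<rho> \<in> density ?\<mu> (indicator A) \<rightarrow>\<^sub>M subprob_algebra borel"
      using measurable_prob_algebraD[OF \<rho>_meas] by simp
    have L_eq: "emeasure L C = emeasure M {\<omega> \<in> space M. Z \<omega> \<in> A \<and> T \<omega> \<in> C}" if [measurable]: "C \<in> sets borel" for C
    proof -
      have "emeasure L C = (\<integral>\<^sup>+\<omega>. indicator (Z -` A \<inter> space M) \<omega> * indicator (T -` C \<inter> space M) \<omega> \<partial>M)"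
        unfolding L_def by (subst emeasure_distr) (auto simp: emeasure_density)
      also have "\<dots> = (\<integral>\<^sup>+\<omega>. indicator {\<omega> \<in> space M. Z \<omega> \<in> A \<and> T \<omega> \<in> C} \<omega> \<partial>M)"
        by (intro nn_integral_cong) (auto simp: indicator_def)
      finally show ?thesis by simp
    qed
    have R_eq: "emeasure R C = (\<integral>\<^sup>+v\<in>A. emeasure (\<rho> v) C \<partial>?\<mu>)" if C: "C \<in> sets borel" for C
    proof -
      have "(\<lambda>v. emeasure (\<rho> v) C) \<in> borel_measurable ?\<mu>"
        using measurable_compose[OF measurable_prob_algebraD[OF \<rho>_meas] measurable_emeasure_subprob_algebra[OF C]] by simp
      then show ?thesis
        unfolding R_def by (subst emeasure_bind[OF ne \<rho>_sub C])
          (simp add: nn_integral_density mult.commute)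
    qed
    have "L = R"
    proof (rule measure_eqI_generator_eq[OF stable, of UNIV _ _ "\<lambda>i. {..real i}"])
      show "sets L = sigma_sets UNIV (range atMost)"
        using borel_Iic by (simp add: L_def)
      show "sets R = sigma_sets UNIV (range atMost)"
        using sets_bind[OF _ ne, of \<rho> borel] \<rho>_sets borel_Iic by (simp add: R_def)
      show "(\<Union>i. {..real i}) = UNIV"
        using real_arch_simple by auto
      show "emeasure L {..real i} \<noteq> \<infinity>" for i
        by (simp add: L_eq)
      fix C assume "C \<in> range (atMost :: real \<Rightarrow> real set)"
      then obtain t where C: "C = {..t}" by auto
      have "emeasure R C = (\<integral>\<^sup>+v. ennreal (indicator A v * F v t) \<partial>?\<mu>)"
      proof -
        have "emeasure R C = (\<integral>\<^sup>+v. emeasure (\<rho> v) C * indicator A v \<partial>?\<mu>)"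
          by (rule R_eq) (simp add: C)
        also have "\<dots> = (\<integral>\<^sup>+v. ennreal (indicator A v * F v t) \<partial>?\<mu>)"
          using AE_E by (intro nn_integral_cong_AE, eventually_elim) (simp add: C \<rho>_Iic indicator_def)
        finally show ?thesis .
      qed
      also have "\<dots> = ennreal (LINT v:A|?\<mu>. F v t)"
      proof -
        have F0: "0 \<le> F v t" for v by (rule F_ge) (rule G01)
        have F1: "F v t \<le> 1" for v
        proof -
          obtain q where "q \<in> Q t" using Q_ne by blast
          then show ?thesis using F_le[of t q v] G01(2)[of q v] by (simp add: Q_def)
        qed
        have "integrable ?\<mu> (\<lambda>v. indicator A v * F v t)"
          by (rule \<mu>.integrable_const_bound[of _ 1]) (use F0 F1 in \<open>auto simp: indicator_def\<close>)
        then show ?thesis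
          unfolding set_lebesgue_integral_def
          by (subst nn_integral_eq_integral) (use F0 in auto)
      qed
      also have "\<dots> = emeasure M {\<omega> \<in> space M. Z \<omega> \<in> A \<and> T \<omega> \<in> C}"
        by (simp add: F_int emeasure_eq_measure)
           (auto simp: S_def C intro!: arg_cong[where f=prob])
      finally show "emeasure L C = emeasure R C"
        by (simp add: L_eq C)
    qed auto
    then show ?thesis
      using L_eq[OF B] R_eq[OF B] by simp
  qed
  with \<rho>_meas show ?thesis
    unfolding is_rcd_def by blast
qed

text \<open>
  The case of values in \<open>[0,1]\<close> is transported along the isomorphism with a Borel set \<open>B\<close>. For exceptional \<open>v\<close> the
  real kernel may charge the complement of \<open>B\<close>, where the inverse is extended by a constant point of \<open>MY\<close>.
\<close>

lemma (in prob_space) rcd_exists: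
  assumes MY: "borel_iso_space MY" and Z [measurable]: "Z \<in> M \<rightarrow>\<^sub>M MZ" and Y [measurable]: "Y \<in> M \<rightarrow>\<^sub>M MY"
  shows "\<exists>\<kappa>. is_rcd M MZ MY Z Y \<kappa>"
proof -
  obtain B f g where B [measurable]: "B \<in> sets (borel :: real measure)" and B01: "B \<subseteq> {0..1}"
    and f: "f \<in> MY \<rightarrow>\<^sub>M restrict_space borel B" and g: "g \<in> restrict_space borel B \<rightarrow>\<^sub>M MY"
    and gf: "\<And>y. y \<in> space MY \<Longrightarrow> g (f y) = y"
    using MY unfolding borel_iso_space_def by blast
  obtain \<omega>0 where "\<omega>0 \<in> space M" using not_empty by blast
  then have y0: "Y \<omega>0 \<in> space MY" by (rule measurable_space[OF Y])
  have fb [measurable]: "f \<in> borel_measurable MY" and fB: "\<And>y. y \<in> space MY \<Longrightarrow> f y \<in> B"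
    using f by (auto simp: measurable_restrict_space2_iff)
  have YS: "\<omega> \<in> space M \<Longrightarrow> Y \<omega> \<in> space MY" for \<omega>
    by (rule measurable_space[OF Y])
  define g' where "g' t = (if t \<in> B then g t else Y \<omega>0)" for t
  have g' [measurable]: "g' \<in> borel \<rightarrow>\<^sub>M MY"
    unfolding g'_def[abs_def]
    by (subst measurable_If_restrict_space_iff) (use g y0 in auto)
  have "\<exists>\<rho>. is_rcd M MZ borel Z (\<lambda>\<omega>. f (Y \<omega>)) \<rho>"
    by (rule real_rcd_exists[OF Z]) (use subsetD[OF B01 fB[OF YS]] in auto)
  then obtain \<rho> where \<rho>: "\<rho> \<in> MZ \<rightarrow>\<^sub>M prob_algebra borel"
    and joint: "\<And>A C. A \<in> sets MZ \<Longrightarrow> C \<in> sets borel \<Longrightarrow>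
        emeasure M {\<omega>\<in>space M. Z \<omega> \<in> A \<and> f (Y \<omega>) \<in> C} = (\<integral>\<^sup>+v\<in>A. emeasure (\<rho> v) C \<partial>distr M MZ Z)"
    unfolding is_rcd_def by blast
  have \<rho>_sets: "sets (\<rho> v) = sets borel" if "v \<in> space MZ" for v
    using measurable_space[OF \<rho> that] by (simp add: space_prob_algebra)
  have "is_rcd M MZ MY Z Y (\<lambda>v. distr (\<rho> v) MY g')"
    unfolding is_rcd_def
  proof (intro conjI ballI)
    show "(\<lambda>v. distr (\<rho> v) MY g') \<in> MZ \<rightarrow>\<^sub>M prob_algebra MY"
      by (rule measurable_compose[OF \<rho> measurable_distr_prob_space[OF g']])
    fix A C assume A: "A \<in> sets MZ" and C [measurable]: "C \<in> sets MY"
    have gC: "g' -` C \<in> sets borel"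
      using measurable_sets[OF g' C] by simp
    have "{\<omega>\<in>space M. Z \<omega> \<in> A \<and> Y \<omega> \<in> C} = {\<omega>\<in>space M. Z \<omega> \<in> A \<and> f (Y \<omega>) \<in> g' -` C}"
      using fB[OF YS] gf[OF YS] by (auto simp: g'_def)
    also have "emeasure M \<dots> = (\<integral>\<^sup>+v\<in>A. emeasure (\<rho> v) (g' -` C) \<partial>distr M MZ Z)"
      by (rule joint[OF A gC])
    also have "\<dots> = (\<integral>\<^sup>+v\<in>A. emeasure (distr (\<rho> v) MY g') C \<partial>distr M MZ Z)"
    proof (rule nn_integral_cong)
      fix v assume "v \<in> space (distr M MZ Z)"
      then have v: "sets (\<rho> v) = sets borel" by (simp add: \<rho>_sets)
      have "g' \<in> \<rho> v \<rightarrow>\<^sub>M MY" using g' by (simp cong: measurable_cong_sets add: v)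
      then show "emeasure (\<rho> v) (g' -` C) * indicator A v = emeasure (distr (\<rho> v) MY g') C * indicator A v"
        using sets_eq_imp_space_eq[OF v] by (simp add: emeasure_distr)
    qed
    finally show "emeasure M {\<omega>\<in>space M. Z \<omega> \<in> A \<and> Y \<omega> \<in> C}
        = (\<integral>\<^sup>+v\<in>A. emeasure (distr (\<rho> v) MY g') C \<partial>distr M MZ Z)" .
  qed
  then show ?thesis by blast
qed

section \<open>Uniqueness of Fourier transforms and independence\<close>

lemma integrable_bounded_times:
  fixes \<xi> g :: "'a \<Rightarrow> complex"
  assumes "integrable M \<xi>" "g \<in> borel_measurable M" "\<And>x. x \<in> space M \<Longrightarrow> norm (g x) \<le> 1"
  shows "integrable M (\<lambda>x. g x * \<xi> x)"
proof (rule Bochner_Integration.integrable_bound[OF assms(1)])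
  show "(\<lambda>x. g x * \<xi> x) \<in> borel_measurable M"
    using assms(1,2) by measurable
  show "AE x in M. norm (g x * \<xi> x) \<le> norm (\<xi> x)"
    using assms(3) by (intro AE_I2) (simp add: norm_mult mult_left_le_one_le)
qed

text \<open>
  The positive and the negative part of \<open>\<eta>\<close> give two measures whose images under \<open>T\<close> have equal mass (take
  \<open>t = 0\<close>) and equal Fourier transforms. After normalisation, Levy's uniqueness theorem applies.
\<close>

lemma (in finite_measure) fourier_uniqueness_real_weight:
  fixes \<eta> T :: "'a \<Rightarrow> real"
  assumes \<eta>: "integrable M \<eta>" and T [measurable]: "T \<in> borel_measurable M"
    and zero: "\<And>t. (\<integral>x. iexp (t * T x) * complex_of_real (\<eta> x) \<partial>M) = 0"
    and B [measurable]: "B \<in> sets borel"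
  shows "(\<integral>x. indicator B (T x) * \<eta> x \<partial>M) = 0"
proof -
  have [measurable]: "\<eta> \<in> borel_measurable M" using \<eta> by measurable
  define p where "p x = max 0 (\<eta> x)" for x
  define n where "n x = max 0 (- \<eta> x)" for x
  have p: "integrable M p" "\<And>x. 0 \<le> p x" and n: "integrable M n" "\<And>x. 0 \<le> n x"
    unfolding p_def[abs_def] n_def[abs_def] using \<eta> by (auto intro!: integrable_max)
  have [measurable]: "p \<in> borel_measurable M" "n \<in> borel_measurable M"
    using p n by auto
  have \<eta>_eq: "\<eta> x = p x - n x" for x by (simp add: p_def n_def max_def)
  have ind: "integrable M (\<lambda>x. indicator B (T x) * q x)" if "integrable M q" for q :: "'a \<Rightarrow> real"
    by (rule Bochner_Integration.integrable_bound[OF that])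
       (use that in \<open>auto simp: indicator_def\<close>)
  have four: "integrable M (\<lambda>x. iexp (t * T x) * complex_of_real (q x))" if "integrable M q" for q t
    using that by (intro integrable_bounded_times integrable_of_real) auto
  have eqF: "(\<integral>x. iexp (t * T x) * complex_of_real (p x) \<partial>M) = (\<integral>x. iexp (t * T x) * complex_of_real (n x) \<partial>M)" for t
  proof -
    have "(\<integral>x. iexp (t * T x) * complex_of_real (p x) - iexp (t * T x) * complex_of_real (n x) \<partial>M) = 0"
      using zero[of t] by (simp add: \<eta>_eq right_diff_distrib)
    then show ?thesis
      using Bochner_Integration.integral_diff[OF four[OF p(1), of t] four[OF n(1), of t]] by simp
  qed
  define c where "c = (\<integral>x. p x \<partial>M)"
  have "complex_of_real (\<integral>x. p x \<partial>M) = complex_of_real (\<integral>x. n x \<partial>M)"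
    using eqF[of 0] by simp
  then have cn: "(\<integral>x. n x \<partial>M) = c"
    unfolding c_def by simp
  have c0: "0 \<le> c" unfolding c_def using p(2) by simp
  show ?thesis
  proof (cases "c = 0")
    case True
    have "AE x in M. p x = 0" "AE x in M. n x = 0"
      using True cn p n integral_nonneg_eq_0_iff_AE[of M p] integral_nonneg_eq_0_iff_AE[of M n]
      by (auto simp: c_def)
    then have "AE x in M. indicator B (T x) * \<eta> x = 0"
      by eventually_elim (simp add: \<eta>_eq)
    then have "(\<integral>x. indicator B (T x) * \<eta> x \<partial>M) = (\<integral>x. 0 \<partial>M)"
      by (intro integral_cong_AE) measurable
    then show ?thesis by simp
  next
    case False
    with c0 have c: "0 < c" by simp
    define L where "L q = distr (density M (\<lambda>x. ennreal (q x / c))) borel T" for q :: "'a \<Rightarrow> real"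
    have L: "real_distribution (L q)" "char (L q) t = (\<integral>x. iexp (t * T x) * complex_of_real (q x) \<partial>M) / c"
        "measure (L q) B = (\<integral>x. indicator B (T x) * q x \<partial>M) / c"
      if q: "integrable M q" "\<And>x. 0 \<le> q x" "(\<integral>x. q x \<partial>M) = c" for q t
    proof -
      have [measurable]: "q \<in> borel_measurable M" using q(1) by measurable
      have "(\<integral>\<^sup>+x. ennreal (q x / c) \<partial>M) = ennreal (\<integral>x. q x / c \<partial>M)"
        using q c by (intro nn_integral_eq_integral) auto
      also have "\<dots> = 1" using q(3) c by simp
      finally have "prob_space (density M (\<lambda>x. ennreal (q x / c)))"
        by (intro prob_spaceI) (simp add: emeasure_density cong: nn_integral_cong_simp)
      then have pL: "prob_space (L q)"
        unfolding L_def by (rule prob_space.prob_space_distr) simp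
      then show "real_distribution (L q)"
        by (intro real_distribution.intro) (auto simp: real_distribution_axioms_def L_def)
      have "char (L q) t = (\<integral>x. iexp (t * T x) \<partial>density M (\<lambda>x. ennreal (q x / c)))"
        unfolding char_def L_def by (subst integral_distr) auto
      also have "\<dots> = (\<integral>x. (q x / c) *\<^sub>R iexp (t * T x) \<partial>M)"
        using q c by (subst integral_density) (auto simp: divide_nonneg_pos)
      also have "\<dots> = (\<integral>x. (iexp (t * T x) * complex_of_real (q x)) / complex_of_real c \<partial>M)"
        by (intro Bochner_Integration.integral_cong refl) (simp add: scaleR_conv_of_real mult.commute)
      finally show "char (L q) t = (\<integral>x. iexp (t * T x) * complex_of_real (q x) \<partial>M) / c"
        by simp
      have "measure (L q) B = (\<integral>y. indicator B y \<partial>L q)"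
        using pL by (simp add: L_def)
      also have "\<dots> = (\<integral>x. indicator B (T x) \<partial>density M (\<lambda>x. ennreal (q x / c)))"
        unfolding L_def by (subst integral_distr) auto
      also have "\<dots> = (\<integral>x. (q x / c) *\<^sub>R indicator B (T x) \<partial>M)"
        using q c by (subst integral_density) (auto simp: divide_nonneg_pos)
      also have "\<dots> = (\<integral>x. (indicator B (T x) * q x) / c \<partial>M)"
        by (intro Bochner_Integration.integral_cong refl) simp
      finally show "measure (L q) B = (\<integral>x. indicator B (T x) * q x \<partial>M) / c"
        by simp
    qed
    note Lp = L[OF p c_def[symmetric]] and Ln = L[OF n cn]
    have "char (L p) = char (L n)"
      by (rule ext) (simp only: Lp(2) Ln(2) eqF)
    then have "L p = L n"
      by (rule Levy_uniqueness[OF Lp(1) Ln(1)])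
    then have "(\<integral>x. indicator B (T x) * p x \<partial>M) = (\<integral>x. indicator B (T x) * n x \<partial>M)"
      using Lp(3) Ln(3) c by simp
    then show ?thesis
      using Bochner_Integration.integral_diff[OF ind[OF p(1)] ind[OF n(1)]]
      by (simp add: \<eta>_eq right_diff_distrib)
  qed
qed

text \<open>
  Complex conjugation turns the hypothesis at \<open>t\<close> into the same hypothesis for \<open>cnj \<eta>\<close> at \<open>-t\<close>, so it holds
  for the real and the imaginary part of \<open>\<eta>\<close> separately.
\<close>

lemma (in finite_measure) fourier_uniqueness_weight:
  fixes \<eta> :: "'a \<Rightarrow> complex" and T :: "'a \<Rightarrow> real"
  assumes \<eta>: "integrable M \<eta>" and T [measurable]: "T \<in> borel_measurable M"
    and zero: "\<And>t. (\<integral>x. iexp (t * T x) * \<eta> x \<partial>M) = 0"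
    and B [measurable]: "B \<in> sets borel"
  shows "(\<integral>x. indicator B (T x) * \<eta> x \<partial>M) = 0"
proof -
  have [measurable]: "\<eta> \<in> borel_measurable M" using \<eta> by measurable
  have four: "integrable M (\<lambda>x. iexp (t * T x) * q x)" if "integrable M q" for q t
    using that by (intro integrable_bounded_times) auto
  have cnj: "(\<integral>x. iexp (t * T x) * cnj (\<eta> x) \<partial>M) = 0" for t
  proof -
    have "(\<integral>x. iexp (t * T x) * cnj (\<eta> x) \<partial>M) = (\<integral>x. cnj (iexp (- t * T x) * \<eta> x) \<partial>M)"
      by (intro Bochner_Integration.integral_cong refl) (simp add: exp_cnj)
    also have "\<dots> = cnj (\<integral>x. iexp (- t * T x) * \<eta> x \<partial>M)"
      by (rule Bochner_Integration.integral_cnj)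
    finally show ?thesis by (simp only: zero) simp
  qed
  have i\<eta>: "integrable M (\<lambda>x. cnj (\<eta> x))" using \<eta> by simp
  have Re: "(\<integral>x. indicator B (T x) * Re (\<eta> x) \<partial>M) = 0"
  proof (rule fourier_uniqueness_real_weight[OF _ T _ B])
    show "(\<integral>x. iexp (t * T x) * complex_of_real (Re (\<eta> x)) \<partial>M) = 0" for t
    proof -
      have half: "complex_of_real (Re z) = (z + cnj z) / 2" for z
        by (simp add: complex_eq_iff)
      then have "(\<integral>x. iexp (t * T x) * complex_of_real (Re (\<eta> x)) \<partial>M)
          = (\<integral>x. (iexp (t * T x) * \<eta> x + iexp (t * T x) * cnj (\<eta> x)) / 2 \<partial>M)"
        by (intro Bochner_Integration.integral_cong refl) (simp only: half, simp add: distrib_left)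
      also have "\<dots> = 0"
        by (simp only: integral_divide_zero zero cnj
            Bochner_Integration.integral_add[OF four[OF \<eta>, of t] four[OF i\<eta>, of t]]) simp
      finally show ?thesis .
    qed
  qed (use \<eta> in simp)
  have Im: "(\<integral>x. indicator B (T x) * Im (\<eta> x) \<partial>M) = 0"
  proof (rule fourier_uniqueness_real_weight[OF _ T _ B])
    show "(\<integral>x. iexp (t * T x) * complex_of_real (Im (\<eta> x)) \<partial>M) = 0" for t
    proof -
      have half: "complex_of_real (Im z) = (z - cnj z) / (2 * \<i>)" for z
        by (simp add: complex_eq_iff)
      then have "(\<integral>x. iexp (t * T x) * complex_of_real (Im (\<eta> x)) \<partial>M)
          = (\<integral>x. (iexp (t * T x) * \<eta> x - iexp (t * T x) * cnj (\<eta> x)) / (2 * \<i>) \<partial>M)"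
        by (intro Bochner_Integration.integral_cong refl) (simp only: half, simp add: right_diff_distrib)
      also have "\<dots> = 0"
        by (simp only: integral_divide_zero zero cnj
            Bochner_Integration.integral_diff[OF four[OF \<eta>, of t] four[OF i\<eta>, of t]]) simp
      finally show ?thesis .
    qed
  qed (use \<eta> in simp)
  have ind: "integrable M (\<lambda>x. indicator B (T x) * \<eta> x)"
    by (rule integrable_bounded_times[OF \<eta>]) (auto simp: indicator_def)
  have "Re (\<integral>x. indicator B (T x) * \<eta> x \<partial>M) = (\<integral>x. indicator B (T x) * Re (\<eta> x) \<partial>M)"
    unfolding integral_Re[OF ind, symmetric]
    by (intro Bochner_Integration.integral_cong refl) (simp add: indicator_def)
  moreover have "Im (\<integral>x. indicator B (T x) * \<eta> x \<partial>M) = (\<integral>x. indicator B (T x) * Im (\<eta> x) \<partial>M)"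
    unfolding integral_Im[OF ind, symmetric]
    by (intro Bochner_Integration.integral_cong refl) (simp add: indicator_def)
  ultimately show ?thesis
    using Re Im by (simp add: complex_eq_iff)
qed

definition cylinder :: "('h::real_inner \<times> real set) list \<Rightarrow> 'h set" where
  "cylinder bs = {v. \<forall>(h, B)\<in>set bs. h \<bullet> v \<in> B}"

lemma cylinder_Cons: "cylinder ((h, B) # bs) = {v. h \<bullet> v \<in> B} \<inter> cylinder bs"
  by (auto simp: cylinder_def)

lemma cylinder_sets [measurable]:
  assumes "\<forall>(h, B)\<in>set bs. B \<in> sets borel"
  shows "cylinder bs \<in> sets (borel :: 'h::{real_inner,second_countable_topology} measure)"
  using assms
proof (induction bs)
  case (Cons b bs)
  obtain h B where b: "b = (h, B)" by (cases b)
  have "{v. h \<bullet> v \<in> B} \<in> sets borel"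
    using Cons.prems b measurable_sets[of "\<lambda>v. h \<bullet> v" borel borel B] by (simp add: vimage_def)
  with Cons show ?case unfolding b cylinder_Cons by auto
qed (simp add: cylinder_def)

lemma sets_borel_cylinder:
  "sets (borel :: 'h::{real_inner,second_countable_topology} measure) =
     sigma_sets UNIV {cylinder bs | bs. \<forall>(h, B)\<in>set bs. B \<in> sets borel}" (is "_ = sigma_sets UNIV ?E")
proof
  let ?M = "sigma UNIV ?E"
  have sets_M: "sets ?M = sigma_sets UNIV ?E" by simp
  have "(\<lambda>v. v) \<in> borel_measurable ?M"
  proof (rule borel_measurable_weakly)
    fix h :: 'h
    show "(\<lambda>v. h \<bullet> v) \<in> borel_measurable ?M"
    proof (rule measurableI)
      fix B :: "real set" assume B: "B \<in> sets borel"
      have "(\<lambda>v. h \<bullet> v) -` B \<inter> space ?M = cylinder [(h, B)]"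
        by (auto simp: cylinder_def)
      also have "\<dots> \<in> sigma_sets UNIV ?E"
        by (rule sigma_sets.Basic) (use B in \<open>auto intro!: exI[of _ "[(h, B)]"]\<close>)
      finally show "(\<lambda>v. h \<bullet> v) -` B \<inter> space ?M \<in> sets ?M" by simp
    qed simp
  qed
  then show "sets borel \<subseteq> sigma_sets UNIV ?E"
    by (auto dest: measurable_sets)
  show "sigma_sets UNIV ?E \<subseteq> sets borel"
    by (rule sets.sigma_sets_subset') (auto intro: cylinder_sets)
qed

text \<open>
  Uniqueness of Fourier transforms for the complex measure \<open>\<xi> dP\<close> transported by \<open>V\<close>. If the transform of
  \<open>\<xi>\<close> vanishes, so does that of \<open>\<xi>\<close> restricted to \<open>k \<bullet> V \<in> B\<close>: fix the frequency \<open>h\<close>, and apply the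
  one-dimensional result to \<open>iexp (h \<bullet> V) * \<xi>\<close> along the direction \<open>k\<close>. Repeating this yields all cylinder
  sets, and these generate the Borel sets.
\<close>

lemma (in finite_measure) fourier_uniqueness_hilbert:
  fixes \<xi> :: "'a \<Rightarrow> complex" and V :: "'a \<Rightarrow> 'h::{real_inner,second_countable_topology}"
  assumes \<xi>: "integrable M \<xi>" and V [measurable]: "V \<in> borel_measurable M"
    and zero: "\<And>h. (\<integral>x. iexp (h \<bullet> V x) * \<xi> x \<partial>M) = 0"
    and A: "A \<in> sets borel"
  shows "(\<integral>x. indicator A (V x) * \<xi> x \<partial>M) = 0"
proof -
  have [measurable]: "\<xi> \<in> borel_measurable M" using \<xi> by measurable
  have ind: "integrable M (\<lambda>x. indicator A (V x) * \<xi> x)" if [measurable]: "A \<in> sets borel" for A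
    by (rule integrable_bounded_times[OF \<xi>]) (auto simp: indicator_def)
  \<comment> \<open>Coordinates are conditioned on one at a time; the free frequency \<open>h\<close> keeps the statement inductive.\<close>
  have cyl: "(\<integral>x. iexp (h \<bullet> V x) * (indicator (cylinder bs) (V x) * \<xi> x) \<partial>M) = 0"
    if "\<forall>(h, B)\<in>set bs. B \<in> sets borel" for h and bs :: "('h \<times> real set) list"
    using that
  proof (induction bs arbitrary: h)
    case Nil
    then show ?case using zero[of h] by (simp add: cylinder_def)
  next
    case (Cons b bs)
    obtain k B where b: "b = (k, B)" by (cases b)
    have B: "B \<in> sets borel" and bs: "\<forall>(h, B)\<in>set bs. B \<in> sets borel"
      using Cons.prems b by auto
    have cb [measurable]: "cylinder bs \<in> sets borel"
      by (rule cylinder_sets[OF bs])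
    let ?\<eta> = "\<lambda>x. iexp (h \<bullet> V x) * (indicator (cylinder bs) (V x) * \<xi> x)"
    have "(\<integral>x. indicator B (k \<bullet> V x) * ?\<eta> x \<partial>M) = 0"
    proof (rule fourier_uniqueness_weight[OF _ _ _ B])
      show "integrable M ?\<eta>"
        by (rule integrable_bounded_times[OF ind[OF cb]]) auto
      show "(\<lambda>x. k \<bullet> V x) \<in> borel_measurable M" by measurable
      fix t
      have "(\<integral>x. iexp (t * (k \<bullet> V x)) * ?\<eta> x \<partial>M)
          = (\<integral>x. iexp ((t *\<^sub>R k + h) \<bullet> V x) * (indicator (cylinder bs) (V x) * \<xi> x) \<partial>M)"
        by (intro Bochner_Integration.integral_cong refl)
           (simp add: inner_add_left exp_add[symmetric] distrib_left mult.assoc[symmetric])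
      also have "\<dots> = 0" by (rule Cons.IH[OF bs])
      finally show "(\<integral>x. iexp (t * (k \<bullet> V x)) * ?\<eta> x \<partial>M) = 0" .
    qed
    also have "(\<integral>x. indicator B (k \<bullet> V x) * ?\<eta> x \<partial>M)
        = (\<integral>x. iexp (h \<bullet> V x) * (indicator (cylinder (b # bs)) (V x) * \<xi> x) \<partial>M)"
      unfolding b cylinder_Cons
      by (intro Bochner_Integration.integral_cong refl) (simp add: indicator_def)
    finally show ?case .
  qed
  let ?E = "{cylinder bs | bs::('h \<times> real set) list. \<forall>(h, B)\<in>set bs. B \<in> sets borel}"
  have E0: "(\<integral>x. indicator A (V x) * \<xi> x \<partial>M) = 0" if "A \<in> ?E" for A
    using that cyl[of _ 0] by auto
  have UNIV0: "(\<integral>x. \<xi> x \<partial>M) = 0"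
    using zero[of 0] by simp
  have stable: "Int_stable ?E"
  proof (rule Int_stableI)
    fix a b assume "a \<in> ?E" "b \<in> ?E"
    then obtain as bs where "a = cylinder as" "\<forall>(h, B)\<in>set as. B \<in> sets borel"
        "b = cylinder bs" "\<forall>(h, B)\<in>set bs. B \<in> sets borel"
      by auto
    then show "a \<inter> b \<in> ?E"
      by (intro CollectI exI[of _ "as @ bs"]) (auto simp: cylinder_def)
  qed
  have closed: "?E \<subseteq> Pow UNIV" by simp
  have borel_eq: "sets borel = sigma_sets UNIV ?E"
    by (rule sets_borel_cylinder)
  then have "A \<in> sigma_sets UNIV ?E"
    using A by simp
  with stable closed show ?thesis
  proof (induction rule: sigma_sets_induct_disjoint)
    case (basic A)
    then show ?case by (rule E0)
  next
    case empty
    show ?case by simp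
  next
    case (compl A)
    have A: "A \<in> sets borel" using compl.hyps borel_eq by simp
    have "(\<integral>x. indicator (UNIV - A) (V x) * \<xi> x \<partial>M) = (\<integral>x. \<xi> x - indicator A (V x) * \<xi> x \<partial>M)"
      by (intro Bochner_Integration.integral_cong refl) (simp add: indicator_def)
    also have "\<dots> = 0"
      using Bochner_Integration.integral_diff[OF \<xi> ind[OF A]] UNIV0 compl.IH by simp
    finally show ?case .
  next
    case (union A)
    have A [measurable]: "A i \<in> sets borel" for i
      using union.hyps borel_eq by auto
    have eq: "(LINT x:(V -` B \<inter> space M)|M. \<xi> x) = (\<integral>x. indicator B (V x) * \<xi> x \<partial>M)" for B
      unfolding set_lebesgue_integral_def
      by (intro Bochner_Integration.integral_cong refl) (auto simp: indicator_def)
    have "(LINT x:(\<Union>i. V -` A i \<inter> space M)|M. \<xi> x) = (\<Sum>i. (LINT x:(V -` A i \<inter> space M)|M. \<xi> x))"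
    proof (rule lebesgue_integral_countable_add)
      show "V -` A i \<inter> space M \<in> sets M" for i by measurable
      show "(V -` A i \<inter> space M) \<inter> (V -` A j \<inter> space M) = {}" if "i \<noteq> j" for i j
        using union.hyps(1) that unfolding disjoint_family_on_def by blast
      show "set_integrable M (\<Union>i. V -` A i \<inter> space M) \<xi>"
        unfolding set_integrable_def by (intro integrable_mult_indicator \<xi>) measurable
    qed
    also have "(\<Union>i. V -` A i \<inter> space M) = V -` (\<Union>i. A i) \<inter> space M" by auto
    finally show ?case
      by (simp add: eq union.IH)
  qed
qed

text \<open>
  Two applications of Fourier uniqueness. First, \<open>iexp (s * Z)\<close> minus its mean has vanishing transform
  with respect to \<open>V\<close>, so it is orthogonal to every indicator of \<open>V\<close>. Then the centred indicator of \<open>V \<in> B\<close> has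
  vanishing transform with respect to \<open>Z\<close>. Independence of two variables is expressed for a common
  type of values, hence the real function \<open>f\<close> of \<open>V\<close>.
\<close>

lemma (in prob_space) indep_var_of_characteristic_function:
  fixes Z :: "'a \<Rightarrow> real" and V :: "'a \<Rightarrow> 'h::{real_inner,second_countable_topology}"
  assumes Z [measurable]: "Z \<in> borel_measurable M" and V [measurable]: "V \<in> borel_measurable M"
    and f [measurable]: "f \<in> borel_measurable borel"
    and factor: "\<And>s h. (\<integral>x. iexp (s * Z x + h \<bullet> V x) \<partial>M)
        = (\<integral>x. iexp (s * Z x) \<partial>M) * (\<integral>x. iexp (h \<bullet> V x) \<partial>M)"
  shows "indep_var borel Z borel (\<lambda>x. f (V x) :: real)"
proof -
  have iZ: "integrable M (\<lambda>x. iexp (s * Z x))" for s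
    by (rule integrable_const_bound[of _ 1]) auto
  have iV: "integrable M (\<lambda>x. iexp (h \<bullet> V x))" for h
    by (rule integrable_const_bound[of _ 1]) auto
  have iZV: "integrable M (\<lambda>x. iexp (h \<bullet> V x) * iexp (s * Z x))" for h s
    by (rule integrable_const_bound[of _ 1]) (auto simp: norm_mult)
  have part: "(\<integral>x. indicator B (V x) * iexp (s * Z x) \<partial>M) = (\<integral>x. iexp (s * Z x) \<partial>M) * prob (V -` B \<inter> space M)"
    if [measurable]: "B \<in> sets borel" for B s
  proof -
    let ?c = "\<integral>x. iexp (s * Z x) \<partial>M"
    have "(\<integral>x. indicator B (V x) * (iexp (s * Z x) - ?c) \<partial>M) = 0"
    proof (rule fourier_uniqueness_hilbert[OF _ V _ that])
      show "integrable M (\<lambda>x. iexp (s * Z x) - ?c)"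
        by (intro Bochner_Integration.integrable_diff iZ) simp
      fix h
      have "(\<integral>x. iexp (h \<bullet> V x) * (iexp (s * Z x) - ?c) \<partial>M)
          = (\<integral>x. iexp (h \<bullet> V x) * iexp (s * Z x) - iexp (h \<bullet> V x) * ?c \<partial>M)"
        by (simp add: right_diff_distrib)
      also have "\<dots> = (\<integral>x. iexp (h \<bullet> V x) * iexp (s * Z x) \<partial>M) - (\<integral>x. iexp (h \<bullet> V x) \<partial>M) * ?c"
        using Bochner_Integration.integral_diff[OF iZV[of h s] integrable_mult_left[OF iV[of h], of ?c]]
        by simp
      also have "(\<integral>x. iexp (h \<bullet> V x) * iexp (s * Z x) \<partial>M) = (\<integral>x. iexp (s * Z x + h \<bullet> V x) \<partial>M)"
        by (intro Bochner_Integration.integral_cong refl) (simp add: exp_add[symmetric] distrib_left add.commute)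
      finally show "(\<integral>x. iexp (h \<bullet> V x) * (iexp (s * Z x) - ?c) \<partial>M) = 0"
        by (simp only: factor) simp
    qed
    moreover have "(\<integral>x. indicator B (V x) * (iexp (s * Z x) - ?c) \<partial>M)
        = (\<integral>x. indicator B (V x) * iexp (s * Z x) \<partial>M) - (\<integral>x. indicator B (V x) * ?c \<partial>M)"
      unfolding right_diff_distrib
      by (intro Bochner_Integration.integral_diff integrable_bounded_times iZ) (auto simp: indicator_def)
    moreover have "(\<integral>x. indicator B (V x) * ?c \<partial>M) = ?c * prob (V -` B \<inter> space M)"
    proof -
      have "(\<integral>x. indicator B (V x) * ?c \<partial>M) = (\<integral>x. complex_of_real (indicator (V -` B \<inter> space M) x) * ?c \<partial>M)"
        by (intro Bochner_Integration.integral_cong refl) (auto simp: indicator_def)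
      also have "\<dots> = complex_of_real (\<integral>x. indicator (V -` B \<inter> space M) x \<partial>M) * ?c"
        by (simp del: integral_indicator)
      finally show ?thesis by simp
    qed
    ultimately show ?thesis by simp
  qed
  have prod: "prob (Z -` A \<inter> space M \<inter> (V -` B \<inter> space M)) = prob (Z -` A \<inter> space M) * prob (V -` B \<inter> space M)"
    if A [measurable]: "A \<in> sets borel" and B [measurable]: "B \<in> sets borel" for A B
  proof -
    let ?p = "prob (V -` B \<inter> space M)"
    have "(\<integral>x. indicator A (Z x) * (indicator B (V x) - ?p) \<partial>M) = 0"
    proof (rule fourier_uniqueness_real_weight[OF _ Z _ A])
      show "integrable M (\<lambda>x. indicator B (V x) - ?p)"
        by (rule Bochner_Integration.integrable_diff, rule integrable_const_bound[of _ 1])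
           (auto simp: indicator_def)
      fix s
      have "(\<integral>x. iexp (s * Z x) * complex_of_real (indicator B (V x) - ?p) \<partial>M)
          = (\<integral>x. indicator B (V x) * iexp (s * Z x) - iexp (s * Z x) * ?p \<partial>M)"
        by (intro Bochner_Integration.integral_cong refl) (simp add: indicator_def right_diff_distrib)
      also have "\<dots> = (\<integral>x. indicator B (V x) * iexp (s * Z x) \<partial>M) - (\<integral>x. iexp (s * Z x) \<partial>M) * ?p"
        using Bochner_Integration.integral_diff[of M "\<lambda>x. indicator B (V x) * iexp (s * Z x)" "\<lambda>x. iexp (s * Z x) * ?p",
            OF integrable_bounded_times[OF iZ] integrable_mult_left[OF iZ]]
        by (simp add: indicator_def)
      finally show "(\<integral>x. iexp (s * Z x) * complex_of_real (indicator B (V x) - ?p) \<partial>M) = 0"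
        by (simp only: part[OF B]) simp
    qed
    also have "(\<integral>x. indicator A (Z x) * (indicator B (V x) - ?p) \<partial>M)
        = (\<integral>x. indicator (Z -` A \<inter> space M \<inter> (V -` B \<inter> space M)) x - indicator (Z -` A \<inter> space M) x * ?p \<partial>M)"
      by (intro Bochner_Integration.integral_cong refl) (auto simp: indicator_def)
    also have "\<dots> = prob (Z -` A \<inter> space M \<inter> (V -` B \<inter> space M)) - prob (Z -` A \<inter> space M) * ?p"
      by (subst Bochner_Integration.integral_diff)
         (auto intro!: integrable_real_indicator integrable_mult_left simp: less_top[symmetric])
    finally show ?thesis by simp
  qed
  let ?W = "\<lambda>x. f (V x)"
  have "distr M borel Z \<Otimes>\<^sub>M distr M borel ?W = distr M (borel \<Otimes>\<^sub>M borel) (\<lambda>x. (Z x, ?W x))"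
  proof (rule pair_measure_eqI)
    interpret Z: prob_space "distr M borel Z" by (rule prob_space_distr) (rule Z)
    interpret W: prob_space "distr M borel ?W" by (rule prob_space_distr) measurable
    show "sigma_finite_measure (distr M borel Z)" "sigma_finite_measure (distr M borel ?W)"
      by unfold_locales
    show "sets (distr M borel Z \<Otimes>\<^sub>M distr M borel ?W) = sets (distr M (borel \<Otimes>\<^sub>M borel) (\<lambda>x. (Z x, ?W x)))"
      by simp
    fix A B assume "A \<in> sets (distr M borel Z)" "B \<in> sets (distr M borel ?W)"
    then have [measurable]: "A \<in> sets borel" "B \<in> sets borel" by auto
    have fB: "f -` B \<in> sets borel"
      using measurable_sets[OF f \<open>B \<in> sets borel\<close>] by simp
    have "(\<lambda>x. (Z x, ?W x)) -` (A \<times> B) \<inter> space M = Z -` A \<inter> space M \<inter> (V -` (f -` B) \<inter> space M)"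
         "?W -` B \<inter> space M = V -` (f -` B) \<inter> space M"
      by auto
    then show "emeasure (distr M borel Z) A * emeasure (distr M borel ?W) B
        = emeasure (distr M (borel \<Otimes>\<^sub>M borel) (\<lambda>x. (Z x, ?W x))) (A \<times> B)"
      by (simp add: emeasure_distr emeasure_eq_measure prod[OF _ fB] ennreal_mult)
  qed
  then show ?thesis
    unfolding indep_var_distribution_eq by simp
qed

section \<open>Gaussian laws and limits of linear regressions\<close>

text \<open>
  This representation treats the degenerate law \<open>v = 0\<close> and the others alike.
\<close>

lemma normal_law_eq_distr:
  assumes "0 \<le> v"
  shows "normal_law m v = distr std_normal_distribution borel (\<lambda>x. m + sqrt v * x)"
proof -
  interpret N: real_distribution std_normal_distribution by (rule real_dist_normal_dist)
  show ?thesis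
  proof (cases "v = 0")
    case True
    then show ?thesis by (simp add: normal_law_def N.distr_const)
  next
    case False
    with assms have v: "0 < sqrt v" by simp
    have "distributed std_normal_distribution lborel (\<lambda>x. x) std_normal_density"
      unfolding distributed_def by (simp add: distr_id2)
    from N.normal_density_affine[OF this, of "sqrt v" m] v
    have "distributed std_normal_distribution lborel (\<lambda>x. m + sqrt v * x) (normal_density m (sqrt v))"
      by simp
    then have "distr std_normal_distribution lborel (\<lambda>x. m + sqrt v * x) = density lborel (normal_density m (sqrt v))"
      by (rule distributed_distr_eq_density)
    moreover have "distr std_normal_distribution lborel (\<lambda>x. m + sqrt v * x)
        = distr std_normal_distribution borel (\<lambda>x. m + sqrt v * x)"
      by (rule distr_cong) auto
    ultimately show ?thesis
      using False by (simp add: normal_law_def)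
  qed
qed

lemma real_distribution_normal_law:
  assumes "0 \<le> v"
  shows "real_distribution (normal_law m v)"
proof -
  interpret N: real_distribution std_normal_distribution by (rule real_dist_normal_dist)
  show ?thesis
    unfolding normal_law_eq_distr[OF assms] by (rule N.real_distribution_distr) simp
qed

lemma char_normal_law:
  assumes "0 \<le> v"
  shows "char (normal_law m v) t = iexp (t * m) * complex_of_real (exp (- (t\<^sup>2 * v) / 2))"
proof -
  have "char (normal_law m v) t = (\<integral>x. iexp (t * (m + sqrt v * x)) \<partial>std_normal_distribution)"
    unfolding char_def normal_law_eq_distr[OF assms] by (rule integral_distr) auto
  also have "\<dots> = (\<integral>x. iexp (t * m) * iexp ((t * sqrt v) * x) \<partial>std_normal_distribution)"
    by (intro Bochner_Integration.integral_cong refl)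
       (simp add: exp_add[symmetric] distrib_left mult.assoc)
  also have "\<dots> = iexp (t * m) * char std_normal_distribution (t * sqrt v)"
    unfolding char_def by simp
  also have "char std_normal_distribution (t * sqrt v) = complex_of_real (exp (- (t\<^sup>2 * v) / 2))"
    using assms by (simp add: char_std_normal_distribution power_mult_distrib)
  finally show ?thesis .
qed

lemma normal_law_moments:
  assumes v: "0 \<le> v"
  shows "integrable (normal_law m v) (\<lambda>x. (x - m)\<^sup>2)" "(\<integral>x. (x - m)\<^sup>2 \<partial>normal_law m v) = v"
    "integrable (normal_law m v) (\<lambda>x. x)" "(\<integral>x. x \<partial>normal_law m v) = m"
proof -
  interpret N: real_distribution std_normal_distribution by (rule real_dist_normal_dist)
  have i1: "integrable std_normal_distribution (\<lambda>x. x)" and m1: "(\<integral>x. x \<partial>std_normal_distribution) = 0"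
    using integrable_std_normal_distribution_moment[of 1] integral_std_normal_distribution_moment_odd[of 1]
    by simp_all
  have i2: "integrable std_normal_distribution (\<lambda>x. x\<^sup>2)" and m2: "(\<integral>x. x\<^sup>2 \<partial>std_normal_distribution) = 1"
    using std_normal_distribution_even_moments[of 1] by simp_all
  note eq = normal_law_eq_distr[OF v]
  show "integrable (normal_law m v) (\<lambda>x. (x - m)\<^sup>2)"
    unfolding eq using i2 v by (subst integrable_distr_eq) (auto simp: power_mult_distrib)
  show "(\<integral>x. (x - m)\<^sup>2 \<partial>normal_law m v) = v"
    unfolding eq using m2 v by (subst integral_distr) (auto simp: power_mult_distrib)
  have i: "integrable std_normal_distribution (\<lambda>x. sqrt v * x)"
    by (rule Bochner_Integration.integrable_mult_right[OF i1])
  show "integrable (normal_law m v) (\<lambda>x. x)"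
    unfolding eq
    by (subst integrable_distr_eq) (simp_all add: Bochner_Integration.integrable_add[OF N.integrable_const i])
  have "(\<integral>x. m + sqrt v * x \<partial>std_normal_distribution) = m"
    using Bochner_Integration.integral_add[OF N.integrable_const[of m] i] m1 N.prob_space by simp
  then show "(\<integral>x. x \<partial>normal_law m v) = m"
    unfolding eq by (subst integral_distr) simp_all
qed

text \<open>
  Pointwise \<open>2 * \<bar>f n\<bar> \<le> (1/2) ^ n + 2 ^ n * (f n)\<^sup>2\<close>, and the expectations of the last terms are summable.
\<close>

lemma AE_summable_of_fast_L2:
  fixes f :: "nat \<Rightarrow> 'a \<Rightarrow> real"
  assumes [measurable]: "\<And>n. f n \<in> borel_measurable M"
    and int: "\<And>n. integrable M (\<lambda>x. (f n x)\<^sup>2)" and le: "\<And>n. (\<integral>x. (f n x)\<^sup>2 \<partial>M) \<le> K / 8 ^ n"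
  shows "AE x in M. summable (\<lambda>n. \<bar>f n x\<bar>)"
proof -
  have "0 \<le> (\<integral>x. (f 0 x)\<^sup>2 \<partial>M)" by (rule Bochner_Integration.integral_nonneg) simp
  also have "\<dots> \<le> K" using le[of 0] by simp
  finally have K: "0 \<le> K" .
  have "(\<integral>\<^sup>+x. (\<Sum>n. ennreal (2 ^ n * (f n x)\<^sup>2)) \<partial>M) = (\<Sum>n. \<integral>\<^sup>+x. ennreal (2 ^ n * (f n x)\<^sup>2) \<partial>M)"
    by (rule nn_integral_suminf) measurable
  also have "\<dots> \<le> (\<Sum>n. ennreal (K * (1 / 4) ^ n))"
  proof (intro suminf_le allI)
    fix n
    have "(\<integral>\<^sup>+x. ennreal (2 ^ n * (f n x)\<^sup>2) \<partial>M) = ennreal (2 ^ n * (\<integral>x. (f n x)\<^sup>2 \<partial>M))"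
      using int by (subst nn_integral_eq_integral) auto
    also have "\<dots> \<le> ennreal (2 ^ n * (K / 8 ^ n))"
      by (intro ennreal_leI mult_left_mono le) simp
    also have "2 ^ n * (K / 8 ^ n) = K * (1 / 4) ^ n"
      using power_mult_distrib[of "2::real" 4 n] by (simp add: power_divide field_simps)
    finally show "(\<integral>\<^sup>+x. ennreal (2 ^ n * (f n x)\<^sup>2) \<partial>M) \<le> ennreal (K * (1 / 4) ^ n)" .
  qed auto
  also have "\<dots> = ennreal (\<Sum>n. K * (1 / 4) ^ n)"
    using K by (intro suminf_ennreal2) (auto intro!: summable_mult summable_geometric)
  finally have "(\<integral>\<^sup>+x. (\<Sum>n. ennreal (2 ^ n * (f n x)\<^sup>2)) \<partial>M) \<noteq> \<infinity>"
    by (auto simp: top_unique)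
  then have "AE x in M. (\<Sum>n. ennreal (2 ^ n * (f n x)\<^sup>2)) \<noteq> \<infinity>"
    by (intro nn_integral_PInf_AE) measurable
  then show ?thesis
  proof eventually_elim
    case (elim x)
    then have "summable (\<lambda>n. 2 ^ n * (f n x)\<^sup>2)"
      by (intro summable_suminf_not_top) auto
    then have "summable (\<lambda>n. (1 / 2) ^ n + 2 ^ n * (f n x)\<^sup>2)"
      by (intro summable_add summable_geometric) auto
    then show ?case
    proof (rule summable_comparison_test')
      fix n
      have "0 \<le> 2 ^ n * ((1 / 2) ^ n - \<bar>f n x\<bar>)\<^sup>2" by simp
      also have "\<dots> = (1 / 2) ^ n + 2 ^ n * (f n x)\<^sup>2 - 2 * \<bar>f n x\<bar>"
      proof -
        have ph: "2 ^ n * (1 / 2) ^ n = (1::real)"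
          by (simp add: power_divide)
        have "p * (c - y)\<^sup>2 = (p * c) * c + p * y\<^sup>2 - 2 * ((p * c) * y)" for p c y :: real
          by (simp add: power2_eq_square algebra_simps)
        from this[of "2 ^ n" "(1 / 2) ^ n" "\<bar>f n x\<bar>"] show ?thesis
          unfolding ph by simp
      qed
      finally show "norm \<bar>f n x\<bar> \<le> (1 / 2) ^ n + 2 ^ n * (f n x)\<^sup>2"
        by simp
    qed
  qed
qed

text \<open>
  The mixed term is controlled by \<open>2 * \<bar>f * g n\<bar> \<le> (1/2) ^ n * f\<^sup>2 + 2 ^ n * (g n)\<^sup>2\<close>.
\<close>

lemma integral_square_add_tendsto:
  fixes f R :: "'a \<Rightarrow> real" and g :: "nat \<Rightarrow> 'a \<Rightarrow> real"
  assumes f: "square_integrable M f" and g: "\<And>n. square_integrable M (g n)"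
    and le: "\<And>n. (\<integral>x. (g n x)\<^sup>2 \<partial>M) \<le> K / 8 ^ n"
  shows "(\<lambda>n. \<integral>x. (f x + g n x)\<^sup>2 \<partial>M) \<longlonglongrightarrow> (\<integral>x. (f x)\<^sup>2 \<partial>M)"
proof -
  have "0 \<le> (\<integral>x. (g 0 x)\<^sup>2 \<partial>M)" by (rule Bochner_Integration.integral_nonneg) simp
  also have "\<dots> \<le> K" using le[of 0] by simp
  finally have K: "0 \<le> K" .
  have i: "integrable M (\<lambda>x. (f x)\<^sup>2)" "integrable M (\<lambda>x. (g n x)\<^sup>2)" "integrable M (\<lambda>x. f x * g n x)" for n
    using square_integrable_power2[OF f] square_integrable_power2[OF g] square_integrable_mult_integrable[OF f g]
    by simp_all
  define I where "I = (\<integral>x. (f x)\<^sup>2 \<partial>M)"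
  have bound: "\<bar>(\<integral>x. (f x + g n x)\<^sup>2 \<partial>M) - I\<bar> \<le> (1 / 2) ^ n * I + K * (1 / 4) ^ n + K * (1 / 8) ^ n" for n
  proof -
    have eq: "(\<integral>x. (f x + g n x)\<^sup>2 \<partial>M) - I = (\<integral>x. 2 * (f x * g n x) \<partial>M) + (\<integral>x. (g n x)\<^sup>2 \<partial>M)"
    proof -
      have "(\<integral>x. (f x + g n x)\<^sup>2 \<partial>M) = (\<integral>x. ((f x)\<^sup>2 + 2 * (f x * g n x)) + (g n x)\<^sup>2 \<partial>M)"
        by (intro Bochner_Integration.integral_cong refl) (simp add: power2_sum)
      then show ?thesis
        using i by (simp add: I_def)
    qed
    have "\<bar>\<integral>x. 2 * (f x * g n x) \<partial>M\<bar> \<le> (\<integral>x. (1 / 2) ^ n * (f x)\<^sup>2 + 2 ^ n * (g n x)\<^sup>2 \<partial>M)"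
    proof (rule integral_abs_bound[THEN order_trans], rule integral_mono)
      show "integrable M (\<lambda>x. \<bar>2 * (f x * g n x)\<bar>)"
        using i(3)[of n] by (intro integrable_abs) simp
      show "integrable M (\<lambda>x. (1 / 2) ^ n * (f x)\<^sup>2 + 2 ^ n * (g n x)\<^sup>2)"
        using i by simp
      show "\<bar>2 * (f x * g n x)\<bar> \<le> (1 / 2) ^ n * (f x)\<^sup>2 + 2 ^ n * (g n x)\<^sup>2" for x
      proof -
        have "0 \<le> (1 / 2) ^ n * (\<bar>f x\<bar> - 2 ^ n * \<bar>g n x\<bar>)\<^sup>2" by simp
        also have "\<dots> = (1 / 2) ^ n * (f x)\<^sup>2 + 2 ^ n * (g n x)\<^sup>2 - 2 * (\<bar>f x\<bar> * \<bar>g n x\<bar>)"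
          by (simp add: power2_diff power_mult_distrib power2_eq_square power_divide field_simps)
        finally show ?thesis by (simp add: abs_mult)
      qed
    qed
    also have "\<dots> = (1 / 2) ^ n * I + 2 ^ n * (\<integral>x. (g n x)\<^sup>2 \<partial>M)"
      using i by (simp add: I_def)
    also have "\<dots> \<le> (1 / 2) ^ n * I + 2 ^ n * (K / 8 ^ n)"
      by (intro add_left_mono mult_left_mono le) simp
    also have "2 ^ n * (K / 8 ^ n) = K * (1 / 4) ^ n"
      using power_mult_distrib[of "2::real" 4 n] by (simp add: power_divide field_simps)
    finally have "\<bar>\<integral>x. 2 * (f x * g n x) \<partial>M\<bar> \<le> (1 / 2) ^ n * I + K * (1 / 4) ^ n" .
    moreover have "\<bar>\<integral>x. (g n x)\<^sup>2 \<partial>M\<bar> \<le> K * (1 / 8) ^ n"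
      using le[of n] by (simp add: power_divide)
    ultimately show ?thesis
      unfolding eq by linarith
  qed
  have "(\<lambda>n. (1 / 2) ^ n * I + K * (1 / 4) ^ n + K * (1 / 8) ^ n) \<longlonglongrightarrow> 0 * I + K * 0 + K * (0::real)"
    by (intro tendsto_intros LIMSEQ_power_zero) auto
  then have lim0: "(\<lambda>n. (1 / 2) ^ n * I + K * (1 / 4) ^ n + K * (1 / 8) ^ n) \<longlonglongrightarrow> 0"
    by (simp only: mult_zero_left mult_zero_right add_0_left)
  have "(\<lambda>n. (\<integral>x. (f x + g n x)\<^sup>2 \<partial>M) - I) \<longlonglongrightarrow> 0"
    by (rule Lim_null_comparison[OF _ lim0], unfold real_norm_def, intro always_eventually allI bound)
  then show ?thesis
    unfolding I_def by (rule LIM_zero_cancel)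
qed

text \<open>
  The pair \<open>(U, V)\<close> is Gaussian with the means \<open>\<alpha>, \<beta>\<close> and the covariances of \<open>(A, B)\<close>, in terms of linear
  functionals. The centred functionals \<open>S a h\<close> of \<open>(A, B)\<close> and \<open>T a h\<close> of \<open>(U, V)\<close> correspond to each other.
\<close>

locale gaussian_pair = P: prob_space P + Q: prob_space Q
  for P :: "'w measure" and Q :: "'v measure" +
  fixes A :: "'w \<Rightarrow> 'g::{real_inner,banach,second_countable_topology}"
    and B :: "'w \<Rightarrow> 'h::{real_inner,banach,second_countable_topology}"
    and U :: "'v \<Rightarrow> 'g" and V :: "'v \<Rightarrow> 'h"
    and \<alpha> :: 'g and \<beta> :: 'h
  assumes A: "square_integrable P A" and B: "square_integrable P B"
    and U [measurable]: "U \<in> borel_measurable Q" and V [measurable]: "V \<in> borel_measurable Q"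
    and \<alpha>: "\<alpha> = (\<integral>\<omega>. A \<omega> \<partial>P)" and \<beta>: "\<beta> = (\<integral>\<omega>. B \<omega> \<partial>P)"
    and joint_law: "\<And>a h. distr Q borel (\<lambda>\<omega>. a \<bullet> U \<omega> + h \<bullet> V \<omega>) =
        normal_law (a \<bullet> \<alpha> + h \<bullet> \<beta>) (\<integral>\<omega>. (a \<bullet> (A \<omega> - \<alpha>) + h \<bullet> (B \<omega> - \<beta>))\<^sup>2 \<partial>P)"
begin

definition S :: "'g \<Rightarrow> 'h \<Rightarrow> 'w \<Rightarrow> real" where "S a h \<omega> = a \<bullet> (A \<omega> - \<alpha>) + h \<bullet> (B \<omega> - \<beta>)"

definition T :: "'g \<Rightarrow> 'h \<Rightarrow> 'v \<Rightarrow> real" where "T a h \<omega> = a \<bullet> (U \<omega> - \<alpha>) + h \<bullet> (V \<omega> - \<beta>)"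

lemma T_measurable [measurable]: "T a h \<in> borel_measurable Q"
  unfolding T_def[abs_def] by measurable

lemma S_square_integrable: "square_integrable P (S a h)"
  unfolding S_def[abs_def]
  by (intro square_integrable_add square_integrable_inner square_integrable_diff A B P.square_integrable_const)

lemma T_eq: "T a h \<omega> = (a \<bullet> U \<omega> + h \<bullet> V \<omega>) - (a \<bullet> \<alpha> + h \<bullet> \<beta>)"
  by (simp add: T_def inner_diff_right)

lemma characteristic_function_T:
  "(\<integral>\<omega>. iexp (T a h \<omega>) \<partial>Q) = complex_of_real (exp (- (\<integral>\<omega>. (S a h \<omega>)\<^sup>2 \<partial>P) / 2))"
proof -
  let ?m = "a \<bullet> \<alpha> + h \<bullet> \<beta>" and ?W = "\<lambda>\<omega>. a \<bullet> U \<omega> + h \<bullet> V \<omega>"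
  have "(\<integral>\<omega>. iexp (T a h \<omega>) \<partial>Q) = (\<integral>\<omega>. iexp (- ?m) * iexp (?W \<omega>) \<partial>Q)"
    by (intro Bochner_Integration.integral_cong refl)
       (simp add: T_eq exp_add[symmetric] algebra_simps)
  also have "\<dots> = iexp (- ?m) * (\<integral>x. iexp (1 * x) \<partial>distr Q borel ?W)"
    by (subst integral_distr) auto
  also have "(\<integral>x. iexp (1 * x) \<partial>distr Q borel ?W) = char (distr Q borel ?W) 1"
    by (simp add: char_def)
  also have "\<dots> = iexp ?m * complex_of_real (exp (- (\<integral>\<omega>. (S a h \<omega>)\<^sup>2 \<partial>P) / 2))"
    unfolding joint_law by (subst char_normal_law) (auto simp: S_def)
  also have "iexp (- ?m) * \<dots> = complex_of_real (exp (- (\<integral>\<omega>. (S a h \<omega>)\<^sup>2 \<partial>P) / 2))"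
    by (simp add: mult.assoc[symmetric] exp_add[symmetric] distrib_left[symmetric])
  finally show ?thesis .
qed

lemma T_moments:
  shows "square_integrable Q (T a h)" "(\<integral>\<omega>. (T a h \<omega>)\<^sup>2 \<partial>Q) = (\<integral>\<omega>. (S a h \<omega>)\<^sup>2 \<partial>P)" "(\<integral>\<omega>. T a h \<omega> \<partial>Q) = 0"
proof -
  let ?m = "a \<bullet> \<alpha> + h \<bullet> \<beta>" and ?W = "\<lambda>\<omega>. a \<bullet> U \<omega> + h \<bullet> V \<omega>"
  have v: "0 \<le> (\<integral>\<omega>. (a \<bullet> (A \<omega> - \<alpha>) + h \<bullet> (B \<omega> - \<beta>))\<^sup>2 \<partial>P)" by simp
  note mom = normal_law_moments[OF v, of ?m, folded joint_law]
  have [measurable]: "?W \<in> borel_measurable Q" by measurable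
  show "square_integrable Q (T a h)"
    unfolding square_integrable_def using mom(1)
    by (subst (asm) integrable_distr_eq) (auto simp: T_eq[abs_def])
  show "(\<integral>\<omega>. (T a h \<omega>)\<^sup>2 \<partial>Q) = (\<integral>\<omega>. (S a h \<omega>)\<^sup>2 \<partial>P)"
    using mom(2) by (subst (asm) integral_distr) (auto simp: T_eq S_def)
  have i: "integrable Q ?W" using mom(3) by (subst (asm) integrable_distr_eq) auto
  have "(\<integral>\<omega>. ?W \<omega> \<partial>Q) = ?m" using mom(4) by (subst (asm) integral_distr) auto
  then show "(\<integral>\<omega>. T a h \<omega> \<partial>Q) = 0"
    unfolding T_eq using i by (subst Bochner_Integration.integral_diff) (auto simp: Q.prob_space)
qed

lemma U_second_moment:
  shows "square_integrable Q (\<lambda>\<omega>. a \<bullet> U \<omega>)" "(\<integral>\<omega>. (a \<bullet> U \<omega>)\<^sup>2 \<partial>Q) = (\<integral>\<omega>. (a \<bullet> A \<omega>)\<^sup>2 \<partial>P)"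
proof -
  have U_eq: "a \<bullet> U \<omega> = T a 0 \<omega> + a \<bullet> \<alpha>" and A_eq: "a \<bullet> A \<xi> = S a 0 \<xi> + a \<bullet> \<alpha>" for \<omega> \<xi>
    by (simp_all add: T_def S_def inner_diff_right)
  show "square_integrable Q (\<lambda>\<omega>. a \<bullet> U \<omega>)"
    unfolding U_eq by (intro square_integrable_add T_moments Q.square_integrable_const)
  have "integrable Q (\<lambda>\<omega>. (T a 0 \<omega>)\<^sup>2)" "integrable Q (T a 0)"
    using T_moments(1)[of a 0] by (auto simp: square_integrable_def intro: Q.square_integrable_integrable)
  then have 1: "(\<integral>\<omega>. (a \<bullet> U \<omega>)\<^sup>2 \<partial>Q) = (\<integral>\<omega>. (S a 0 \<omega>)\<^sup>2 \<partial>P) + (a \<bullet> \<alpha>)\<^sup>2"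
    unfolding U_eq power2_sum by (simp add: T_moments Q.prob_space)
  have i: "integrable P (\<lambda>\<omega>. (S a 0 \<omega>)\<^sup>2)" "integrable P (S a 0)"
    using S_square_integrable[of a 0] by (auto simp: square_integrable_def intro: P.square_integrable_integrable)
  have "(\<integral>\<omega>. S a 0 \<omega> \<partial>P) = 0"
    using P.square_integrable_integrable[OF A]
    by (simp add: S_def[abs_def] inner_diff_right P.prob_space \<alpha>[symmetric])
  with i have "(\<integral>\<omega>. (a \<bullet> A \<omega>)\<^sup>2 \<partial>P) = (\<integral>\<omega>. (S a 0 \<omega>)\<^sup>2 \<partial>P) + (a \<bullet> \<alpha>)\<^sup>2"
    unfolding A_eq power2_sum by (simp add: P.prob_space)
  with 1 show "(\<integral>\<omega>. (a \<bullet> U \<omega>)\<^sup>2 \<partial>Q) = (\<integral>\<omega>. (a \<bullet> A \<omega>)\<^sup>2 \<partial>P)" by simp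
qed

text \<open>
  By Parseval, the second moment of the norm is the sum of the second moments of the coordinates, and the
  latter agree for \<open>U\<close> and \<open>A\<close>.
\<close>

lemma U_square_integrable: "square_integrable Q U"
proof -
  obtain e :: "nat \<Rightarrow> 'g" where "\<And>v n. norm (\<Sum>i<n. (v \<bullet> e i) *\<^sub>R e i) \<le> norm v"
    and e: "\<And>v. (\<lambda>i. (v \<bullet> e i)\<^sup>2) sums (norm v)\<^sup>2"
    by (rule obtain_parseval_frame) blast
  have Am [measurable]: "A \<in> borel_measurable P" using A by measurable
  have pars: "ennreal ((norm v)\<^sup>2) = (\<Sum>i. ennreal ((e i \<bullet> v)\<^sup>2))" for v :: 'g
    using e[of v] by (subst suminf_ennreal2) (auto simp: sums_iff inner_commute)
  have term_eq: "(\<integral>\<^sup>+\<omega>. ennreal ((e i \<bullet> U \<omega>)\<^sup>2) \<partial>Q) = (\<integral>\<^sup>+\<omega>. ennreal ((e i \<bullet> A \<omega>)\<^sup>2) \<partial>P)" for i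
  proof -
    have "(\<integral>\<^sup>+\<omega>. ennreal ((e i \<bullet> U \<omega>)\<^sup>2) \<partial>Q) = ennreal (\<integral>\<omega>. (e i \<bullet> U \<omega>)\<^sup>2 \<partial>Q)"
      using U_second_moment(1)[of "e i"] by (intro nn_integral_eq_integral) (auto simp: square_integrable_def)
    also have "\<dots> = (\<integral>\<^sup>+\<omega>. ennreal ((e i \<bullet> A \<omega>)\<^sup>2) \<partial>P)"
      unfolding U_second_moment(2)
      using square_integrable_power2[OF square_integrable_inner[OF A, of "e i"]]
      by (intro nn_integral_eq_integral[symmetric]) auto
    finally show ?thesis .
  qed
  have "(\<integral>\<^sup>+\<omega>. ennreal ((norm (U \<omega>))\<^sup>2) \<partial>Q) = (\<integral>\<^sup>+\<omega>. ennreal ((norm (A \<omega>))\<^sup>2) \<partial>P)"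
    unfolding pars by (simp add: nn_integral_suminf term_eq)
  also have "\<dots> < \<infinity>"
    using integrableD(2)[of P "\<lambda>\<omega>. (norm (A \<omega>))\<^sup>2"] A by (simp add: square_integrable_def less_top)
  finally show ?thesis
    unfolding square_integrable_def by (auto intro!: integrableI_nonneg)
qed

text \<open>
  If \<open>R\<close> is orthogonal to the centred functionals of \<open>B\<close> and the limit of \<open>S a (- h n)\<close>, then the counterpart
  \<open>Z\<close> of \<open>R\<close> on the Gaussian side is the residual of \<open>a \<bullet> (U - \<alpha>)\<close> after subtraction of a function of \<open>V\<close>.
  The characteristic function of \<open>(Z, V)\<close> is the limit of Gaussian ones, with variances equal to the
  second moments of \<open>s * S a (- h n) + S 0 k\<close>; by orthogonality, these converge to the sum of the second
  moments of \<open>s * R\<close> and \<open>S 0 k\<close>. So it factorises, and independence follows.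
\<close>

lemma linear_regression_limit:
  fixes a :: 'g and h :: "nat \<Rightarrow> 'h" and R :: "'w \<Rightarrow> real"
  defines "r \<equiv> (\<lambda>v. lim (\<lambda>n. h n \<bullet> (v - \<beta>)))"
  assumes R: "square_integrable P R"
    and orth: "\<And>k. (\<integral>\<omega>. R \<omega> * (k \<bullet> (B \<omega> - \<beta>)) \<partial>P) = 0"
    and approx: "\<And>n. (\<integral>\<omega>. (S a (- h n) \<omega> - R \<omega>)\<^sup>2 \<partial>P) \<le> 1 / 8 ^ n"
  shows "r \<in> borel_measurable borel"
    and "AE \<omega> in P. (\<lambda>n. S a (- h n) \<omega>) \<longlonglongrightarrow> R \<omega>"
    and "f \<in> borel_measurable borel \<Longrightarrow>
      Q.indep_var borel (\<lambda>\<omega>. a \<bullet> (U \<omega> - \<alpha>) - r (V \<omega>)) borel (\<lambda>\<omega>. f (V \<omega>) :: real)"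
    and "distr Q borel (\<lambda>\<omega>. a \<bullet> (U \<omega> - \<alpha>) - r (V \<omega>)) = normal_law 0 (\<integral>\<omega>. (R \<omega>)\<^sup>2 \<partial>P)"
proof -
  have hm [measurable]: "(\<lambda>v. h n \<bullet> (v - \<beta>)) \<in> borel_measurable borel" for n
    by measurable
  show rm [measurable]: "r \<in> borel_measurable borel"
    unfolding r_def by (rule borel_measurable_lim_metric) (rule hm)
  define g where "g n \<omega> = S a (- h n) \<omega> - R \<omega>" for n \<omega>
  have g: "square_integrable P (g n)" for n
    unfolding g_def[abs_def] by (intro square_integrable_diff S_square_integrable R)
  have g_le: "(\<integral>\<omega>. (g n \<omega>)\<^sup>2 \<partial>P) \<le> 1 / 8 ^ n" for n
    unfolding g_def by (rule approx)
  have "AE \<omega> in P. summable (\<lambda>n. \<bar>g n \<omega>\<bar>)"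
    using g g_le by (intro AE_summable_of_fast_L2) (auto simp: square_integrable_def)
  then show "AE \<omega> in P. (\<lambda>n. S a (- h n) \<omega>) \<longlonglongrightarrow> R \<omega>"
  proof eventually_elim
    case (elim \<omega>)
    then have "(\<lambda>n. g n \<omega>) \<longlonglongrightarrow> 0"
      by (rule tendsto_rabs_zero_cancel[OF summable_LIMSEQ_zero])
    then show ?case unfolding g_def by (rule LIM_zero_cancel)
  qed
  (* The increments of h n \<bullet> (V - \<beta>) have the second moments of the increments of
     S a (- h n), because the parts that involve U and A cancel. *)
  define d where "d n = T 0 (h (Suc n) - h n)" for n
  have d_le: "(\<integral>\<omega>. (d n \<omega>)\<^sup>2 \<partial>Q) \<le> 4 / 8 ^ n" for n
  proof -
    have eq: "S 0 (h (Suc n) - h n) \<omega> = g n \<omega> - g (Suc n) \<omega>" for \<omega>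
      by (simp add: g_def S_def inner_diff_left)
    have gi: "integrable P (\<lambda>\<omega>. (g n \<omega>)\<^sup>2)" for n
      using g by (rule square_integrable_power2)
    have "(\<integral>\<omega>. (d n \<omega>)\<^sup>2 \<partial>Q) = (\<integral>\<omega>. (g n \<omega> - g (Suc n) \<omega>)\<^sup>2 \<partial>P)"
      unfolding d_def T_moments(2) eq ..
    also have "\<dots> \<le> (\<integral>\<omega>. 2 * (g n \<omega>)\<^sup>2 + 2 * (g (Suc n) \<omega>)\<^sup>2 \<partial>P)"
    proof (rule integral_mono)
      show "integrable P (\<lambda>\<omega>. (g n \<omega> - g (Suc n) \<omega>)\<^sup>2)"
        by (rule square_integrable_power2[OF square_integrable_diff[OF g g]])
      show "integrable P (\<lambda>\<omega>. 2 * (g n \<omega>)\<^sup>2 + 2 * (g (Suc n) \<omega>)\<^sup>2)"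
        using gi by simp
      show "(g n \<omega> - g (Suc n) \<omega>)\<^sup>2 \<le> 2 * (g n \<omega>)\<^sup>2 + 2 * (g (Suc n) \<omega>)\<^sup>2" for \<omega>
        using zero_le_power2[of "g n \<omega> + g (Suc n) \<omega>"] by (simp add: power2_sum power2_diff)
    qed
    also have "\<dots> = 2 * (\<integral>\<omega>. (g n \<omega>)\<^sup>2 \<partial>P) + 2 * (\<integral>\<omega>. (g (Suc n) \<omega>)\<^sup>2 \<partial>P)"
      using gi by simp
    also have "\<dots> \<le> 2 * (1 / 8 ^ n) + 2 * (1 / 8 ^ Suc n)"
      by (intro add_mono mult_left_mono g_le) auto
    also have "\<dots> \<le> 4 / 8 ^ n"
      by (simp add: field_simps)
    finally show ?thesis .
  qed
  have "AE \<omega> in Q. summable (\<lambda>n. \<bar>d n \<omega>\<bar>)"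
    using T_moments(1) d_le by (intro AE_summable_of_fast_L2) (auto simp: square_integrable_def d_def)
  then have lim: "AE \<omega> in Q. (\<lambda>n. h n \<bullet> (V \<omega> - \<beta>)) \<longlonglongrightarrow> r (V \<omega>)"
  proof eventually_elim
    case (elim \<omega>)
    let ?s = "\<lambda>n. h n \<bullet> (V \<omega> - \<beta>)"
    have "summable (\<lambda>n. d n \<omega>)"
      using elim by (rule summable_rabs_cancel)
    then have "convergent (\<lambda>n. \<Sum>i<n. d i \<omega>)"
      by (simp add: summable_iff_convergent)
    moreover have "(\<Sum>i<n. d i \<omega>) = ?s n - ?s 0" for n
      using sum_lessThan_telescope[of ?s n] by (simp add: d_def T_def inner_diff_left)
    ultimately have "convergent (\<lambda>n. ?s n - ?s 0)" by simp
    then have "convergent ?s"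
      by (simp add: convergent_diff_const_right_iff)
    then show ?case
      unfolding r_def by (simp add: convergent_LIMSEQ_iff)
  qed
  define Z where "Z \<omega> = a \<bullet> (U \<omega> - \<alpha>) - r (V \<omega>)" for \<omega>
  have Zm [measurable]: "Z \<in> borel_measurable Q"
    unfolding Z_def[abs_def] by measurable
  have Z_lim: "AE \<omega> in Q. (\<lambda>n. T a (- h n) \<omega>) \<longlonglongrightarrow> Z \<omega>"
    using lim
  proof eventually_elim
    case (elim \<omega>)
    then have "(\<lambda>n. a \<bullet> (U \<omega> - \<alpha>) - h n \<bullet> (V \<omega> - \<beta>)) \<longlonglongrightarrow> a \<bullet> (U \<omega> - \<alpha>) - r (V \<omega>)"
      by (intro tendsto_intros)
    then show ?case by (simp add: T_def Z_def)
  qed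
  define v where "v = (\<integral>\<omega>. (R \<omega>)\<^sup>2 \<partial>P)"
  define w where "w k = (\<integral>\<omega>. (S 0 k \<omega>)\<^sup>2 \<partial>P)" for k
  have \<Phi>: "(\<integral>\<omega>. iexp (s * Z \<omega> + k \<bullet> V \<omega>) \<partial>Q)
      = iexp (k \<bullet> \<beta>) * complex_of_real (exp (- (s\<^sup>2 * v + w k) / 2))" for s k
  proof -
    have comb: "T (s *\<^sub>R a) (k - s *\<^sub>R h n) \<omega> = s * T a (- h n) \<omega> + k \<bullet> V \<omega> - k \<bullet> \<beta>" for n \<omega>
      by (simp add: T_def inner_diff_left inner_diff_right algebra_simps)
    have combS: "S (s *\<^sub>R a) (k - s *\<^sub>R h n) \<omega> = (s * R \<omega> + S 0 k \<omega>) + s * g n \<omega>" for n \<omega>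
      by (simp add: S_def g_def inner_diff_left algebra_simps)
    have "(\<lambda>n. \<integral>\<omega>. iexp (s * T a (- h n) \<omega> + k \<bullet> V \<omega>) \<partial>Q) \<longlonglongrightarrow> (\<integral>\<omega>. iexp (s * Z \<omega> + k \<bullet> V \<omega>) \<partial>Q)"
    proof (rule integral_dominated_convergence[where w="\<lambda>_. 1"])
      show "AE \<omega> in Q. (\<lambda>n. iexp (s * T a (- h n) \<omega> + k \<bullet> V \<omega>)) \<longlonglongrightarrow> iexp (s * Z \<omega> + k \<bullet> V \<omega>)"
        using Z_lim
      proof eventually_elim
        case (elim \<omega>)
        then show ?case by (intro tendsto_intros)
      qed
    qed auto
    moreover have "(\<integral>\<omega>. iexp (s * T a (- h n) \<omega> + k \<bullet> V \<omega>) \<partial>Q)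
        = iexp (k \<bullet> \<beta>) * complex_of_real (exp (- (\<integral>\<omega>. ((s * R \<omega> + S 0 k \<omega>) + s * g n \<omega>)\<^sup>2 \<partial>P) / 2))" for n
    proof -
      have "(\<integral>\<omega>. iexp (s * T a (- h n) \<omega> + k \<bullet> V \<omega>) \<partial>Q)
          = (\<integral>\<omega>. iexp (k \<bullet> \<beta>) * iexp (T (s *\<^sub>R a) (k - s *\<^sub>R h n) \<omega>) \<partial>Q)"
        by (intro Bochner_Integration.integral_cong refl)
           (simp add: comb exp_add[symmetric] distrib_left right_diff_distrib)
      also have "\<dots> = iexp (k \<bullet> \<beta>) * (\<integral>\<omega>. iexp (T (s *\<^sub>R a) (k - s *\<^sub>R h n) \<omega>) \<partial>Q)"
        by simp
      finally show ?thesis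
        unfolding characteristic_function_T combS .
    qed
    ultimately have lim1: "(\<lambda>n. iexp (k \<bullet> \<beta>) * complex_of_real (exp (- (\<integral>\<omega>. ((s * R \<omega> + S 0 k \<omega>) + s * g n \<omega>)\<^sup>2 \<partial>P) / 2)))
        \<longlonglongrightarrow> (\<integral>\<omega>. iexp (s * Z \<omega> + k \<bullet> V \<omega>) \<partial>Q)"
      by simp
    have sR: "square_integrable P (\<lambda>\<omega>. s * R \<omega> + S 0 k \<omega>)"
      by (intro square_integrable_add square_integrable_mult R S_square_integrable)
    have "(\<lambda>n. \<integral>\<omega>. ((s * R \<omega> + S 0 k \<omega>) + s * g n \<omega>)\<^sup>2 \<partial>P) \<longlonglongrightarrow> (\<integral>\<omega>. (s * R \<omega> + S 0 k \<omega>)\<^sup>2 \<partial>P)"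
    proof (rule integral_square_add_tendsto[OF sR, where K="s\<^sup>2"])
      show "square_integrable P (\<lambda>\<omega>. s * g n \<omega>)" for n
        by (rule square_integrable_mult[OF g])
      show "(\<integral>\<omega>. (s * g n \<omega>)\<^sup>2 \<partial>P) \<le> s\<^sup>2 / 8 ^ n" for n
        using mult_left_mono[OF g_le[of n], of "s\<^sup>2"] by (simp add: power_mult_distrib)
    qed
    also have "(\<integral>\<omega>. (s * R \<omega> + S 0 k \<omega>)\<^sup>2 \<partial>P) = s\<^sup>2 * v + w k"
    proof -
      have i: "integrable P (\<lambda>\<omega>. (R \<omega>)\<^sup>2)" "integrable P (\<lambda>\<omega>. (S 0 k \<omega>)\<^sup>2)" "integrable P (\<lambda>\<omega>. R \<omega> * S 0 k \<omega>)"
        using square_integrable_power2[OF R] square_integrable_power2[OF S_square_integrable]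
          square_integrable_mult_integrable[OF R S_square_integrable] by simp_all
      have "(\<integral>\<omega>. (s * R \<omega> + S 0 k \<omega>)\<^sup>2 \<partial>P)
          = (\<integral>\<omega>. (s\<^sup>2 * (R \<omega>)\<^sup>2 + (2 * s) * (R \<omega> * S 0 k \<omega>)) + (S 0 k \<omega>)\<^sup>2 \<partial>P)"
        by (intro Bochner_Integration.integral_cong refl) (simp add: power2_sum power_mult_distrib)
      also have "\<dots> = s\<^sup>2 * v + (2 * s) * (\<integral>\<omega>. R \<omega> * S 0 k \<omega> \<partial>P) + w k"
        using i by (simp add: v_def w_def)
      also have "(\<integral>\<omega>. R \<omega> * S 0 k \<omega> \<partial>P) = 0"
        using orth[of k] by (simp add: S_def)
      finally show ?thesis by simp
    qed
    finally have "(\<lambda>n. iexp (k \<bullet> \<beta>) * complex_of_real (exp (- (\<integral>\<omega>. ((s * R \<omega> + S 0 k \<omega>) + s * g n \<omega>)\<^sup>2 \<partial>P) / 2)))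
        \<longlonglongrightarrow> iexp (k \<bullet> \<beta>) * complex_of_real (exp (- (s\<^sup>2 * v + w k) / 2))"
      by (intro tendsto_intros) auto
    with lim1 show ?thesis
      by (rule LIMSEQ_unique)
  qed
  have w0: "w 0 = 0" by (simp add: w_def S_def)
  have charZ: "(\<integral>\<omega>. iexp (s * Z \<omega>) \<partial>Q) = complex_of_real (exp (- (s\<^sup>2 * v) / 2))" for s
    using \<Phi>[of s 0] by (simp add: w0)
  have charV: "(\<integral>\<omega>. iexp (k \<bullet> V \<omega>) \<partial>Q) = iexp (k \<bullet> \<beta>) * complex_of_real (exp (- w k / 2))" for k
    using \<Phi>[of 0 k] by simp
  have v0: "0 \<le> v" by (simp add: v_def)
  show "Q.indep_var borel (\<lambda>\<omega>. a \<bullet> (U \<omega> - \<alpha>) - r (V \<omega>)) borel (\<lambda>\<omega>. f (V \<omega>) :: real)"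
    if "f \<in> borel_measurable borel"
    unfolding Z_def[symmetric]
  proof (rule Q.indep_var_of_characteristic_function[OF Zm V that])
    fix s k
    show "(\<integral>\<omega>. iexp (s * Z \<omega> + k \<bullet> V \<omega>) \<partial>Q) = (\<integral>\<omega>. iexp (s * Z \<omega>) \<partial>Q) * (\<integral>\<omega>. iexp (k \<bullet> V \<omega>) \<partial>Q)"
      unfolding \<Phi> charZ charV
      by (simp add: exp_add[symmetric] of_real_mult[symmetric] add_divide_distrib diff_divide_distrib
          del: of_real_mult)
  qed
  have "distr Q borel Z = normal_law 0 v"
  proof (rule Levy_uniqueness)
    show "real_distribution (distr Q borel Z)"
      by (rule Q.real_distribution_distr) (rule Zm)
    show "real_distribution (normal_law 0 v)"
      by (rule real_distribution_normal_law[OF v0])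
    show "char (distr Q borel Z) = char (normal_law 0 v)"
    proof
      fix t
      have "char (distr Q borel Z) t = (\<integral>\<omega>. iexp (t * Z \<omega>) \<partial>Q)"
        unfolding char_def by (subst integral_distr) auto
      then show "char (distr Q borel Z) t = char (normal_law 0 v) t"
        unfolding charZ by (simp add: char_normal_law[OF v0])
    qed
  qed
  then show "distr Q borel (\<lambda>\<omega>. a \<bullet> (U \<omega> - \<alpha>) - r (V \<omega>)) = normal_law 0 (\<integral>\<omega>. (R \<omega>)\<^sup>2 \<partial>P)"
    by (simp add: Z_def[abs_def] v_def)
qed

end

section \<open>Conditioning the Gaussian pair\<close>

lemma (in prob_space) integral_centered_square_le:
  fixes f :: "'a \<Rightarrow> real"
  assumes "square_integrable M f"
  shows "(\<integral>x. (f x - (\<integral>x. f x \<partial>M))\<^sup>2 \<partial>M) \<le> (\<integral>x. (f x)\<^sup>2 \<partial>M)"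
  using variance_eq[OF square_integrable_integrable[OF assms] square_integrable_power2[OF assms]] by simp

lemma frame_vector_eqI:
  fixes v w :: "'a::real_inner"
  assumes e: "\<And>v. (\<lambda>n. \<Sum>i<n. (v \<bullet> e i) *\<^sub>R e i) \<longlonglongrightarrow> v" and eq: "\<And>i. e i \<bullet> v = e i \<bullet> w"
  shows "v = w"
proof -
  have "(\<lambda>n. \<Sum>i<n. (v \<bullet> e i) *\<^sub>R e i) = (\<lambda>n. \<Sum>i<n. (w \<bullet> e i) *\<^sub>R e i)"
    using eq by (simp add: inner_commute)
  then show ?thesis
    using LIMSEQ_unique[OF e[of v]] e[of w] by simp
qed

text \<open>
  Polarisation: taking \<open>i = j\<close> gives the diagonal entries, the other pairs give the remaining ones.
\<close>

lemma symmetric_blinfun_eqI: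
  fixes C D :: "'a::real_inner \<Rightarrow>\<^sub>L 'a"
  assumes e: "\<And>v. (\<lambda>n. \<Sum>i<n. (v \<bullet> e i) *\<^sub>R e i) \<longlonglongrightarrow> v"
    and C: "\<And>a b. blinfun_apply C a \<bullet> b = blinfun_apply C b \<bullet> a"
    and D: "\<And>a b. blinfun_apply D a \<bullet> b = blinfun_apply D b \<bullet> a"
    and eq: "\<And>i j. blinfun_apply C (e i + e j) \<bullet> (e i + e j) = blinfun_apply D (e i + e j) \<bullet> (e i + e j)"
  shows "C = D"
proof -
  define q where "q a b = blinfun_apply C a \<bullet> b - blinfun_apply D a \<bullet> b" for a b
  have q_add: "q (a + b) c = q a c + q b c" "q c (a + b) = q c a + q c b" for a b c
    by (simp_all add: q_def blinfun.add_right inner_add_left inner_add_right)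
  have q_sym: "q a b = q b a" for a b
    by (simp add: q_def C[of a b] D[of a b])
  have q_eq: "q (e i + e j) (e i + e j) = 0" for i j
    by (simp add: q_def eq)
  have diag: "q (e i) (e i) = 0" for i
    using q_eq[of i i] by (simp add: q_add)
  have off: "q (e i) (e j) = 0" for i j
    using q_eq[of i j] q_sym[of "e i" "e j"] by (simp add: q_add diag)
  have entries: "blinfun_apply C (e j) \<bullet> e i = blinfun_apply D (e j) \<bullet> e i" for i j
    using off[of j i] by (simp add: q_def)
  have Ce: "blinfun_apply C (e j) = blinfun_apply D (e j)" for j
    by (rule frame_vector_eqI[OF e], subst (1 2) inner_commute, rule entries)
  show ?thesis
  proof (rule blinfun_eqI)
    fix v
    have "(\<lambda>n. blinfun_apply C (\<Sum>i<n. (v \<bullet> e i) *\<^sub>R e i)) \<longlonglongrightarrow> blinfun_apply C v"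
      by (intro blinfun.tendsto tendsto_const e)
    moreover have "(\<lambda>n. blinfun_apply C (\<Sum>i<n. (v \<bullet> e i) *\<^sub>R e i)) \<longlonglongrightarrow> blinfun_apply D v"
      using blinfun.tendsto[OF tendsto_const[of D] e[of v]]
      by (simp add: blinfun.sum_right blinfun.scaleR_right Ce)
    ultimately show "blinfun_apply C v = blinfun_apply D v"
      by (rule LIMSEQ_unique)
  qed
qed

text \<open>
  Here \<open>\<kappa>\<close> is the conditional law of \<open>Y\<close> given \<open>X\<close>, and \<open>\<gamma>\<close> that of \<open>U\<close> given \<open>V\<close>. Every functional of the
  conditional mean is assumed to be approximable in \<open>L\<^sup>2\<close> by affine functions of \<open>\<phi>\<close>, with a constant term that
  does not depend on the precision.
\<close>

locale gaussian_regression =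
  CF: conditional_feature P MX MY X Y \<kappa> \<psi> +
  CG: conditional_feature Q borel borel V U \<gamma> "\<lambda>u. u" +
  G: gaussian_pair P Q "\<lambda>\<omega>. \<psi> (Y \<omega>)" "\<lambda>\<omega>. \<phi> (X \<omega>)" U V \<alpha> \<beta>
  for P :: "'w measure" and MX :: "'x measure" and MY :: "'y measure"
    and X :: "'w \<Rightarrow> 'x" and Y :: "'w \<Rightarrow> 'y" and \<kappa> :: "'x \<Rightarrow> 'y measure"
    and \<psi> :: "'y \<Rightarrow> 'g::{real_inner,banach,second_countable_topology}"
    and \<phi> :: "'x \<Rightarrow> 'h::{real_inner,banach,second_countable_topology}"
    and Q :: "'v measure" and U :: "'v \<Rightarrow> 'g" and V :: "'v \<Rightarrow> 'h" and \<gamma> :: "'h \<Rightarrow> 'g measure"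
    and \<alpha> :: 'g and \<beta> :: 'h +
  assumes \<phi> [measurable]: "\<phi> \<in> borel_measurable MX"
    and approximable: "\<exists>c. \<forall>\<epsilon>>0. \<exists>h.
      (\<integral>\<^sup>+x. ennreal ((a \<bullet> CF.m x - c - h \<bullet> \<phi> x)\<^sup>2) \<partial>CF.law) < ennreal \<epsilon>"
begin

(* The identity map as a measurability rule would send the measurability prover into a loop. *)
declare CG.\<psi> [measurable del]

lemma square_integrable_\<phi>: "square_integrable CF.law \<phi>"
  using G.B by (simp add: CF.square_integrable_compose_X)

lemma mean_cond_mean: "(\<integral>\<omega>. a \<bullet> CF.m (X \<omega>) \<partial>P) = a \<bullet> \<alpha>"
proof -
  have "(\<integral>\<omega>. a \<bullet> CF.m (X \<omega>) \<partial>P) = (\<integral>\<omega>. a \<bullet> \<psi> (Y \<omega>) \<partial>P)"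
    using CF.cond_mean_projection[of "\<lambda>_. 1" a] CF.law.square_integrable_const[of "1::real"] by simp
  also have "\<dots> = a \<bullet> \<alpha>"
    using CF.square_integrable_integrable[OF G.A] by (simp add: G.\<alpha>)
  finally show ?thesis .
qed

text \<open>
  The difference \<open>S a (- h n) - residual a\<close> is the centred version of the approximation error, and
  centring does not increase second moments.
\<close>

lemma residual_approximation:
  obtains h where "\<And>n. (\<integral>\<omega>. (G.S a (- h n) \<omega> - CF.residual a \<omega>)\<^sup>2 \<partial>P) \<le> 1 / 8 ^ n"
proof -
  obtain c where c: "\<forall>\<epsilon>>0. \<exists>h.
      (\<integral>\<^sup>+x. ennreal ((a \<bullet> CF.m x - c - h \<bullet> \<phi> x)\<^sup>2) \<partial>CF.law) < ennreal \<epsilon>"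
    using approximable[of a] by blast
  have "\<forall>n::nat. \<exists>h. (\<integral>\<^sup>+x. ennreal ((a \<bullet> CF.m x - c - h \<bullet> \<phi> x)\<^sup>2) \<partial>CF.law) < ennreal (1 / 8 ^ n)"
    by (intro allI c[rule_format]) simp
  then obtain h where h: "\<And>n::nat. (\<integral>\<^sup>+x. ennreal ((a \<bullet> CF.m x - c - h n \<bullet> \<phi> x)\<^sup>2) \<partial>CF.law) < ennreal (1 / 8 ^ n)"
    unfolding choice_iff by blast
  show thesis
  proof (rule that)
    fix n
    define d where "d x = a \<bullet> CF.m x - c - h n \<bullet> \<phi> x" for x
    have dm [measurable]: "d \<in> borel_measurable MX"
      unfolding d_def[abs_def] by measurable
    have d: "square_integrable CF.law d"
      unfolding d_def[abs_def]
      by (intro square_integrable_diff square_integrable_inner CF.square_integrable_cond_mean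
          square_integrable_\<phi> CF.law.square_integrable_const)
    have dX: "square_integrable P (\<lambda>\<omega>. d (X \<omega>))"
      using d by (simp add: CF.square_integrable_compose_X)
    have "ennreal (\<integral>x. (d x)\<^sup>2 \<partial>CF.law) = (\<integral>\<^sup>+x. ennreal ((d x)\<^sup>2) \<partial>CF.law)"
      by (rule nn_integral_eq_integral[symmetric]) (auto intro: square_integrable_power2[OF d])
    also have "\<dots> < ennreal (1 / 8 ^ n)"
      unfolding d_def by (rule h)
    finally have d_le: "(\<integral>x. (d x)\<^sup>2 \<partial>CF.law) \<le> 1 / 8 ^ n"
      by (subst (asm) ennreal_less_iff) auto
    have mean: "(\<integral>\<omega>. d (X \<omega>) \<partial>P) = a \<bullet> \<alpha> - c - h n \<bullet> \<beta>"
    proof -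
      have mX: "square_integrable P (\<lambda>\<omega>. CF.m (X \<omega>))"
        by (simp add: CF.square_integrable_compose_X CF.square_integrable_cond_mean)
      have "integrable P (\<lambda>\<omega>. a \<bullet> CF.m (X \<omega>))" "integrable P (\<lambda>\<omega>. \<phi> (X \<omega>))"
        using CF.square_integrable_integrable[OF square_integrable_inner[OF mX, of a]]
          CF.square_integrable_integrable[OF G.B] by simp_all
      then show ?thesis
        by (simp add: d_def mean_cond_mean CF.prob_space G.\<beta>)
    qed
    have "G.S a (- h n) \<omega> - CF.residual a \<omega> = d (X \<omega>) - (\<integral>\<omega>. d (X \<omega>) \<partial>P)" for \<omega>
      unfolding mean by (simp add: G.S_def d_def inner_diff_right)
    then have "(\<integral>\<omega>. (G.S a (- h n) \<omega> - CF.residual a \<omega>)\<^sup>2 \<partial>P)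
        \<le> (\<integral>\<omega>. (d (X \<omega>))\<^sup>2 \<partial>P)"
      using CF.integral_centered_square_le[OF dX] by simp
    also have "\<dots> = (\<integral>x. (d x)\<^sup>2 \<partial>CF.law)"
      by (rule integral_distr[symmetric]) measurable
    finally show "(\<integral>\<omega>. (G.S a (- h n) \<omega> - CF.residual a \<omega>)\<^sup>2 \<partial>P) \<le> 1 / 8 ^ n"
      using d_le by simp
  qed
qed

text \<open>
  The function \<open>r\<close> is \<open>v \<mapsto> lim (h n \<bullet> (v - \<beta>)) + a \<bullet> \<alpha>\<close>. On the side of \<open>P\<close>, this limit is evaluated along
  \<open>\<phi> (X)\<close>. On the side of \<open>Q\<close>, the variable \<open>Z = a \<bullet> U - r (V)\<close> is independent of \<open>V\<close>, centred, and has the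
  second moment of the residual; integrating \<open>Z\<close> and \<open>Z\<^sup>2\<close> over events that depend on \<open>V\<close> identifies the
  conditional mean and variance.
\<close>

lemma regression_function:
  obtains r where "r \<in> borel_measurable borel"
    and "AE x in CF.law. r (\<phi> x) = a \<bullet> CF.m x"
    and "AE v in CG.law. a \<bullet> CG.m v = r v"
    and "AE v in CG.law. blinfun_apply (CG.C v) a \<bullet> a = (\<integral>\<omega>. (CF.residual a \<omega>)\<^sup>2 \<partial>P)"
proof -
  define R where "R \<omega> = CF.residual a \<omega>" for \<omega>
  obtain h where h: "\<And>n. (\<integral>\<omega>. (G.S a (- h n) \<omega> - R \<omega>)\<^sup>2 \<partial>P) \<le> 1 / 8 ^ n"
    unfolding R_def by (rule residual_approximation) blast
  have mX: "square_integrable P (\<lambda>\<omega>. CF.m (X \<omega>))"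
    by (simp add: CF.square_integrable_compose_X CF.square_integrable_cond_mean)
  have R: "square_integrable P R"
    unfolding R_def[abs_def] by (intro square_integrable_inner square_integrable_diff G.A mX)
  have orth: "(\<integral>\<omega>. R \<omega> * (k \<bullet> (\<phi> (X \<omega>) - \<beta>)) \<partial>P) = 0" for k
  proof -
    let ?g = "\<lambda>x. k \<bullet> (\<phi> x - \<beta>)"
    have g: "square_integrable CF.law ?g"
      by (intro square_integrable_inner square_integrable_diff square_integrable_\<phi> CF.law.square_integrable_const)
    then have gX: "square_integrable P (\<lambda>\<omega>. ?g (X \<omega>))"
      using CF.square_integrable_compose_X[of ?g] by simp
    have "(\<integral>\<omega>. R \<omega> * ?g (X \<omega>) \<partial>P) = (\<integral>\<omega>. (a \<bullet> \<psi> (Y \<omega>)) * ?g (X \<omega>) - (a \<bullet> CF.m (X \<omega>)) * ?g (X \<omega>) \<partial>P)"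
      by (simp add: R_def inner_diff_right left_diff_distrib)
    also have "\<dots> = (\<integral>\<omega>. (a \<bullet> \<psi> (Y \<omega>)) * ?g (X \<omega>) \<partial>P) - (\<integral>\<omega>. (a \<bullet> CF.m (X \<omega>)) * ?g (X \<omega>) \<partial>P)"
      by (intro Bochner_Integration.integral_diff square_integrable_mult_integrable gX
          square_integrable_inner[OF G.A] square_integrable_inner[OF mX])
    also have "\<dots> = 0"
      using CF.cond_mean_projection[OF _ g] by simp
    finally show ?thesis .
  qed
  define r0 where "r0 v = lim (\<lambda>n. h n \<bullet> (v - \<beta>))" for v
  note reg = G.linear_regression_limit[OF R orth h, folded r0_def]
  have r0m [measurable]: "r0 \<in> borel_measurable borel"
    by (rule reg(1))
  define r where "r v = r0 v + a \<bullet> \<alpha>" for v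
  have rm [measurable]: "r \<in> borel_measurable borel"
    unfolding r_def[abs_def] by measurable
  have "AE \<omega> in P. r (\<phi> (X \<omega>)) = a \<bullet> CF.m (X \<omega>)"
    using reg(2)
  proof eventually_elim
    case (elim \<omega>)
    then have "(\<lambda>n. a \<bullet> (\<psi> (Y \<omega>) - \<alpha>) - G.S a (- h n) \<omega>) \<longlonglongrightarrow> a \<bullet> (\<psi> (Y \<omega>) - \<alpha>) - R \<omega>"
      by (intro tendsto_intros)
    then have "(\<lambda>n. h n \<bullet> (\<phi> (X \<omega>) - \<beta>)) \<longlonglongrightarrow> a \<bullet> CF.m (X \<omega>) - a \<bullet> \<alpha>"
      by (simp add: G.S_def R_def inner_diff_right)
    then show ?case
      by (simp add: r_def r0_def limI)
  qed
  then have P_side: "AE x in CF.law. r (\<phi> x) = a \<bullet> CF.m x"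
    by (rule CF.AE_law_eqI[OF measurable_compose[OF \<phi> rm] CF.cond_mean_inner_measurable])
  define Z where "Z \<omega> = a \<bullet> (U \<omega> - \<alpha>) - r0 (V \<omega>)" for \<omega>
  have Zm [measurable]: "Z \<in> borel_measurable Q"
    unfolding Z_def[abs_def] by measurable
  define s where "s = (\<integral>\<omega>. (R \<omega>)\<^sup>2 \<partial>P)"
  have Z_law: "distr Q borel Z = normal_law 0 s"
    using reg(4) unfolding Z_def[abs_def] s_def by simp
  have s0: "0 \<le> s" by (simp add: s_def)
  note mom = normal_law_moments[OF s0, of 0, folded Z_law]
  have Z: "square_integrable Q Z"
    unfolding square_integrable_def using mom(1) by (subst (asm) integrable_distr_eq) auto
  have Z1: "integrable Q Z" and Z2: "integrable Q (\<lambda>\<omega>. (Z \<omega>)\<^sup>2)"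
    using CG.square_integrable_integrable[OF Z] square_integrable_power2[OF Z] by simp_all
  have EZ: "(\<integral>\<omega>. Z \<omega> \<partial>Q) = 0"
    using mom(4) by (subst (asm) integral_distr) auto
  have EZ2: "(\<integral>\<omega>. (Z \<omega>)\<^sup>2 \<partial>Q) = s"
    using mom(2) by (subst (asm) integral_distr) auto
  have indep: "CG.indep_var borel Z borel (\<lambda>\<omega>. indicator S (V \<omega>) :: real)"
    if [measurable]: "S \<in> sets borel" for S
    unfolding Z_def[abs_def] by (rule reg(3)) simp
  have ind: "integrable Q (\<lambda>\<omega>. indicator S (V \<omega>) :: real)" if [measurable]: "S \<in> sets borel" for S
    by (rule CG.integrable_const_bound[of _ 1]) (auto simp: indicator_def)
  have EZS: "(\<integral>\<omega>. Z \<omega> * indicator S (V \<omega>) \<partial>Q) = 0" if "S \<in> sets borel" for S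
    using CG.indep_var_lebesgue_integral[OF indep[OF that] Z1 ind[OF that]] by (simp add: EZ)
  have EZ2S: "(\<integral>\<omega>. (Z \<omega>)\<^sup>2 * indicator S (V \<omega>) \<partial>Q) = s * (\<integral>\<omega>. indicator S (V \<omega>) \<partial>Q)" if "S \<in> sets borel" for S
  proof -
    have "CG.indep_var borel ((\<lambda>z. z\<^sup>2) \<circ> Z) borel ((\<lambda>x. x) \<circ> (\<lambda>\<omega>. indicator S (V \<omega>) :: real))"
      by (rule CG.indep_var_compose[OF indep[OF that]]) auto
    then have "CG.indep_var borel (\<lambda>\<omega>. (Z \<omega>)\<^sup>2) borel (\<lambda>\<omega>. indicator S (V \<omega>) :: real)"
      by (simp add: comp_def)
    from CG.indep_var_lebesgue_integral[OF this Z2 ind[OF that]] show ?thesis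
      by (simp add: EZ2)
  qed
  have r0V: "square_integrable Q (\<lambda>\<omega>. r (V \<omega>))"
  proof -
    have "square_integrable Q (\<lambda>\<omega>. a \<bullet> U \<omega> - Z \<omega>)"
      by (intro square_integrable_diff square_integrable_inner CG.square_integrable_\<psi>Y Z)
    then show ?thesis by (simp add: Z_def r_def inner_diff_right algebra_simps)
  qed
  have Q_mean: "AE v in CG.law. a \<bullet> CG.m v = r v"
  proof (rule CG.AE_cond_mean_eqI[OF rm CG.square_integrable_integrable[OF r0V]])
    fix S :: "'h set" assume S [measurable]: "S \<in> sets borel"
    have indV: "square_integrable Q (\<lambda>\<omega>. indicator S (V \<omega>) :: real)"
      by (rule square_integrable_bound[OF CG.square_integrable_const[of "1::real"], where K=1])
         (auto simp: indicator_def)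
    have "(\<integral>\<omega>. (a \<bullet> U \<omega>) * indicator S (V \<omega>) \<partial>Q)
        = (\<integral>\<omega>. Z \<omega> * indicator S (V \<omega>) + r (V \<omega>) * indicator S (V \<omega>) \<partial>Q)"
      by (intro Bochner_Integration.integral_cong refl) (simp add: Z_def r_def inner_diff_right algebra_simps)
    also have "\<dots> = (\<integral>\<omega>. Z \<omega> * indicator S (V \<omega>) \<partial>Q) + (\<integral>\<omega>. r (V \<omega>) * indicator S (V \<omega>) \<partial>Q)"
      by (intro Bochner_Integration.integral_add square_integrable_mult_integrable indV Z r0V)
    finally show "(\<integral>\<omega>. (a \<bullet> U \<omega>) * indicator S (V \<omega>) \<partial>Q) = (\<integral>\<omega>. r (V \<omega>) * indicator S (V \<omega>) \<partial>Q)"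
      by (simp add: EZS)
  qed
  then have mV: "AE \<omega> in Q. a \<bullet> CG.m (V \<omega>) = r (V \<omega>)"
    by (rule CG.AE_law_eqD[OF CG.cond_mean_inner_measurable rm])
  have Q_var: "AE v in CG.law. blinfun_apply (CG.C v) a \<bullet> a = s"
  proof (rule density_unique_real[OF CG.cond_cov_disintegration(1)])
    show "integrable CG.law (\<lambda>_. s)" by simp
    fix S assume "S \<in> sets CG.law"
    then have S [measurable]: "S \<in> sets borel" by simp
    have "(LINT v:S|CG.law. blinfun_apply (CG.C v) a \<bullet> a)
        = (\<integral>\<omega>. indicator S (V \<omega>) * (CG.residual a \<omega> * CG.residual a \<omega>) \<partial>Q)"
      by (rule CG.cond_cov_disintegration(2)[OF S])
    also have "\<dots> = (\<integral>\<omega>. (Z \<omega>)\<^sup>2 * indicator S (V \<omega>) \<partial>Q)"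
    proof (rule integral_cong_AE)
      show "AE \<omega> in Q. indicator S (V \<omega>) * (CG.residual a \<omega> * CG.residual a \<omega>)
          = (Z \<omega>)\<^sup>2 * indicator S (V \<omega>)"
        using mV
      proof eventually_elim
        case (elim \<omega>)
        then have "CG.residual a \<omega> = Z \<omega>"
          by (simp add: Z_def r_def inner_diff_right)
        then show ?case by (simp add: power2_eq_square)
      qed
    qed measurable
    also have "\<dots> = s * (\<integral>w. indicator S w \<partial>CG.law)"
      unfolding EZ2S[OF S] by (subst integral_distr) auto
    also have "\<dots> = (LINT w:S|CG.law. s)"
      by (simp add: set_lebesgue_integral_def)
    finally show "(LINT v:S|CG.law. blinfun_apply (CG.C v) a \<bullet> a) = (LINT w:S|CG.law. s)" .
  qed
  show thesis
    by (rule that[OF rm P_side Q_mean]) (use Q_var in \<open>simp add: s_def R_def\<close>)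
qed

text \<open>
  Both operators have the same quadratic form at the countably many vectors \<open>e i + e j\<close>, outside a single null
  set.
\<close>

lemma gaussian_cond_cov_constant:
  assumes I: "\<And>a b. blinfun_apply I a \<bullet> b
      = (\<integral>\<omega>. CF.residual a \<omega> * CF.residual b \<omega> \<partial>P)"
  shows "AE v in CG.law. CG.C v = I"
proof -
  obtain e :: "nat \<Rightarrow> 'g" where e: "\<And>v. (\<lambda>n. \<Sum>i<n. (v \<bullet> e i) *\<^sub>R e i) \<longlonglongrightarrow> v"
    by (rule obtain_parseval_frame) blast
  have quad: "AE v in CG.law. blinfun_apply (CG.C v) a \<bullet> a = blinfun_apply I a \<bullet> a" for a
  proof -
    have "blinfun_apply I a \<bullet> a = (\<integral>\<omega>. (CF.residual a \<omega>)\<^sup>2 \<partial>P)"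
      by (simp add: I power2_eq_square)
    then show ?thesis
      using regression_function[of a] by metis
  qed
  have "AE v in CG.law. \<forall>i j. blinfun_apply (CG.C v) (e i + e j) \<bullet> (e i + e j)
      = blinfun_apply I (e i + e j) \<bullet> (e i + e j)"
    by (intro AE_all_countable[THEN iffD2] allI quad)
  then show ?thesis
    using CG.AE_dom
  proof eventually_elim
    case (elim v)
    show ?case
    proof (rule symmetric_blinfun_eqI[OF e])
      show "blinfun_apply (CG.C v) a \<bullet> b = blinfun_apply (CG.C v) b \<bullet> a" for a b
        by (simp add: CG.cond_cov_inner[OF elim(2)] mult.commute)
      show "blinfun_apply I a \<bullet> b = blinfun_apply I b \<bullet> a" for a b
        by (simp add: I mult.commute)
    qed (use elim(1) in simp)
  qed
qed

text \<open>
  For almost every \<open>x\<close>, the mean of \<open>\<kappa> x\<close> has the coordinates \<open>r i (\<phi> x)\<close>; so do the mean of \<open>\<gamma> v\<close> at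
  \<open>v = \<phi> x\<close>, outside a null set of \<open>v\<close>, and, by the tower property, the mean of the conditional law \<open>\<tau> v\<close> of \<open>Y\<close> given
  \<open>\<phi> (X) = v\<close>. Replacing \<open>\<kappa> x\<close> by \<open>\<tau> (\<phi> x)\<close> on the null set of bad points \<open>x\<close> leaves exceptional sets in \<open>'h\<close> only.
\<close>

lemma gaussian_cond_mean_version:
  assumes MY: "borel_iso_space MY"
  shows "\<exists>\<kappa>'. is_rcd P MX MY X Y \<kappa>' \<and> (AE x in CF.law. \<kappa>' x = \<kappa> x)
    \<and> (\<exists>N1\<in>null_sets (distr P borel (\<lambda>\<omega>. \<phi> (X \<omega>))). \<exists>N2\<in>null_sets CG.law.
         \<forall>x\<in>space MX. \<phi> x \<notin> N1 \<union> N2 \<longrightarrow> (\<integral>u. u \<partial>\<gamma> (\<phi> x)) = cond_mean MX \<kappa>' \<psi> x)"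
proof -
  obtain e :: "nat \<Rightarrow> 'g" where e: "\<And>v. (\<lambda>n. \<Sum>i<n. (v \<bullet> e i) *\<^sub>R e i) \<longlonglongrightarrow> v"
    by (rule obtain_parseval_frame) blast
  have "\<forall>i. \<exists>r. r \<in> borel_measurable borel \<and> (AE x in CF.law. r (\<phi> x) = e i \<bullet> CF.m x)
      \<and> (AE v in CG.law. e i \<bullet> CG.m v = r v)"
  proof
    fix i :: nat
    obtain r where "r \<in> borel_measurable borel" "AE x in CF.law. r (\<phi> x) = e i \<bullet> CF.m x"
        "AE v in CG.law. e i \<bullet> CG.m v = r v"
      by (rule regression_function)
    then show "\<exists>r. r \<in> borel_measurable borel \<and> (AE x in CF.law. r (\<phi> x) = e i \<bullet> CF.m x)
      \<and> (AE v in CG.law. e i \<bullet> CG.m v = r v)"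
      by blast
  qed
  from choice[OF this] obtain r where r_all: "\<forall>i. r i \<in> borel_measurable borel \<and>
      (AE x in CF.law. r i (\<phi> x) = e i \<bullet> CF.m x) \<and> (AE v in CG.law. e i \<bullet> CG.m v = r i v)"
    by blast
  have r [measurable]: "r i \<in> borel_measurable borel"
    and rX: "AE x in CF.law. r i (\<phi> x) = e i \<bullet> CF.m x"
    and rV: "AE v in CG.law. e i \<bullet> CG.m v = r i v" for i
    using r_all by blast+
  have \<phi>X [measurable]: "(\<lambda>\<omega>. \<phi> (X \<omega>)) \<in> P \<rightarrow>\<^sub>M borel" by measurable
  obtain \<tau> where \<tau>: "is_rcd P borel MY (\<lambda>\<omega>. \<phi> (X \<omega>)) Y \<tau>"
    using CF.rcd_exists[OF MY \<phi>X CF.Y] by blast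
  interpret CK: conditional_feature P borel MY "\<lambda>\<omega>. \<phi> (X \<omega>)" Y \<tau> \<psi>
    by (intro conditional_feature.intro conditional_law.intro conditional_law_axioms.intro
        conditional_feature_axioms.intro CF.prob_space_axioms \<phi>X CF.Y \<tau> CF.\<psi> CF.square_integrable_\<psi>Y)
  have rK: "AE v in CK.law. e i \<bullet> CK.m v = r i v" for i
  proof (rule CK.AE_cond_mean_eqI[OF r])
    have rP: "AE \<omega> in P. r i (\<phi> (X \<omega>)) = e i \<bullet> CF.m (X \<omega>)"
      by (rule CF.AE_law_eqD[OF measurable_compose[OF \<phi> r] CF.cond_mean_inner_measurable rX])
    have mX: "square_integrable P (\<lambda>\<omega>. e i \<bullet> CF.m (X \<omega>))"
      by (rule square_integrable_inner) (simp add: CF.square_integrable_compose_X CF.square_integrable_cond_mean)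
    show "integrable P (\<lambda>\<omega>. r i (\<phi> (X \<omega>)))"
      using CF.square_integrable_integrable[OF mX] rP by (subst integrable_cong_AE) auto
    fix S :: "'h set" assume S [measurable]: "S \<in> sets borel"
    have indX: "square_integrable CF.law (\<lambda>x. indicator S (\<phi> x) :: real)"
      by (rule square_integrable_bound[OF CF.law.square_integrable_const[of "1::real"], where K=1])
         (auto simp: indicator_def)
    have "(\<integral>\<omega>. (e i \<bullet> \<psi> (Y \<omega>)) * indicator S (\<phi> (X \<omega>)) \<partial>P)
        = (\<integral>\<omega>. (e i \<bullet> CF.m (X \<omega>)) * indicator S (\<phi> (X \<omega>)) \<partial>P)"
      by (rule CF.cond_mean_projection[OF _ indX]) simp
    also have "\<dots> = (\<integral>\<omega>. r i (\<phi> (X \<omega>)) * indicator S (\<phi> (X \<omega>)) \<partial>P)"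
    proof (rule integral_cong_AE)
      show "AE \<omega> in P. (e i \<bullet> CF.m (X \<omega>)) * indicator S (\<phi> (X \<omega>)) = r i (\<phi> (X \<omega>)) * indicator S (\<phi> (X \<omega>))"
        using rP by eventually_elim simp
    qed measurable
    finally show "(\<integral>\<omega>. (e i \<bullet> \<psi> (Y \<omega>)) * indicator S (\<phi> (X \<omega>)) \<partial>P)
        = (\<integral>\<omega>. r i (\<phi> (X \<omega>)) * indicator S (\<phi> (X \<omega>)) \<partial>P)" .
  qed
  have "AE x in CF.law. x \<in> CF.domY \<and> (\<forall>i. r i (\<phi> x) = e i \<bullet> CF.m x)"
    using CF.AE_dom AE_all_countable[THEN iffD2, OF allI, OF rX] by eventually_elim simp
  then obtain N where notN: "\<And>x. x \<in> space CF.law - N \<Longrightarrow> x \<in> CF.domY \<and> (\<forall>i. r i (\<phi> x) = e i \<bullet> CF.m x)"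
      and N_null: "N \<in> null_sets CF.law"
    by (rule AE_E3) (rule that)
  have N [measurable]: "N \<in> sets MX"
    using N_null by auto
  have "AE v in CK.law. v \<in> CK.domY \<and> (\<forall>i. e i \<bullet> CK.m v = r i v)"
    using CK.AE_dom AE_all_countable[THEN iffD2, OF allI, OF rK] by eventually_elim simp
  then obtain N1 where notN1: "\<And>v. v \<in> space CK.law - N1 \<Longrightarrow> v \<in> CK.domY \<and> (\<forall>i. e i \<bullet> CK.m v = r i v)"
      and N1: "N1 \<in> null_sets CK.law"
    by (rule AE_E3) (rule that)
  have "AE v in CG.law. v \<in> CG.domY \<and> (\<forall>i. e i \<bullet> CG.m v = r i v)"
    using CG.AE_dom AE_all_countable[THEN iffD2, OF allI, OF rV] by eventually_elim simp
  then obtain N2 where notN2: "\<And>v. v \<in> space CG.law - N2 \<Longrightarrow> v \<in> CG.domY \<and> (\<forall>i. e i \<bullet> CG.m v = r i v)"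
      and N2: "N2 \<in> null_sets CG.law"
    by (rule AE_E3) (rule that)
  define \<kappa>' where "\<kappa>' x = (if x \<in> N then \<tau> (\<phi> x) else \<kappa> x)" for x
  have AE_\<kappa>': "AE x in CF.law. \<kappa>' x = \<kappa> x"
    using AE_not_in[OF N_null] by eventually_elim (simp add: \<kappa>'_def)
  have rcd': "is_rcd P MX MY X Y \<kappa>'"
    unfolding is_rcd_def
  proof (intro conjI ballI)
    have [measurable]: "\<kappa> \<in> MX \<rightarrow>\<^sub>M prob_algebra MY" "\<tau> \<in> borel \<rightarrow>\<^sub>M prob_algebra MY"
      using CF.rcd \<tau> by (auto simp: is_rcd_def)
    show "\<kappa>' \<in> MX \<rightarrow>\<^sub>M prob_algebra MY"
      unfolding \<kappa>'_def[abs_def] by measurable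
    fix S T assume "S \<in> sets MX" "T \<in> sets MY"
    then have "emeasure P {\<omega>\<in>space P. X \<omega> \<in> S \<and> Y \<omega> \<in> T} = (\<integral>\<^sup>+x\<in>S. emeasure (\<kappa> x) T \<partial>CF.law)"
      using CF.rcd by (simp add: is_rcd_def)
    also have "\<dots> = (\<integral>\<^sup>+x\<in>S. emeasure (\<kappa>' x) T \<partial>CF.law)"
      using AE_\<kappa>' by (intro nn_integral_cong_AE, eventually_elim) simp
    finally show "emeasure P {\<omega>\<in>space P. X \<omega> \<in> S \<and> Y \<omega> \<in> T} = (\<integral>\<^sup>+x\<in>S. emeasure (\<kappa>' x) T \<partial>CF.law)" .
  qed
  have "(\<integral>u. u \<partial>\<gamma> (\<phi> x)) = cond_mean MX \<kappa>' \<psi> x" if x: "x \<in> space MX" and xN: "\<phi> x \<notin> N1 \<union> N2" for x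
  proof -
    have "(\<integral>u. u \<partial>\<gamma> (\<phi> x)) = CG.m (\<phi> x)"
      using notN2[of "\<phi> x"] xN by (simp add: cond_mean_def)
    also have "\<dots> = cond_mean MX \<kappa>' \<psi> x"
    proof (cases "x \<in> N")
      case True
      then have "cond_mean MX \<kappa>' \<psi> x = CK.m (\<phi> x)"
        using x by (simp add: cond_mean_def cond_domain_def \<kappa>'_def)
      moreover have "CG.m (\<phi> x) = CK.m (\<phi> x)"
        by (rule frame_vector_eqI[OF e]) (use notN1[of "\<phi> x"] notN2[of "\<phi> x"] xN in simp)
      ultimately show ?thesis by simp
    next
      case False
      then have "cond_mean MX \<kappa>' \<psi> x = CF.m x"
        by (simp add: cond_mean_def cond_domain_def \<kappa>'_def)
      moreover have "CG.m (\<phi> x) = CF.m x"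
        by (rule frame_vector_eqI[OF e]) (use notN[of x] x False notN2[of "\<phi> x"] xN in simp)
      ultimately show ?thesis by simp
    qed
    finally show ?thesis .
  qed
  with rcd' AE_\<kappa>' N1 N2 show ?thesis
    by blast
qed

end

theorem theorem7p1:
  fixes P :: "'w measure" and MX :: "'x measure" and MY :: "'y measure"
    and X :: "'w \<Rightarrow> 'x" and Y :: "'w \<Rightarrow> 'y"
    and k :: "'x \<Rightarrow> 'x \<Rightarrow> real" and l :: "'y \<Rightarrow> 'y \<Rightarrow> real"
    and evH :: "'h::{real_inner,banach,second_countable_topology} \<Rightarrow> 'x \<Rightarrow> real"
    and evG :: "'g::{real_inner,banach,second_countable_topology} \<Rightarrow> 'y \<Rightarrow> real"
    and \<phi> :: "'x \<Rightarrow> 'h" and \<psi> :: "'y \<Rightarrow> 'g"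
    and \<kappa> :: "'x \<Rightarrow> 'y measure"
    and Q :: "'v measure" and U :: "'v \<Rightarrow> 'g" and V :: "'v \<Rightarrow> 'h"
    and \<gamma> :: "'h \<Rightarrow> 'g measure"
  assumes "prob_space P"
    and "borel_iso_space MY"
    and "psd_kernel (space MX) k"
    and "psd_kernel (space MY) l"
    and "\<forall>x\<in>space MX. k x \<in> borel_measurable MX"
    and "\<forall>y\<in>space MY. l y \<in> borel_measurable MY"
    and "is_rkhs (space MX) k evH \<phi>"
    and "is_rkhs (space MY) l evG \<psi>"
    and "X \<in> P \<rightarrow>\<^sub>M MX"
    and "Y \<in> P \<rightarrow>\<^sub>M MY"
    and "is_rcd P MX MY X Y \<kappa>"
    and "(\<integral>\<^sup>+\<omega>. ennreal ((norm (\<phi> (X \<omega>)))\<^sup>2 + (norm (\<psi> (Y \<omega>)))\<^sup>2) \<partial>P) < \<infinity>"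
    and "\<forall>h. (AE x in distr P MX X. evH h x = 0) \<longleftrightarrow> h = 0"
    and "\<forall>g. \<exists>hg\<in>L2_closure (distr P MX X) evH. \<exists>c.
           AE x in distr P MX X. hg x = cond_fun MX \<kappa> \<psi> evG g x - c"
    and "prob_space Q"
    and "(\<lambda>\<omega>. (U \<omega>, V \<omega>)) \<in> borel_measurable Q"
    and "gaussian_measure (distr Q borel (\<lambda>\<omega>. (U \<omega>, V \<omega>)))
           ((\<integral>\<omega>. \<psi> (Y \<omega>) \<partial>P), (\<integral>\<omega>. \<phi> (X \<omega>) \<partial>P))
           (block_op
              (blinfun_apply (Cov P (\<lambda>\<omega>. \<psi> (Y \<omega>)) (\<lambda>\<omega>. \<psi> (Y \<omega>))))
              (adjoint (blinfun_apply (Cov P (\<lambda>\<omega>. \<phi> (X \<omega>)) (\<lambda>\<omega>. \<psi> (Y \<omega>)))))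
              (blinfun_apply (Cov P (\<lambda>\<omega>. \<phi> (X \<omega>)) (\<lambda>\<omega>. \<psi> (Y \<omega>))))
              (blinfun_apply (Cov P (\<lambda>\<omega>. \<phi> (X \<omega>)) (\<lambda>\<omega>. \<phi> (X \<omega>)))))"
    and "is_rcd Q borel borel V U \<gamma>"
  shows "(AE v in distr Q borel V.
            has_banach_integral P (\<lambda>\<omega>. cond_cov MX \<kappa> \<psi> (X \<omega>)) (Cov (\<gamma> v) (\<lambda>u. u) (\<lambda>u. u))
            \<and> has_banach_integral (distr P MX X) (cond_cov MX \<kappa> \<psi>) (Cov (\<gamma> v) (\<lambda>u. u) (\<lambda>u. u)))
         \<and> (\<exists>\<kappa>'. is_rcd P MX MY X Y \<kappa>' \<and> (AE x in distr P MX X. \<kappa>' x = \<kappa> x)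
              \<and> (\<exists>N1\<in>null_sets (distr P borel (\<lambda>\<omega>. \<phi> (X \<omega>))). \<exists>N2\<in>null_sets (distr Q borel V).
                   \<forall>x\<in>space MX. \<phi> x \<notin> N1 \<union> N2 \<longrightarrow> (\<integral>u. u \<partial>\<gamma> (\<phi> x)) = cond_mean MX \<kappa>' \<psi> x))"
proof -
  interpret P: prob_space P by fact
  interpret Q: prob_space Q by fact
  have rkhsH: "evH h x = h \<bullet> \<phi> x" if "x \<in> space MX" for h x
    using assms(7) that unfolding is_rkhs_def by blast
  have rkhsG: "evG g y = g \<bullet> \<psi> y" if "y \<in> space MY" for g y
    using assms(8) that unfolding is_rkhs_def by blast
  have \<phi> [measurable]: "\<phi> \<in> borel_measurable MX"
    using rkhs_feature_measurable[OF assms(7)] assms(5) by blast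
  have \<psi> [measurable]: "\<psi> \<in> borel_measurable MY"
    using rkhs_feature_measurable[OF assms(8)] assms(6) by blast
  note X [measurable] = assms(9) and Y [measurable] = assms(10)
  have sum: "integrable P (\<lambda>\<omega>. (norm (\<phi> (X \<omega>)))\<^sup>2 + (norm (\<psi> (Y \<omega>)))\<^sup>2)"
    using assms(12) by (intro integrableI_nonneg) (auto simp: less_top)
  have sq\<psi>: "square_integrable P (\<lambda>\<omega>. \<psi> (Y \<omega>))"
    unfolding square_integrable_def
    by (intro conjI Bochner_Integration.integrable_bound[OF sum]) auto
  have sq\<phi>: "square_integrable P (\<lambda>\<omega>. \<phi> (X \<omega>))"
    unfolding square_integrable_def
    by (intro conjI Bochner_Integration.integrable_bound[OF sum]) auto
  have U [measurable]: "U \<in> borel_measurable Q"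
    using borel_measurable_continuous_on[OF continuous_on_fst[OF continuous_on_id] assms(16)] by simp
  have V [measurable]: "V \<in> borel_measurable Q"
    using borel_measurable_continuous_on[OF continuous_on_snd[OF continuous_on_id] assms(16)] by simp
  define \<alpha> where "\<alpha> = (\<integral>\<omega>. \<psi> (Y \<omega>) \<partial>P)"
  define \<beta> where "\<beta> = (\<integral>\<omega>. \<phi> (X \<omega>) \<partial>P)"
  let ?A = "\<lambda>\<omega>. \<psi> (Y \<omega>)" and ?B = "\<lambda>\<omega>. \<phi> (X \<omega>)"
  let ?cA = "\<lambda>\<omega>. \<psi> (Y \<omega>) - \<alpha>" and ?cB = "\<lambda>\<omega>. \<phi> (X \<omega>) - \<beta>"
  have cA: "square_integrable P ?cA" and cB: "square_integrable P ?cB"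
    by (intro square_integrable_diff sq\<psi> sq\<phi> P.square_integrable_const)+
  have joint: "distr Q borel (\<lambda>\<omega>. a \<bullet> U \<omega> + h \<bullet> V \<omega>) =
        normal_law (a \<bullet> \<alpha> + h \<bullet> \<beta>) (\<integral>\<omega>. (a \<bullet> ?cA \<omega> + h \<bullet> ?cB \<omega>)\<^sup>2 \<partial>P)" for a h
  proof -
    let ?L = "blinfun_apply (Cov P ?B ?A)"
    let ?C = "block_op (blinfun_apply (Cov P ?A ?A)) (adjoint ?L) ?L (blinfun_apply (Cov P ?B ?B))"
    have "?L x \<bullet> y = x \<bullet> blinfun_apply (Cov P ?A ?B) y" for x y
      unfolding inner_commute[of x] P.Cov_inner[OF sq\<phi> sq\<psi>] P.Cov_inner[OF sq\<psi> sq\<phi>]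
      by (simp add: mult.commute)
    (* An adjoint exists, so the choice operator behind adjoint returns one. *)
    then have "\<exists>f. \<forall>x y. ?L x \<bullet> y = x \<bullet> f y"
      by blast
    then have adj: "\<forall>x y. ?L x \<bullet> y = x \<bullet> adjoint ?L y"
      unfolding adjoint_def by (rule someI_ex)
    have i: "integrable P (\<lambda>\<omega>. (a \<bullet> ?cA \<omega>)\<^sup>2)" "integrable P (\<lambda>\<omega>. (h \<bullet> ?cB \<omega>)\<^sup>2)"
        "integrable P (\<lambda>\<omega>. (a \<bullet> ?cA \<omega>) * (h \<bullet> ?cB \<omega>))"
      by (rule square_integrable_power2[OF square_integrable_inner[OF cA]]
          square_integrable_power2[OF square_integrable_inner[OF cB]]
          square_integrable_mult_integrable[OF square_integrable_inner[OF cA] square_integrable_inner[OF cB]])+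
    have "?C (a, h) \<bullet> (a, h) = blinfun_apply (Cov P ?A ?A) a \<bullet> a + 2 * (?L a \<bullet> h) + blinfun_apply (Cov P ?B ?B) h \<bullet> h"
      using adj by (simp add: block_op_def inner_add_left inner_commute[of "adjoint ?L h"])
    also have "\<dots> = (\<integral>\<omega>. (a \<bullet> ?cA \<omega>)\<^sup>2 \<partial>P) + 2 * (\<integral>\<omega>. (a \<bullet> ?cA \<omega>) * (h \<bullet> ?cB \<omega>) \<partial>P) + (\<integral>\<omega>. (h \<bullet> ?cB \<omega>)\<^sup>2 \<partial>P)"
      unfolding P.Cov_inner[OF sq\<phi> sq\<psi>] P.Cov_inner[OF sq\<psi> sq\<psi>] P.Cov_inner[OF sq\<phi> sq\<phi>]
      by (simp add: \<alpha>_def \<beta>_def power2_eq_square)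
    also have "\<dots> = (\<integral>\<omega>. ((a \<bullet> ?cA \<omega>)\<^sup>2 + 2 * ((a \<bullet> ?cA \<omega>) * (h \<bullet> ?cB \<omega>))) + (h \<bullet> ?cB \<omega>)\<^sup>2 \<partial>P)"
      using i by simp
    also have "\<dots> = (\<integral>\<omega>. (a \<bullet> ?cA \<omega> + h \<bullet> ?cB \<omega>)\<^sup>2 \<partial>P)"
      by (intro Bochner_Integration.integral_cong refl) (simp add: power2_sum)
    finally have var: "?C (a, h) \<bullet> (a, h) = (\<integral>\<omega>. (a \<bullet> ?cA \<omega> + h \<bullet> ?cB \<omega>)\<^sup>2 \<partial>P)" .
    have "distr Q borel (\<lambda>\<omega>. a \<bullet> U \<omega> + h \<bullet> V \<omega>)
        = distr (distr Q borel (\<lambda>\<omega>. (U \<omega>, V \<omega>))) borel (\<lambda>z. (a, h) \<bullet> z)"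
      using assms(16) by (subst distr_distr) (simp_all add: comp_def)
    also have "\<dots> = normal_law ((a, h) \<bullet> (\<alpha>, \<beta>)) (?C (a, h) \<bullet> (a, h))"
      using assms(17) unfolding gaussian_measure_def \<alpha>_def \<beta>_def by blast
    finally show ?thesis
      unfolding var by simp
  qed
  interpret G: gaussian_pair P Q ?A ?B U V \<alpha> \<beta>
    by (intro gaussian_pair.intro gaussian_pair_axioms.intro P.prob_space_axioms Q.prob_space_axioms
        sq\<psi> sq\<phi> U V \<alpha>_def \<beta>_def joint)
  interpret CF: conditional_feature P MX MY X Y \<kappa> \<psi>
    by (intro conditional_feature.intro conditional_law.intro conditional_law_axioms.intro
        conditional_feature_axioms.intro P.prob_space_axioms X Y assms(11) \<psi> sq\<psi>)
  interpret CG: conditional_feature Q borel borel V U \<gamma> "\<lambda>u. u"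
    by (intro conditional_feature.intro conditional_law.intro conditional_law_axioms.intro
        conditional_feature_axioms.intro Q.prob_space_axioms U V assms(18) measurable_ident_sets refl
        G.U_square_integrable)
  (* The vector h stands for the function x \<mapsto> h \<bullet> \<phi> x, so approximation of f in the
     closure is approximation of a \<bullet> m x - c by such functions. *)
  have approx: "\<exists>c. \<forall>\<epsilon>>0. \<exists>h.
      (\<integral>\<^sup>+x. ennreal ((a \<bullet> CF.m x - c - h \<bullet> \<phi> x)\<^sup>2) \<partial>CF.law) < ennreal \<epsilon>" for a
  proof -
    obtain f c where f: "f \<in> L2_closure CF.law evH"
      and AE_f: "AE x in CF.law. f x = cond_fun MX \<kappa> \<psi> evG a x - c"
      using assms(14) by blast
    have cond_fun: "cond_fun MX \<kappa> \<psi> evG a x = a \<bullet> CF.m x" if x: "x \<in> CF.domY" for x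
    proof -
      have "space (\<kappa> x) = space MY"
        using CF.sets_kernel_eq[OF CF.dom_subset[OF x]] by (rule sets_eq_imp_space_eq)
      then have "(\<integral>y. evG a y \<partial>\<kappa> x) = (\<integral>y. a \<bullet> \<psi> y \<partial>\<kappa> x)"
        by (intro Bochner_Integration.integral_cong refl) (simp add: rkhsG)
      then show ?thesis
        using x by (simp add: cond_fun_def CF.cond_mean_inner)
    qed
    have eq: "(\<integral>\<^sup>+x. ennreal ((a \<bullet> CF.m x - c - h \<bullet> \<phi> x)\<^sup>2) \<partial>CF.law)
        = (\<integral>\<^sup>+x. ennreal ((evH h x - f x)\<^sup>2) \<partial>CF.law)" for h
    proof (rule nn_integral_cong_AE)
      show "AE x in CF.law. ennreal ((a \<bullet> CF.m x - c - h \<bullet> \<phi> x)\<^sup>2) = ennreal ((evH h x - f x)\<^sup>2)"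
        using AE_f CF.AE_dom
      proof eventually_elim
        case (elim x)
        then have "evH h x - f x = - (a \<bullet> CF.m x - c - h \<bullet> \<phi> x)"
          by (simp add: cond_fun rkhsH CF.dom_subset)
        then show ?case by (simp only: power2_minus)
      qed
    qed
    have "\<forall>\<epsilon>>0. \<exists>h. (\<integral>\<^sup>+x. ennreal ((evH h x - f x)\<^sup>2) \<partial>CF.law) < ennreal \<epsilon>"
      using f by (simp add: L2_closure_def)
    then show ?thesis
      by (intro exI[of _ c]) (simp only: eq)
  qed
  interpret R: gaussian_regression P MX MY X Y \<kappa> \<psi> \<phi> Q U V \<gamma> \<alpha> \<beta>
    by (intro gaussian_regression.intro gaussian_regression_axioms.intro CF.conditional_feature_axioms
        CG.conditional_feature_axioms G.gaussian_pair_axioms \<phi> approx)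
  obtain I where I: "has_banach_integral CF.law CF.C I" "has_banach_integral P (\<lambda>\<omega>. CF.C (X \<omega>)) I"
    "\<And>a b. blinfun_apply I a \<bullet> b
       = (\<integral>\<omega>. CF.residual a \<omega> * CF.residual b \<omega> \<partial>P)"
    by (rule CF.expected_cond_cov_exists) (rule that)
  have "AE v in CG.law. has_banach_integral P (\<lambda>\<omega>. CF.C (X \<omega>)) (Cov (\<gamma> v) (\<lambda>u. u) (\<lambda>u. u))
      \<and> has_banach_integral CF.law CF.C (Cov (\<gamma> v) (\<lambda>u. u) (\<lambda>u. u))"
    using R.gaussian_cond_cov_constant[OF I(3)] CG.AE_dom
  proof eventually_elim
    case (elim v)
    then have "Cov (\<gamma> v) (\<lambda>u. u) (\<lambda>u. u) = I"
      by (simp add: cond_cov_def)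
    with I(1,2) show ?case by simp
  qed
  then show ?thesis
    using R.gaussian_cond_mean_version[OF assms(2)] by (rule conjI)
qed

end
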